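(* Let $(N,Q,C_1,C_2,\dots)$ be a nonnegative random vector with $N\in\mathbb N_+\cup\{\infty\}$ and $P(Q>0)>0$, and suppose that for some $\alpha>0$: (a) $E\left[\sum_{i=1}^N C_i^\alpha\right]=1$ and $E\left[\sum_{i=1}^N C_i^\alpha\log C_i\right]\in(0,\infty)$; (b) $E\left[\sum_{i=1}^N C_i^\beta\right]<1$ for some $0<\beta<\alpha$, and $E[Q^\alpha]<\infty$; (c) $P\left(\sum_{i=1}^N C_i^\alpha=0\right)=0$; (d) the probability measure $\eta(dx)=E\left[\sum_{i=1}^N C_i^\alpha 1(\log C_i\in dx)\right]$ is non-arithmetic; (e) $E\left[\left(\sum_{i=1}^N C_i^\alpha\right)\log^+\left(Q^\alpha\vee\sum_{i=1}^N C_i^\alpha\right)\right]<\infty$. Let $R=\bigvee_{\boldsymbol i\in\mathcal T}\Pi_{\boldsymbol i}Q_{\boldsymbol i}$ be the endogenous solution of $R\stackrel{\mathcal D}{=}Q\vee\bigvee_{i=1}^N C_iR_i$, and let $W=\log R=\bigvee_{\boldsymbol i\in\mathcal T}(S_{\boldsymbol i}+Y_{\boldsymbol i})$. Put $\mu=E\left[\sum_{i=1}^N C_i^\alpha\log C_i\right]$. Then $$P(W>t)\sim He^{-\alpha t}\quad\text{as }t\to\infty$$ (i.e. $e^{\alpha t}P(W>t)\to H$), where $$H=\lim_{m\to\infty}\frac{\widetilde E\left[\left(e^{\alpha\xi_m}-e^{\alpha\left(\bigvee_{\boldsymbol i\prec\boldsymbol J_m}(S_{\boldsymbol i}+Y_{\boldsymbol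 i})-V_m\right)}\right)^+D_{\boldsymbol J_m}^{-1}\right]}{\alpha\mu}.$$ If furthermore $E\left[\left(\sum_{i=1}^N C_i\right)^\alpha\right]<\infty$ in the case $\alpha>1$, or $E\left[\left(\sum_{i=1}^N C_i^{\alpha/(1+\epsilon)}\right)^{1+\epsilon}\right]<\infty$ for some $0<\epsilon<1$ in the case $0<\alpha\le1$, then $H>0$.
   Context: Conventions: $\log 0=-\infty$, $e^{-\infty}=0$, $0\cdot\log 0=0$, $x\vee y=\max\{x,y\}$, $x^+=\max\{x,0\}$; a maximum/supremum over the empty set is $-\infty$. Weighted branching tree. Let $U=\bigcup_{k\ge0}\mathbb N_+^k$ be the set of finite sequences of positive integers ($\mathbb N_+^0=\{\emptyset\}$); $|\boldsymbol i|$ is the length of $\boldsymbol i$ and $(\boldsymbol i,j)$ is concatenation. $U$ is ordered length-lexicographically: $\boldsymbol i\prec\boldsymbol j$ if $|\boldsymbol i|<|\boldsymbol j|$, or $|\boldsymbol i|=|\boldsymbol j|$ and at the first coordinate $t$ where they differ $i_t<j_t$. Let $\boldsymbol\psi_{\boldsymbol i}=(N_{\boldsymbol i},Q_{\boldsymbol i},C_{(\boldsymbol i,1)},C_{(\boldsymbol i,2)},\dots)$, $\boldsymbol i\in U$, be i.i.d. copies of $\boldsymbol\psi=(N,Q,C_1,C_2,\dots)$ (arbitrary dependence within the vector is allowed). Let $A_0=\{\emptyset\}$, $A_n=\{(\boldsymbol i,j):\boldsymbol i\in A_{n-1},\,j\in\mathbb N_+,\,1\le j\le N_{\boldsymbol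 i}\}$, $\mathcal T=\bigcup_{n\ge0}A_n$. Let $\Pi_\emptyset=1$, $\Pi_{(\boldsymbol i,j)}=C_{(\boldsymbol i,j)}\Pi_{\boldsymbol i}$, $S_{\boldsymbol i}=\log\Pi_{\boldsymbol i}$, $Y_{\boldsymbol i}=\log Q_{\boldsymbol i}$. Spine. Let $D_{\boldsymbol i}=\sum_{r=1}^{N_{\boldsymbol i}}C_{(\boldsymbol i,r)}^\alpha$. Set $\boldsymbol J_0=\emptyset$ and, conditionally on all the $\{\boldsymbol\psi_{\boldsymbol i}\}$ and on $\boldsymbol J_0,\dots,\boldsymbol J_{k-1}$, let $\boldsymbol J_k=(\boldsymbol J_{k-1},i)$ with probability $C_{(\boldsymbol J_{k-1},i)}^\alpha/D_{\boldsymbol J_{k-1}}$, $1\le i\le N_{\boldsymbol J_{k-1}}$, $k\ge1$. Let $V_k=S_{\boldsymbol J_k}$ (so $V_0=0$) and $\xi_k=Y_{\boldsymbol J_k}$. Change of measure. Let $\mathcal F_k=\sigma(\boldsymbol\psi_{\boldsymbol i}:\boldsymbol i\in A_s,\,s<k)$, $\mathcal G_k=\sigma(\mathcal F_k\cup\sigma(\boldsymbol J_s:s\le k))$ for $k\ge1$, $\mathcal F_0=\mathcal G_0$ trivial, and $L_0=1$, $L_k=\prod_{r=0}^{k-1}D_{\boldsymbol J_r}$, a mean-one nonnegative $(\mathcal G_k)$-martingale under $P$. $\widetilde P$ is the probability measure on $\sigma(\bigcup_k\mathcal G_k)$ with $\widetilde P(A)=E[1(A)L_k]$ for $A\in\mathcal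 G_k$, $k\ge0$; $\widetilde E$ is its expectation. *)

theory Defs
  imports "HOL-Probability.Probability"
begin

section \<open>Extended logarithm, exponential and real powers\<close>

definition elog :: "ennreal \<Rightarrow> ereal" where
  "elog x = (if x = 0 then -\<infinity> else if x = \<infinity> then \<infinity> else ereal (ln (enn2real x)))"

definition eexp :: "ereal \<Rightarrow> ennreal" where
  "eexp x = (if x = -\<infinity> then 0 else if x = \<infinity> then \<infinity> else ennreal (exp (real_of_ereal x)))"

definition elog_pos :: "ennreal \<Rightarrow> ennreal" where
  "elog_pos x = e2ennreal (max 0 (elog x))"

text \<open>Only used for exponents \<open>a > 0\<close>.\<close>
definition epowr :: "ennreal \<Rightarrow> real \<Rightarrow> ennreal" where
  "epowr x a = (if x = \<infinity> then \<infinity> else ennreal (enn2real x powr a))"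

lemma elog_le_iff: "elog x \<le> y \<longleftrightarrow> x \<le> eexp y"
proof (cases x rule: ennreal_cases)
  case (real r)
  show ?thesis
  proof (cases "r = 0")
    case True
    then show ?thesis using real by (simp add: elog_def)
  next
    case False
    then have r: "0 < r" using real by simp
    then have "ln r \<le> z \<longleftrightarrow> r \<le> exp z" for z
      by (metis exp_le_cancel_iff exp_ln)
    then show ?thesis using real r
      by (cases y) (auto simp: elog_def eexp_def ennreal_eq_0_iff)
  qed
next
  case top
  then show ?thesis by (cases y) (auto simp: elog_def eexp_def top_unique)
qed

section \<open>Marks\<close>

text \<open>A mark is a value of the vector \<open>(N, Q, C\<^sub>1, C\<^sub>2, \<dots>)\<close>. Only the arguments \<open>j \<ge> 1\<close> of
  the last component are meaningful; the product measure space over \<open>{1..}\<close> reflects this.\<close>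

type_synonym mark = "enat \<times> real \<times> (nat \<Rightarrow> real)"

definition mN :: "mark \<Rightarrow> enat" where "mN m = fst m"
definition mQ :: "mark \<Rightarrow> real" where "mQ m = fst (snd m)"
definition mC :: "mark \<Rightarrow> nat \<Rightarrow> real" where "mC m = snd (snd m)"

definition mark_space :: "mark measure" where
  "mark_space = count_space UNIV \<Otimes>\<^sub>M (borel \<Otimes>\<^sub>M (\<Pi>\<^sub>M j\<in>{1..}. borel))"

definition admissible_mark :: "mark \<Rightarrow> bool" where
  "admissible_mark m \<longleftrightarrow> 1 \<le> mN m \<and> 0 \<le> mQ m \<and> (\<forall>j\<ge>1. 0 \<le> mC m j)"

definition random_mark :: "'a measure \<Rightarrow> ('a \<Rightarrow> mark) \<Rightarrow> bool" where
  "random_mark M \<psi> \<longleftrightarrow> \<psi> \<in> measurable M mark_space \<and> (\<forall>\<omega>\<in>space M. admissible_mark (\<psi> \<omega>))"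

definition children :: "mark \<Rightarrow> nat set" where
  "children m = {j. 1 \<le> j \<and> enat j \<le> mN m}"

text \<open>\<open>power_sum a m\<close> is \<open>\<Sum>\<^sub>i\<^sub>\<le>\<^sub>N C\<^sub>i\<^sup>a\<close>, possibly infinite; for \<open>a > 0\<close> note \<open>0 powr a = 0\<close>.\<close>
definition power_sum :: "real \<Rightarrow> mark \<Rightarrow> ennreal" where
  "power_sum a m = (\<Sum>j. indicator (children m) j * ennreal (mC m j powr a))"

text \<open>The summand of \<open>\<Sum>\<^sub>i\<^sub>\<le>\<^sub>N C\<^sub>i\<^sup>a log C\<^sub>i\<close>; it vanishes when \<open>C\<^sub>i = 0\<close>.\<close>
definition log_term :: "real \<Rightarrow> mark \<Rightarrow> nat \<Rightarrow> real" where
  "log_term a m j = indicator (children m) j * (mC m j powr a * ln (mC m j))"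

text \<open>The measure \<open>\<eta>(dx) = E[\<Sum>\<^sub>i\<^sub>\<le>\<^sub>N C\<^sub>i\<^sup>a 1(log C\<^sub>i \<in> dx)]\<close>. Indices with \<open>C\<^sub>i = 0\<close>, where HOL has
  \<open>ln 0 = 0\<close>, carry no weight.\<close>
definition eta_fun :: "'a measure \<Rightarrow> real \<Rightarrow> ('a \<Rightarrow> mark) \<Rightarrow> real set \<Rightarrow> ennreal" where
  "eta_fun M a \<psi> B =
    (\<integral>\<^sup>+\<omega>. (\<Sum>j. indicator (children (\<psi> \<omega>)) j * ennreal (mC (\<psi> \<omega>) j powr a)
                 * indicator B (ln (mC (\<psi> \<omega>) j))) \<partial>M)"

definition eta :: "'a measure \<Rightarrow> real \<Rightarrow> ('a \<Rightarrow> mark) \<Rightarrow> real measure" where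
  "eta M a \<psi> = measure_of UNIV (sets borel) (eta_fun M a \<psi>)"

lemma emeasure_eta:
  assumes "random_mark M \<psi>" and B: "B \<in> sets borel"
  shows "emeasure (eta M a \<psi>) B = eta_fun M a \<psi> B"
proof -
  have psi: "\<psi> \<in> measurable M mark_space"
    using assms by (simp add: random_mark_def)
  have mN: "(\<lambda>\<omega>. mN (\<psi> \<omega>)) \<in> measurable M (count_space UNIV)"
    using measurable_compose[OF psi[unfolded mark_space_def] measurable_fst]
    by (simp add: mN_def)
  have mC: "(\<lambda>\<omega>. mC (\<psi> \<omega>) j) \<in> borel_measurable M" if "1 \<le> j" for j
  proof -
    have "(\<lambda>\<omega>. snd (snd (\<psi> \<omega>))) \<in> measurable M (\<Pi>\<^sub>M j\<in>{1..}. borel)"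
      using psi unfolding mark_space_def
      by (intro measurable_compose[OF measurable_compose[OF _ measurable_snd] measurable_snd])
    from measurable_compose[OF this measurable_component_singleton[of j]] that
    show ?thesis by (simp add: mC_def)
  qed
  define f where "f j A \<omega> = indicator (children (\<psi> \<omega>)) j * ennreal (mC (\<psi> \<omega>) j powr a)
      * indicator A (ln (mC (\<psi> \<omega>) j))" for j \<omega> and A :: "real set"
  have f: "f j A \<in> borel_measurable M" if A: "A \<in> sets borel" for j A
  proof (cases "1 \<le> j")
    case True
    have ch: "(\<lambda>\<omega>. indicator (children (\<psi> \<omega>)) j :: ennreal) \<in> borel_measurable M"
    proof -
      have "(\<lambda>n. if enat j \<le> n then 1 else 0 :: ennreal) \<in> borel_measurable (count_space UNIV)"
        by simp
      from measurable_compose[OF mN this] True show ?thesis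
        by (simp add: children_def indicator_def of_bool_def)
    qed
    note [measurable] = ch mC[OF True] A
    show ?thesis unfolding f_def by measurable
  next
    case False
    then have "f j A = (\<lambda>_. 0)" by (auto simp: f_def children_def fun_eq_iff)
    then show ?thesis by simp
  qed
  have eta: "eta_fun M a \<psi> A = (\<Sum>j. \<integral>\<^sup>+\<omega>. f j A \<omega> \<partial>M)" if "A \<in> sets borel" for A
    unfolding eta_fun_def f_def[symmetric] using f[OF that] by (intro nn_integral_suminf)
  show ?thesis
    unfolding eta_def
  proof (rule emeasure_measure_of_sigma)
    show "sigma_algebra UNIV (sets (borel :: real measure))"
      using sets.sigma_algebra_axioms[of "borel :: real measure"] by simp
    show "positive (sets borel) (eta_fun M a \<psi>)"
      by (simp add: positive_def eta_fun_def)
    show "countably_additive (sets borel) (eta_fun M a \<psi>)"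
    proof (rule countably_additiveI)
      fix A :: "nat \<Rightarrow> real set"
      assume A: "range A \<subseteq> sets borel" "disjoint_family A" "(\<Union>i. A i) \<in> sets borel"
      then have Ai: "A n \<in> sets borel" for n by auto
      have "f j (\<Union>n. A n) \<omega> = (\<Sum>n. f j (A n) \<omega>)" for j \<omega>
        using suminf_indicator[OF A(2), of "ln (mC (\<psi> \<omega>) j)"] by (simp add: f_def)
      then have "eta_fun M a \<psi> (\<Union>n. A n) = (\<Sum>j. \<integral>\<^sup>+\<omega>. (\<Sum>n. f j (A n) \<omega>) \<partial>M)"
        using eta[OF A(3)] by simp
      also have "\<dots> = (\<Sum>j. \<Sum>n. \<integral>\<^sup>+\<omega>. f j (A n) \<omega> \<partial>M)"
        using f[OF Ai] by (simp add: nn_integral_suminf)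
      also have "\<dots> = (\<Sum>n. \<Sum>j. \<integral>\<^sup>+\<omega>. f j (A n) \<omega> \<partial>M)"
        using nn_integral_suminf[of "\<lambda>n j. \<integral>\<^sup>+\<omega>. f j (A n) \<omega> \<partial>M" "count_space (UNIV :: nat set)"]
        by (simp add: nn_integral_count_space_nat)
      also have "\<dots> = (\<Sum>n. eta_fun M a \<psi> (A n))"
        using eta[OF Ai] by simp
      finally show "(\<Sum>n. eta_fun M a \<psi> (A n)) = eta_fun M a \<psi> (\<Union>n. A n)" by simp
    qed
    show "B \<in> sets borel" by fact
  qed
qed

text \<open>Arithmetic: carried by \<open>h\<int>\<close> for some span \<open>h > 0\<close> (no shift of the lattice).\<close>
definition arithmetic :: "real measure \<Rightarrow> bool" where
  "arithmetic \<nu> \<longleftrightarrow> (\<exists>h>0. AE x in \<nu>. \<exists>k::int. x = h * of_int k)"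

section \<open>The weighted branching tree\<close>

text \<open>Deterministic functionals of a realization \<open>w\<close>, which assigns a mark to every finite sequence;
  \<open>mC (w i) j\<close> is the weight \<open>C\<close> of the node \<open>i @ [j]\<close>.\<close>

definition Ulam :: "nat list set" where
  "Ulam = {i. 0 \<notin> set i}"

definition prec :: "nat list \<Rightarrow> nat list \<Rightarrow> bool"  (infix \<open>\<prec>\<close> 50) where
  "i \<prec> j \<longleftrightarrow> (i, j) \<in> lenlex less_than"

fun generation :: "(nat list \<Rightarrow> mark) \<Rightarrow> nat \<Rightarrow> nat list set" where
  "generation w 0 = {[]}"
| "generation w (Suc n) = {i @ [j] | i j. i \<in> generation w n \<and> j \<in> children (w i)}"

definition tree :: "(nat list \<Rightarrow> mark) \<Rightarrow> nat list set" where
  "tree w = (\<Union>n. generation w n)"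

definition path_weight :: "(nat list \<Rightarrow> mark) \<Rightarrow> nat list \<Rightarrow> real" where
  "path_weight w i = (\<Prod>k<length i. mC (w (take k i)) (i ! k))"

lemma path_weight_Nil: "path_weight w [] = 1"
  by (simp add: path_weight_def)

lemma path_weight_snoc: "path_weight w (i @ [j]) = mC (w i) j * path_weight w i"
  by (simp add: path_weight_def nth_append)

definition node_S :: "(nat list \<Rightarrow> mark) \<Rightarrow> nat list \<Rightarrow> ereal" where
  "node_S w i = elog (ennreal (path_weight w i))"

definition node_Y :: "(nat list \<Rightarrow> mark) \<Rightarrow> nat list \<Rightarrow> ereal" where
  "node_Y w i = elog (ennreal (mQ (w i)))"

definition max_R :: "(nat list \<Rightarrow> mark) \<Rightarrow> ennreal" where
  "max_R w = (SUP i\<in>tree w. ennreal (path_weight w i * mQ (w i)))"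

definition max_W :: "(nat list \<Rightarrow> mark) \<Rightarrow> ereal" where
  "max_W w = (SUP i\<in>tree w. node_S w i + node_Y w i)"

definition node_D :: "real \<Rightarrow> (nat list \<Rightarrow> mark) \<Rightarrow> nat list \<Rightarrow> ennreal" where
  "node_D \<alpha> w i = power_sum \<alpha> (w i)"

lemma generation_weight_nonneg:
  assumes "\<And>i. i \<in> Ulam \<Longrightarrow> admissible_mark (w i)" and "i \<in> generation w n"
  shows "i \<in> Ulam \<and> 0 \<le> path_weight w i"
  using assms(2)
proof (induction n arbitrary: i)
  case 0
  then show ?case by (simp add: Ulam_def path_weight_Nil)
next
  case (Suc n)
  then obtain i' j where i': "i = i' @ [j]" "i' \<in> generation w n" "j \<in> children (w i')"
    by auto
  with Suc.IH have "i' \<in> Ulam" "0 \<le> path_weight w i'" by auto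
  with i' assms(1) show ?case
    by (auto simp: Ulam_def children_def path_weight_snoc admissible_mark_def)
qed

lemma max_W_eq_log_max_R:
  assumes "\<And>i. i \<in> Ulam \<Longrightarrow> admissible_mark (w i)"
  shows "max_W w = elog (max_R w)"
proof -
  have *: "node_S w i + node_Y w i = elog (ennreal (path_weight w i * mQ (w i)))" if "i \<in> tree w" for i
  proof -
    from that assms have "0 \<le> path_weight w i" "0 \<le> mQ (w i)"
      using generation_weight_nonneg[of w i] by (auto simp: tree_def admissible_mark_def)
    then show ?thesis
      by (cases "path_weight w i = 0"; cases "mQ (w i) = 0")
        (auto simp: node_S_def node_Y_def elog_def ennreal_eq_0_iff ln_mult mult_le_0_iff)
  qed
  have "max_W w \<le> y \<longleftrightarrow> elog (max_R w) \<le> y" for y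
    using * by (simp add: max_W_def max_R_def SUP_le_iff elog_le_iff)
  then show ?thesis
    by (meson order.antisym order.refl)
qed

section \<open>Random tree, spine and change of measure\<close>

definition iid_copies :: "'a measure \<Rightarrow> ('a \<Rightarrow> mark) \<Rightarrow> (nat list \<Rightarrow> 'a \<Rightarrow> mark) \<Rightarrow> bool" where
  "iid_copies M \<psi>0 \<psi> \<longleftrightarrow>
     (\<forall>i\<in>Ulam. random_mark M (\<psi> i)) \<and>
     prob_space.indep_vars M (\<lambda>_. mark_space) \<psi> Ulam \<and>
     (\<forall>i\<in>Ulam. distr M mark_space (\<psi> i) = distr M mark_space \<psi>0)"

text \<open>Sigma-algebra generated by all marks and by \<open>J\<^sub>0, \<dots>, J\<^sub>k\<close>.\<close>
definition spine_past ::
  "'a measure \<Rightarrow> (nat list \<Rightarrow> 'a \<Rightarrow> mark) \<Rightarrow> (nat \<Rightarrow> 'a \<Rightarrow> nat list) \<Rightarrow> nat \<Rightarrow> 'a measure" where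
  "spine_past M \<psi> J k = sigma (space M)
     ({\<psi> i -` B \<inter> space M | i B. i \<in> Ulam \<and> B \<in> sets mark_space} \<union>
      {J s -` B \<inter> space M | s B. s \<le> k})"

text \<open>The quotient is a genuine probability only where \<open>0 < D < \<infinity>\<close>, which under the hypotheses of
  the theorem holds almost surely; on the exceptional null set the spine is only required to
  stay in the tree.\<close>
definition spine ::
  "'a measure \<Rightarrow> real \<Rightarrow> (nat list \<Rightarrow> 'a \<Rightarrow> mark) \<Rightarrow> (nat \<Rightarrow> 'a \<Rightarrow> nat list) \<Rightarrow> bool" where
  "spine M \<alpha> \<psi> J \<longleftrightarrow>
     (\<forall>k. J k \<in> measurable M (count_space UNIV)) \<and>
     (\<forall>\<omega>\<in>space M. J 0 \<omega> = [] \<and>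
        (\<forall>k. \<exists>i\<in>children (\<psi> (J k \<omega>) \<omega>). J (Suc k) \<omega> = J k \<omega> @ [i])) \<and>
     (\<forall>k. \<forall>i\<ge>1. AE \<omega> in M. i \<in> children (\<psi> (J k \<omega>) \<omega>) \<longrightarrow>
        nn_cond_exp M (spine_past M \<psi> J k)
          (indicator {\<omega>' \<in> space M. J (Suc k) \<omega>' = J k \<omega>' @ [i]}) \<omega>
        = ennreal (mC (\<psi> (J k \<omega>) \<omega>) i powr \<alpha>) / node_D \<alpha> (\<lambda>i. \<psi> i \<omega>) (J k \<omega>))"

text \<open>The index set \<open>A\<^sub>s\<close> in \<open>\<F>\<^sub>k = \<sigma>(\<psi>\<^sub>i : i \<in> A\<^sub>s, s < k)\<close> is random: the generators are the events that
  \<open>i\<close> belongs to \<open>A\<^sub>s\<close> and its mark lies in \<open>B\<close>. For \<open>k = 0\<close> both sigma-algebras are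
  trivial, since then there are no marks and \<open>J\<^sub>0\<close> is constant.\<close>
definition F_gen :: "'a measure \<Rightarrow> (nat list \<Rightarrow> 'a \<Rightarrow> mark) \<Rightarrow> nat \<Rightarrow> 'a set set" where
  "F_gen M \<psi> k = {{\<omega> \<in> space M. i \<in> generation (\<lambda>i. \<psi> i \<omega>) s \<and> \<psi> i \<omega> \<in> B} | i s B.
     s < k \<and> i \<in> Ulam \<and> B \<in> sets mark_space}"

definition G_alg ::
  "'a measure \<Rightarrow> (nat list \<Rightarrow> 'a \<Rightarrow> mark) \<Rightarrow> (nat \<Rightarrow> 'a \<Rightarrow> nat list) \<Rightarrow> nat \<Rightarrow> 'a measure" where
  "G_alg M \<psi> J k = sigma (space M) (F_gen M \<psi> k \<union> {J s -` B \<inter> space M | s B. s \<le> k})"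

definition spine_L ::
  "real \<Rightarrow> (nat list \<Rightarrow> 'a \<Rightarrow> mark) \<Rightarrow> (nat \<Rightarrow> 'a \<Rightarrow> nat list) \<Rightarrow> nat \<Rightarrow> 'a \<Rightarrow> ennreal" where
  "spine_L \<alpha> \<psi> J k \<omega> = (\<Prod>r<k. node_D \<alpha> (\<lambda>i. \<psi> i \<omega>) (J r \<omega>))"

definition tilted_measure ::
  "'a measure \<Rightarrow> real \<Rightarrow> (nat list \<Rightarrow> 'a \<Rightarrow> mark) \<Rightarrow> (nat \<Rightarrow> 'a \<Rightarrow> nat list) \<Rightarrow> 'a measure \<Rightarrow> bool" where
  "tilted_measure M \<alpha> \<psi> J Pt \<longleftrightarrow>
     prob_space Pt \<and>
     sets Pt = sets (sigma (space M) (\<Union>k. sets (G_alg M \<psi> J k))) \<and>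
     (\<forall>k. \<forall>A\<in>sets (G_alg M \<psi> J k). emeasure Pt A = (\<integral>\<^sup>+\<omega>. indicator A \<omega> * spine_L \<alpha> \<psi> J k \<omega> \<partial>M))"

text \<open>The random variable whose tilted expectation defines \<open>H\<close>. Subtraction on \<open>ennreal\<close> is
  truncated at \<open>0\<close> and the minuend is finite, so it is the positive part of the difference.
  The supremum runs over the nodes of the tree that precede the spine; \<open>node_S w (J m \<omega>)\<close> is
  \<open>V\<^sub>m\<close> and \<open>node_Y w (J m \<omega>)\<close> is \<open>\<xi>\<^sub>m\<close>.\<close>
definition H_integrand ::
  "real \<Rightarrow> (nat list \<Rightarrow> 'a \<Rightarrow> mark) \<Rightarrow> (nat \<Rightarrow> 'a \<Rightarrow> nat list) \<Rightarrow> nat \<Rightarrow> 'a \<Rightarrow> ennreal" where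
  "H_integrand \<alpha> \<psi> J m \<omega> =
     (let w = (\<lambda>i. \<psi> i \<omega>) in
       (eexp (ereal \<alpha> * node_Y w (J m \<omega>))
        - eexp (ereal \<alpha> * ((SUP i\<in>{i \<in> tree w. i \<prec> J m \<omega>}. node_S w i + node_Y w i) - node_S w (J m \<omega>))))
       * inverse (node_D \<alpha> w (J m \<omega>)))"

end

theory Submission
  imports Defs
begin

text \<open>Let \<open>R\<^sub>n\<close> be the maximum of \<open>\<Pi>\<^sub>i Q\<^sub>i\<close> over the generations up to \<open>n\<close> and
  \<open>G\<^sub>n(t) = exp (\<alpha> t) P(log R\<^sub>n > t)\<close>. Splitting at the root gives
  \<open>G\<^sub>n\<^sub>+\<^sub>1 + \<Delta>\<^sub>n = G\<^sub>0 + \<eta> * G\<^sub>n\<close>, where \<open>\<Delta>\<^sub>n \<ge> 0\<close> is the expected excess of the number of exceedances over one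
  and increases with \<open>n\<close>. The limit \<open>G\<close> is bounded and solves \<open>G = (G\<^sub>0 - \<Delta>) + \<eta> * G\<close> with an integrable
  forcing term; since \<open>exp (- \<alpha> t) G(t)\<close> is monotone, it is enough to know the limit of its box averages,
  for which a renewal theorem for Lipschitz functions suffices. Hence
  \<open>G \<rightarrow> \<integral> (G\<^sub>0 - \<Delta>) / \<mu>\<close>, and this integral is the limit of \<open>(E R\<^sub>m\<^sup>\<alpha> - E R\<^sub>m\<^sub>-\<^sub>1\<^sup>\<alpha>) / \<alpha>\<close>.
  Undoing the change of measure, the tilted expectation in the definition of \<open>H\<close> is the expected sum, over
  generation \<open>m\<close>, of the jumps of the running maximum of \<open>(\<Pi>\<^sub>i Q\<^sub>i)\<^sup>\<alpha>\<close> in length-lexicographic order, which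
  telescopes to \<open>E R\<^sub>m\<^sup>\<alpha> - E R\<^sub>m\<^sub>-\<^sub>1\<^sup>\<alpha>\<close>. Positivity follows by showing that \<open>E R\<^sub>m\<^sup>\<alpha>\<close> grows linearly, which is
  seen by counting each node only with a small weight \<open>p\<close>.\<close>

text \<open>Two obstacles shape the proof. First, \<open>G\<close> has infinite integral as soon as
  its limit is positive. Equations are therefore kept additive in \<open>ennreal\<close> and masses
  are subtracted only at finite \<open>n\<close>, where the mass of \<open>gtail n\<close> is finite
  because each generation adds at most the mass of \<open>gtail 0\<close>. Cancelling that finite
  mass also bounds the total excess, which is what makes the forcing term integrable. Second,
  \<open>G\<close> may jump, and an integrable forcing term need not be directly Riemann integrable.
  Box averages are Lipschitz, and for Lipschitz solutions a limsup argument on increments is enough.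
  Boundedness of \<open>G\<close> comes from the \<beta>-moment: it says that the step law
  \<open>\<eta>\<close> satisfies E exp (-(\<alpha> - \<beta>) y) < 1. In the formula for
  \<open>H\<close>, the mark at the spine node of generation m is known only to the sigma-algebra
  with index m + 1. The density is thus the likelihood with m + 1 factors; its last factor cancels
  the inverse of D in the integrand, and the others turn the spine probability of a node into its
  path weight to the power \<alpha>.\<close>

section \<open>A renewal theorem\<close>

text \<open>If the positive elements have infimum 0, their multiples come arbitrarily close to every
  real and closedness gives everything. Otherwise the infimum belongs to \<open>P\<close>, and
  division with remainder shows that it generates \<open>P\<close>. The trivial group lies in every
  lattice, so the span 1 serves there.\<close>

lemma closed_subgroup_real:
  fixes P :: "real set"
  assumes cl: "closed P" and z: "0 \<in> P" and add: "\<And>x y. x \<in> P \<Longrightarrow> y \<in> P \<Longrightarrow> x + y \<in> P"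
    and neg: "\<And>x. x \<in> P \<Longrightarrow> - x \<in> P"
  shows "P = UNIV \<or> (\<exists>h>0. \<forall>x\<in>P. \<exists>k::int. x = h * of_int k)"
proof -
  have nat: "of_nat n * x \<in> P" if "x \<in> P" for n x
    using that by (induction n) (auto simp: z add algebra_simps)
  have int: "of_int k * x \<in> P" if "x \<in> P" for k x
    using nat[OF that, of "nat k"] neg[OF nat[OF that, of "nat (-k)"]] by (cases "k \<ge> 0") auto
  define S where "S = {x \<in> P. 0 < x}"
  show ?thesis
  proof (cases "S = {}")
    case True
    have "x = 0" if "x \<in> P" for x
    proof (rule ccontr)
      assume "x \<noteq> 0"
      then have "x \<in> S \<or> - x \<in> S" using that neg by (auto simp: S_def)
      with True show False by auto
    qed
    then show ?thesis by (intro disjI2 exI[of _ 1]) (auto intro!: exI[of _ 0])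
  next
    case False
    define m where "m = Inf S"
    have bdd: "bdd_below S" by (auto simp: S_def intro!: bdd_belowI[of _ 0])
    have m0: "0 \<le> m" unfolding m_def using False by (intro cInf_greatest) (auto simp: S_def)
    have near: "\<exists>x\<in>S. x < m + e" if "e > 0" for e
      using cInf_lessD[OF False, of "m + e"] that by (auto simp: m_def)
    show ?thesis
    proof (cases "m = 0")
      case True
      have "x \<in> P" for x
      proof -
        have "\<exists>y\<in>P. dist y x < e" if e: "e > 0" for e
        proof -
          obtain p where p: "p \<in> S" "p < e" using near[OF e] True by auto
          then have p0: "p > 0" "p \<in> P" by (auto simp: S_def)
          have "dist (of_int \<lfloor>x / p\<rfloor> * p) x < e"
            using p floor_divide_lower[OF p0(1), of x] floor_divide_upper[OF p0(1), of x]
            by (auto simp: dist_real_def algebra_simps)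
          then show ?thesis using int[OF p0(2)] by blast
        qed
        then show ?thesis using cl by (metis closed_approachable)
      qed
      then show ?thesis by auto
    next
      case False
      then have mp: "m > 0" using m0 by simp
      have "m \<in> P"
      proof -
        have "\<exists>y\<in>P. dist y m < e" if e: "e > 0" for e
        proof -
          obtain x where "x \<in> S" "x < m + e" using near[OF e] by auto
          moreover have "m \<le> x" unfolding m_def using \<open>x \<in> S\<close> bdd by (rule cInf_lower)
          ultimately show ?thesis by (intro bexI[of _ x]) (auto simp: S_def dist_real_def)
        qed
        then show ?thesis using cl by (metis closed_approachable)
      qed
      have "\<exists>k::int. x = m * of_int k" if "x \<in> P" for x
      proof -
        define r where "r = x - of_int \<lfloor>x / m\<rfloor> * m"
        have "r \<in> P" using add[OF that int[OF \<open>m \<in> P\<close>, of "-\<lfloor>x / m\<rfloor>"]] by (simp add: r_def)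
        have "0 \<le> r" "r < m"
          using floor_divide_lower[OF mp, of x] floor_divide_upper[OF mp, of x]
          by (auto simp: r_def algebra_simps)
        have "r = 0"
        proof (rule ccontr)
          assume "r \<noteq> 0"
          then have "r \<in> S" using \<open>r \<in> P\<close> \<open>0 \<le> r\<close> by (auto simp: S_def)
          then have "m \<le> r" unfolding m_def using bdd by (rule cInf_lower)
          then show False using \<open>r < m\<close> by simp
        qed
        then show ?thesis by (auto simp: r_def mult.commute)
      qed
      then show ?thesis using mp by blast
    qed
  qed
qed

lemma continuous_on_of_lipschitz:
  fixes g :: "real \<Rightarrow> real"
  assumes lip: "\<And>x y. \<bar>g x - g y\<bar> \<le> K * \<bar>x - y\<bar>"
  shows "continuous_on UNIV g"
proof -
  have "K \<ge> 0" using lip[of 1 0] by (auto intro: order_trans[OF abs_ge_zero])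
  then have "K-lipschitz_on UNIV g"
    using lip by (auto simp: lipschitz_on_def dist_real_def)
  then show ?thesis by (rule lipschitz_on_continuous_on)
qed

section \<open>Increments of Lipschitz solutions of the renewal equation\<close>

locale real_step = prob_space \<eta> for \<eta> :: "real measure" +
  assumes sets_step [simp, measurable_cong]: "sets \<eta> = sets borel"
begin

lemma space_step [simp]: "space \<eta> = UNIV"
  using sets_eq_imp_space_eq[OF sets_step] by simp

lemma prob_UNIV [simp]: "prob UNIV = 1"
  using prob_space by simp

text \<open>A maximum principle at infinity. If \<open>v\<close> nearly attains its limsup along
  \<open>t n\<close> and is, up to the vanishing \<open>d\<close>, an average of its own shifts,
  then the shifts by points \<open>a\<close> in the support of \<open>\<eta>\<close> must nearly
  attain it too; the Lipschitz bound passes from averages over a small ball to the centre.\<close>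

lemma shift_limit:
  fixes v d :: "real \<Rightarrow> real"
  assumes veq: "\<And>t. v t = d t + (\<integral>y. v (t - y) \<partial>\<eta>)"
    and lip: "\<And>x y. \<bar>v x - v y\<bar> \<le> K * \<bar>x - y\<bar>"
    and bnd: "\<And>x. \<bar>v x\<bar> \<le> B"
    and d: "(d \<longlongrightarrow> 0) at_top"
    and up: "\<And>e. e > 0 \<Longrightarrow> eventually (\<lambda>t. v t < L + e) at_top"
    and a: "\<And>e. e > 0 \<Longrightarrow> measure \<eta> (ball a e) > 0"
    and t: "filterlim t at_top sequentially" and vt: "(\<lambda>n. v (t n)) \<longlonglongrightarrow> L"
  shows "(\<lambda>n. v (t n - a)) \<longlonglongrightarrow> L"
proof -
  have K0: "K \<ge> 0" using lip[of 1 0] by (auto intro: order_trans[OF abs_ge_zero])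
  have "continuous_on UNIV v" using lip by (rule continuous_on_of_lipschitz)
  then have [measurable]: "v \<in> borel_measurable borel" by (rule borel_measurable_continuous_onI)
  have vint: "integrable \<eta> (\<lambda>y. v (s - y))" for s
    by (rule integrable_const_bound[of _ B]) (use bnd in auto)
  \<comment> \<open>The defect from the limsup. Its negative part vanishes in mean by dominated
    convergence and its integral tends to 0 by the equation, so its positive part vanishes in mean
    as well.\<close>
  define w where "w n y = L - v (t n - y)" for n y
  have [measurable]: "w n \<in> borel_measurable borel" for n unfolding w_def by measurable
  have wb: "\<bar>w n y\<bar> \<le> \<bar>L\<bar> + B" for n y
    using bnd[of "t n - y"] by (auto simp: w_def)
  have wint: "integrable \<eta> (w n)" for n
    by (rule integrable_const_bound[of _ "\<bar>L\<bar> + B"]) (use wb in auto)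
  have negint: "integrable \<eta> (\<lambda>y. max 0 (- w n y))" and posint: "integrable \<eta> (\<lambda>y. max 0 (w n y))" for n
    using wint[of n] by auto
  have shift: "filterlim (\<lambda>n. t n - y) at_top sequentially" for y
    using filterlim_tendsto_add_at_top[OF tendsto_const[of "-y"] t] by (simp add: add.commute)
  have upn: "eventually (\<lambda>n. - e < w n y) sequentially" if "e > 0" for e y
  proof -
    have "eventually (\<lambda>n. v (t n - y) < L + e) sequentially"
      using up[OF that] shift[of y] by (rule eventually_compose_filterlim)
    then show ?thesis by eventually_elim (simp add: w_def)
  qed
  have neg0: "(\<lambda>n. max 0 (- w n y)) \<longlonglongrightarrow> 0" for y
  proof (rule tendstoI)
    fix e :: real assume "e > 0"
    from upn[OF this, of y] show "eventually (\<lambda>n. dist (max 0 (- w n y)) 0 < e) sequentially"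
      by eventually_elim (use \<open>e > 0\<close> in auto)
  qed
  have "(\<lambda>n. \<integral>y. max 0 (- w n y) \<partial>\<eta>) \<longlonglongrightarrow> (\<integral>y. 0 \<partial>\<eta>)"
  proof (rule integral_dominated_convergence[where w = "\<lambda>_. \<bar>L\<bar> + B"])
    show "AE y in \<eta>. norm (max 0 (- w n y)) \<le> \<bar>L\<bar> + B" for n
      proof (rule AE_I2)
      fix y show "norm (max 0 (- w n y)) \<le> \<bar>L\<bar> + B" using wb[of n y] by (auto simp: max_def)
    qed
  qed (use neg0 in auto)
  then have negl: "(\<lambda>n. \<integral>y. max 0 (- w n y) \<partial>\<eta>) \<longlonglongrightarrow> 0" by simp
  have "(\<integral>y. w n y \<partial>\<eta>) = L - v (t n) + d (t n)" for n
    unfolding w_def using veq[of "t n"] vint[of "t n"] by (simp add: prob_space)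
  moreover have "(\<lambda>n. L - v (t n) + d (t n)) \<longlonglongrightarrow> L - L + 0"
    by (intro tendsto_intros vt filterlim_compose[OF d t])
  ultimately have wl: "(\<lambda>n. \<integral>y. w n y \<partial>\<eta>) \<longlonglongrightarrow> 0" by simp
  have "(\<integral>y. max 0 (w n y) \<partial>\<eta>) = (\<integral>y. w n y \<partial>\<eta>) + (\<integral>y. max 0 (- w n y) \<partial>\<eta>)" for n
    by (subst Bochner_Integration.integral_add[symmetric, OF wint negint])
      (auto intro!: Bochner_Integration.integral_cong)
  then have posl: "(\<lambda>n. \<integral>y. max 0 (w n y) \<partial>\<eta>) \<longlonglongrightarrow> 0"
    using tendsto_add[OF wl negl] by simp
  have "(\<lambda>n. w n a) \<longlonglongrightarrow> 0"
  proof (rule tendstoI)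
    fix e :: real assume e: "e > 0"
    \<comment> \<open>On a ball of this radius \<open>v\<close> varies by at most e / 2;
      \<open>K + 1\<close> avoids division by zero when \<open>K = 0\<close>.\<close>
    define r where "r = e / (2 * (K + 1))"
    have r: "r > 0" "K * r \<le> e / 2" using e K0 by (auto simp: r_def field_simps)
    define c where "c = measure \<eta> (ball a r)"
    have c: "c > 0" using a[OF r(1)] by (simp add: c_def)
    have bound: "(w n a - e / 2) * c \<le> (\<integral>y. max 0 (w n y) \<partial>\<eta>)" for n
    proof -
      have "(w n a - e / 2) * c = (\<integral>y. (w n a - e / 2) * indicator (ball a r) y \<partial>\<eta>)"
        by (simp add: c_def)
      also have "\<dots> \<le> (\<integral>y. max 0 (w n y) \<partial>\<eta>)"
      proof (rule integral_mono)
        show "integrable \<eta> (\<lambda>y. (w n a - e / 2) * indicator (ball a r) y)"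
          by (auto simp: less_top[symmetric])
        fix y
        show "(w n a - e / 2) * indicator (ball a r) y \<le> max 0 (w n y)"
        proof (cases "y \<in> ball a r")
          case True
          then have "\<bar>a - y\<bar> < r" by (simp add: dist_real_def)
          then have "K * \<bar>a - y\<bar> \<le> K * r" using K0 by (intro mult_left_mono) auto
          moreover have "\<bar>v (t n - y) - v (t n - a)\<bar> \<le> K * \<bar>a - y\<bar>"
            using lip[of "t n - y" "t n - a"] by (simp add: algebra_simps abs_minus_commute)
          ultimately have "L - v (t n - a) - e / 2 \<le> L - v (t n - y)" using r by linarith
          then show ?thesis using True by (auto simp: w_def)
        qed auto
      qed (use posint in auto)
      finally show ?thesis .
    qed
    have "eventually (\<lambda>n. (\<integral>y. max 0 (w n y) \<partial>\<eta>) < e / 2 * c) sequentially"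
      using posl e c by (intro order_tendstoD(2)) auto
    with upn[OF e, of a] show "eventually (\<lambda>n. dist (w n a) 0 < e) sequentially"
    proof eventually_elim
      case (elim n)
      have "(w n a - e / 2) * c < e / 2 * c" using bound[of n] elim by linarith
      then have "w n a - e / 2 < e / 2" using c by simp
      then show ?case using elim by (auto simp: dist_real_def)
    qed
  qed
  then have "(\<lambda>n. L - w n a) \<longlonglongrightarrow> L - 0" by (intro tendsto_intros)
  then show ?thesis by (simp add: w_def)
qed

text \<open>Let L be the limsup of the increment of \<open>g\<close> over the step \<open>a\<close>.
  By \<open>shift_limit\<close> the increments ending at t n, t n - a, t n - 2a and so on all tend
  to L along one sequence. Summing k of them telescopes to a difference of two values of
  \<open>g\<close>, so k * L is at most 2 * B for every k, and L cannot be positive.\<close>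

lemma increment_upper:
  fixes g z :: "real \<Rightarrow> real"
  assumes geq: "\<And>t. g t = z t + (\<integral>y. g (t - y) \<partial>\<eta>)"
    and lip: "\<And>x y. \<bar>g x - g y\<bar> \<le> K * \<bar>x - y\<bar>"
    and bnd: "\<And>x. \<bar>g x\<bar> \<le> B"
    and z: "(z \<longlongrightarrow> 0) at_top"
    and a: "\<And>e. e > 0 \<Longrightarrow> measure \<eta> (ball a e) > 0"
    and e: "e > 0"
  shows "eventually (\<lambda>t. g (t + a) - g t < e) at_top"
proof -
  have "continuous_on UNIV g" using lip by (rule continuous_on_of_lipschitz)
  then have [measurable]: "g \<in> borel_measurable borel" by (rule borel_measurable_continuous_onI)
  have gint: "integrable \<eta> (\<lambda>y. g (s - y))" for s
    by (rule integrable_const_bound[of _ B]) (use bnd in auto)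
  define v where "v t = g (t + a) - g t" for t
  define d where "d t = z (t + a) - z t" for t
  have sh: "filterlim (\<lambda>t. t + a) at_top at_top"
    using filterlim_tendsto_add_at_top[OF tendsto_const[of a] filterlim_ident]
    by (simp add: add.commute)
  have "(d \<longlongrightarrow> 0 - 0) at_top" unfolding d_def
    by (intro tendsto_diff z filterlim_compose[OF z sh])
  then have d: "(d \<longlongrightarrow> 0) at_top" by simp
  have veq: "v t = d t + (\<integral>y. v (t - y) \<partial>\<eta>)" for t
  proof -
    have "(\<integral>y. v (t - y) \<partial>\<eta>) = (\<integral>y. g (t + a - y) - g (t - y) \<partial>\<eta>)"
      by (simp add: v_def algebra_simps)
    also have "\<dots> = (\<integral>y. g (t + a - y) \<partial>\<eta>) - (\<integral>y. g (t - y) \<partial>\<eta>)"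
      using gint by (intro Bochner_Integration.integral_diff)
    finally show ?thesis using geq[of t] geq[of "t + a"] by (simp add: v_def d_def)
  qed
  have vlip: "\<bar>v x - v y\<bar> \<le> (2 * K) * \<bar>x - y\<bar>" for x y
    using lip[of x y] lip[of "x + a" "y + a"] by (auto simp: v_def)
  have vbnd: "\<bar>v x\<bar> \<le> 2 * B" for x
    using bnd[of x] bnd[of "x + a"] by (auto simp: v_def)
  \<comment> \<open>\<open>L\<close> is the limsup of \<open>v\<close> at infinity, as the infimum
    of its eventual upper bounds; boundedness of \<open>v\<close> keeps it real.\<close>
  define U where "U = {b. eventually (\<lambda>t. v t < b) at_top}"
  define L where "L = Inf U"
  have lowU: "- 2 * B - 1 \<le> b" if "b \<in> U" for b
  proof -
    from that have "eventually (\<lambda>t. v t < b) at_top" by (simp add: U_def)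
    then obtain t where "v t < b" using eventually_happens[of _ "at_top :: real filter"] by auto
    then show ?thesis using vbnd[of t] by (auto simp: abs_le_iff)
  qed
  have bdd: "bdd_below U" by (rule bdd_belowI[of _ "- 2 * B - 1"]) (rule lowU)
  have ne: "U \<noteq> {}"
  proof -
    have "v t < 2 * B + 1" for t using vbnd[of t] by (auto simp: abs_le_iff)
    then have "2 * B + 1 \<in> U" by (simp add: U_def)
    then show ?thesis by auto
  qed
  have up: "eventually (\<lambda>t. v t < L + r) at_top" if r: "r > 0" for r
  proof -
    obtain b where "b \<in> U" "b < L + r" using cInf_lessD[OF ne, of "L + r"] r by (auto simp: L_def)
    then have "eventually (\<lambda>t. v t < b) at_top" by (simp add: U_def)
    then show ?thesis by eventually_elim (use \<open>b < L + r\<close> in simp)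
  qed
  have low: "\<exists>t\<ge>s. v t \<ge> L - r" if "r > 0" for r s
  proof (rule ccontr)
    assume "\<not> ?thesis"
    then have "\<forall>t\<ge>s. v t < L - r" by auto
    then have "L - r \<in> U" by (auto simp: U_def eventually_at_top_linorder)
    then have "L \<le> L - r" unfolding L_def using bdd by (rule cInf_lower)
    then show False using that by simp
  qed
  have "\<forall>n. \<exists>t. t \<ge> real n \<and> v t \<ge> L - 1 / real (Suc n)"
  proof
    fix n show "\<exists>t. t \<ge> real n \<and> v t \<ge> L - 1 / real (Suc n)"
      using low[of "1 / real (Suc n)" "real n"] by auto
  qed
  then obtain t where t: "\<And>n. t n \<ge> real n" "\<And>n. v (t n) \<ge> L - 1 / real (Suc n)"
    by metis
  have tt: "filterlim t at_top sequentially"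
    by (rule filterlim_at_top_mono[OF filterlim_real_sequentially]) (use t in auto)
  have vt: "(\<lambda>n. v (t n)) \<longlonglongrightarrow> L"
  proof (rule tendstoI)
    fix r :: real assume r: "r > 0"
    have "eventually (\<lambda>n. v (t n) < L + r) sequentially"
      using up[OF r] tt by (rule eventually_compose_filterlim)
    moreover have "eventually (\<lambda>n. 1 / real (Suc n) < r) sequentially"
      using lim_inverse_n'[THEN LIMSEQ_Suc] r by (auto intro: order_tendstoD(2))
    ultimately show "eventually (\<lambda>n. dist (v (t n)) L < r) sequentially"
    proof eventually_elim
      case (elim n)
      then show ?case using t(2)[of n] by (auto simp: dist_real_def)
    qed
  qed
  have step: "(\<lambda>n. v (t n - real j * a)) \<longlonglongrightarrow> L" for j
  proof (induction j)
    case (Suc j)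
    have "filterlim (\<lambda>n. t n - real j * a) at_top sequentially"
      using filterlim_tendsto_add_at_top[OF tendsto_const[of "- real j * a"] tt]
      by (simp add: add.commute)
    from shift_limit[OF veq vlip vbnd d up a this Suc]
    show ?case by (simp add: algebra_simps)
  qed (use vt in simp)
  have sum: "(\<Sum>j=1..k. v (s - real j * a)) = g s - g (s - real k * a)" for k s
    by (induction k) (auto simp: v_def algebra_simps)
  have "real k * L \<le> 2 * B" for k
  proof -
    have "(\<lambda>n. \<Sum>j=1..k. v (t n - real j * a)) \<longlonglongrightarrow> (\<Sum>j=1..k. L)"
      by (intro tendsto_sum step)
    then have "(\<lambda>n. g (t n) - g (t n - real k * a)) \<longlonglongrightarrow> real k * L" unfolding sum by simp
    moreover have "g (t n) - g (t n - real k * a) \<le> 2 * B" for n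
      using bnd[of "t n"] bnd[of "t n - real k * a"] by (auto simp: abs_le_iff)
    ultimately show ?thesis by (intro LIMSEQ_le_const2) auto
  qed
  then have "L \<le> 0" using reals_Archimedean3[of L] by (meson linorder_not_le)
  from up[OF e] show ?thesis
    by eventually_elim (use \<open>L \<le> 0\<close> in \<open>auto simp: v_def\<close>)
qed

text \<open>The asymptotic periods of \<open>g\<close> form a closed subgroup that contains the
  support of \<open>\<eta>\<close>. Were it not the whole line, \<open>\<eta>\<close> would be
  carried by a lattice.\<close>

lemma increment_tendsto:
  fixes g z :: "real \<Rightarrow> real"
  assumes geq: "\<And>t. g t = z t + (\<integral>y. g (t - y) \<partial>\<eta>)"
    and lip: "\<And>x y. \<bar>g x - g y\<bar> \<le> K * \<bar>x - y\<bar>"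
    and bnd: "\<And>x. \<bar>g x\<bar> \<le> B"
    and z: "(z \<longlongrightarrow> 0) at_top"
    and na: "\<not> arithmetic \<eta>"
  shows "((\<lambda>t. g (t + x) - g t) \<longlongrightarrow> 0) at_top"
proof -
  have K0: "K \<ge> 0" using lip[of 1 0] by (auto intro: order_trans[OF abs_ge_zero])
  define P where "P = {x. ((\<lambda>t. g (t + x) - g t) \<longlongrightarrow> 0) at_top}"
  define S where "S = {a. \<forall>e>0. measure \<eta> (ball a e) > 0}"
  have sh: "filterlim (\<lambda>t. t + c) at_top at_top" for c :: real
    using filterlim_tendsto_add_at_top[OF tendsto_const[of c] filterlim_ident]
    by (simp add: add.commute)
  have SP: "a \<in> P" if "a \<in> S" for a
  proof -
    have pos: "\<And>e. e > 0 \<Longrightarrow> measure \<eta> (ball a e) > 0" using that by (auto simp: S_def)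
    have u: "eventually (\<lambda>t. g (t + a) - g t < e) at_top" if "e > 0" for e
      using increment_upper[OF geq lip bnd z pos that] .
    \<comment> \<open>The lower bound is the upper bound for \<open>- g\<close>, which solves the
      equation with \<open>- z\<close>.\<close>
    have l: "eventually (\<lambda>t. - g (t + a) - (- g t) < e) at_top" if "e > 0" for e
    proof (rule increment_upper[OF _ _ _ _ pos that, of "\<lambda>t. - g t" "\<lambda>t. - z t" K B])
      show "- g t = - z t + (\<integral>y. - g (t - y) \<partial>\<eta>)" for t using geq[of t] by simp
      show "\<bar>- g x - - g y\<bar> \<le> K * \<bar>x - y\<bar>" for x y using lip[of x y] by simp
      show "\<bar>- g x\<bar> \<le> B" for x using bnd[of x] by simp
      show "((\<lambda>t. - z t) \<longlongrightarrow> 0) at_top" using tendsto_minus[OF z] by simp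
    qed
    show ?thesis unfolding P_def mem_Collect_eq
    proof (rule tendstoI)
      fix e :: real assume "e > 0"
      from u[OF this] l[OF this] show "eventually (\<lambda>t. dist (g (t + a) - g t) 0 < e) at_top"
        by eventually_elim (auto simp: dist_real_def)
    qed
  qed
  have P0: "0 \<in> P" by (simp add: P_def)
  have Padd: "x + y \<in> P" if "x \<in> P" "y \<in> P" for x y
  proof -
    have "((\<lambda>t. (g (t + x + y) - g (t + x)) + (g (t + x) - g t)) \<longlongrightarrow> 0 + 0) at_top"
      using that filterlim_compose[of "\<lambda>t. g (t + y) - g t" _ at_top "\<lambda>t. t + x", OF _ sh]
      by (intro tendsto_add) (auto simp: P_def)
    then show ?thesis by (simp add: P_def add.assoc)
  qed
  have Pneg: "- x \<in> P" if "x \<in> P" for x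
  proof -
    have "((\<lambda>t. - (g (t + - x + x) - g (t + - x))) \<longlongrightarrow> - 0) at_top"
      using that filterlim_compose[of "\<lambda>t. g (t + x) - g t" _ at_top "\<lambda>t. t + - x", OF _ sh]
      by (intro tendsto_minus) (auto simp: P_def)
    then show ?thesis by (simp add: P_def)
  qed
  have Pcl: "closed P"
  proof (unfold closed_sequential_limits, intro allI impI, elim conjE)
    fix X l assume X: "\<forall>n. X n \<in> P" "X \<longlonglongrightarrow> l"
    show "l \<in> P" unfolding P_def mem_Collect_eq
    proof (rule tendstoI)
      fix e :: real assume e: "e > 0"
      have "eventually (\<lambda>n. dist (X n) l < e / (2 * (K + 1))) sequentially"
        using X(2) e K0 by (intro tendstoD) auto
      then obtain n where n: "dist (X n) l < e / (2 * (K + 1))"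
        using eventually_happens[of _ sequentially] by auto
      have "K * \<bar>l - X n\<bar> \<le> (K + 1) * \<bar>l - X n\<bar>" by (intro mult_right_mono) auto
      also have "\<dots> \<le> e / 2" using n K0 by (simp add: dist_real_def field_simps abs_minus_commute)
      finally have b: "K * \<bar>l - X n\<bar> \<le> e / 2" .
      have "eventually (\<lambda>t. dist (g (t + X n) - g t) 0 < e / 2) at_top"
        using X(1) e by (intro tendstoD) (auto simp: P_def)
      then show "eventually (\<lambda>t. dist (g (t + l) - g t) 0 < e) at_top"
      proof eventually_elim
        case (elim t)
        then have "\<bar>g (t + X n) - g t\<bar> < e / 2" by (simp add: dist_real_def)
        moreover have "\<bar>g (t + l) - g (t + X n)\<bar> \<le> K * \<bar>l - X n\<bar>"
          using lip[of "t + l" "t + X n"] by simp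
        ultimately have "\<bar>g (t + l) - g t\<bar> < e" using b by linarith
        then show ?case by (simp add: dist_real_def)
      qed
    qed
  qed
  \<comment> \<open>By Lindelof, the complement of the support is covered by countably many null
    balls.\<close>
  have supp: "AE x in \<eta>. x \<in> S"
  proof -
    define \<U> where "\<U> = {ball a e | a e. e > 0 \<and> measure \<eta> (ball a e) = 0}"
    have op: "\<And>U. U \<in> \<U> \<Longrightarrow> open U" by (auto simp: \<U>_def)
    obtain \<V> where V: "\<V> \<subseteq> \<U>" "countable \<V>" "\<Union>\<V> = \<Union>\<U>"
      using Lindelof[OF op] by metis
    have "AE x in \<eta>. \<forall>V\<in>\<V>. x \<notin> V"
    proof (rule AE_ball_countable'[rotated, OF V(2)])
      fix V assume "V \<in> \<V>"
      then obtain a e where "V = ball a e" "measure \<eta> (ball a e) = 0" using V(1) by (auto simp: \<U>_def)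
      then show "AE x in \<eta>. x \<notin> V" by (intro AE_not_in) (auto simp: null_sets_def emeasure_eq_measure)
    qed
    then show ?thesis
    proof eventually_elim
      case (elim x)
      then have nx: "x \<notin> \<Union>\<U>" using V(3) by auto
      show ?case unfolding S_def
      proof safe
        fix e :: real assume "e > 0"
        show "measure \<eta> (ball x e) > 0"
        proof (rule ccontr)
          assume "\<not> ?thesis"
          then have "measure \<eta> (ball x e) = 0" by (simp add: zero_less_measure_iff)
          then have "ball x e \<in> \<U>" using \<open>e > 0\<close> by (auto simp: \<U>_def)
          then show False using nx \<open>e > 0\<close> by auto
        qed
      qed
    qed
  qed
  have "P = UNIV"
  proof (rule ccontr)
    assume "P \<noteq> UNIV"
    then obtain h where h: "h > 0" "\<forall>x\<in>P. \<exists>k::int. x = h * of_int k"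
      using closed_subgroup_real[OF Pcl P0 Padd Pneg] by blast
    have "AE x in \<eta>. \<exists>k::int. x = h * of_int k"
      using supp by eventually_elim (use SP h in blast)
    then show False using na h by (auto simp: arithmetic_def)
  qed
  then show ?thesis by (auto simp: P_def)
qed

lemma integral_to_minus_infinity_tendsto:
  fixes z :: "real \<Rightarrow> real"
  assumes "integrable lborel z"
  shows "((\<lambda>T. \<integral>t. indicator {..T} t * z t \<partial>lborel) \<longlongrightarrow> (\<integral>t. z t \<partial>lborel)) at_top"
proof (rule integral_dominated_convergence_at_top[where w = "\<lambda>t. \<bar>z t\<bar>"])
  show "\<forall>\<^sub>F T in at_top. AE t in lborel. norm (indicator {..T} t * z t) \<le> \<bar>z t\<bar>"
    by (auto simp: indicator_def)
  show "AE t in lborel. ((\<lambda>T. indicator {..T} t * z t) \<longlongrightarrow> z t) at_top"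
  proof (rule AE_I2)
    fix t
    have "eventually (\<lambda>T. z t = indicator {..T} t * z t) at_top"
      using eventually_ge_at_top[of t] by eventually_elim auto
    then show "((\<lambda>T. indicator {..T} t * z t) \<longlongrightarrow> z t) at_top"
      by (rule Lim_transform_eventually[OF tendsto_const])
  qed
qed (use assms in auto)

text \<open>Integrating the renewal equation over \<open>(-\<infinity>, T]\<close> gives
  \<open>\<integral>\<^sub>t\<^sub>\<le>\<^sub>T z(t) dt = \<integral> (A(T) - A(T - y)) \<eta>(dy)\<close> with \<open>A(T) = \<integral>\<^sub>t\<^sub>\<le>\<^sub>T g(t) dt\<close>, and once the increments of \<open>g\<close>
  vanish the integrand is asymptotically \<open>y g(T)\<close>.\<close>
theorem renewal_limit:
  fixes g z :: "real \<Rightarrow> real"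
  assumes geq: "\<And>t. g t = z t + (\<integral>y. g (t - y) \<partial>\<eta>)"
    and lip: "\<And>x y. \<bar>g x - g y\<bar> \<le> K * \<bar>x - y\<bar>"
    and g0: "\<And>x. 0 \<le> g x" and bnd: "\<And>x. g x \<le> B"
    and gint: "\<And>T. integrable lborel (\<lambda>t. indicator {..T} t * g t)"
    and z: "(z \<longlongrightarrow> 0) at_top" and zint: "integrable lborel z"
    and na: "\<not> arithmetic \<eta>"
    and yint: "integrable \<eta> (\<lambda>y. y)" and pos: "(\<integral>y. y \<partial>\<eta>) > 0"
  shows "(g \<longlongrightarrow> (\<integral>t. z t \<partial>lborel) / (\<integral>y. y \<partial>\<eta>)) at_top"
proof -
  have B: "\<bar>g x\<bar> \<le> B" for x using g0[of x] bnd[of x] by auto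
  have B0: "B \<ge> 0" using g0[of 0] bnd[of 0] by auto
  note incr = increment_tendsto[OF geq lip B z na]
  have "continuous_on UNIV g" using lip by (rule continuous_on_of_lipschitz)
  then have gm [measurable]: "g \<in> borel_measurable borel" by (rule borel_measurable_continuous_onI)
  interpret lb: pair_sigma_finite \<eta> lborel ..
  define A where "A T = (\<integral>t. indicator {..T} t * g t \<partial>lborel)" for T
  define D where "D T y = A T - A (T - y)" for T y
  \<comment> \<open>The increment of the primitive is \<open>y\<close> times the mean of
    \<open>g\<close> over the segment from T to T - y. One formula serves both signs of
    \<open>y\<close>, and it exhibits the comparison with \<open>y * g T\<close>.\<close>
  have Deq: "D T y = y * (\<integral>r. indicator {0..1} r * g (T - y * r) \<partial>lborel)" for T y
  proof -
    have flat: "A T - A S = (\<integral>t. indicator {S<..T} t * g t \<partial>lborel)" if "S \<le> T" for S T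
      unfolding A_def using that
      by (subst Bochner_Integration.integral_diff[symmetric, OF gint gint])
        (auto intro!: Bochner_Integration.integral_cong simp: indicator_def)
    show ?thesis
    proof (cases y "0::real" rule: linorder_cases)
      case equal then show ?thesis by (simp add: D_def)
    next
      case greater
      have "A T - A (T - y) = (\<integral>t. indicator {T - y<..T} t * g t \<partial>lborel)"
        using greater by (intro flat) auto
      also have "\<dots> = \<bar>- y\<bar> *\<^sub>R (\<integral>r. indicator {T - y<..T} (T + (- y) * r) * g (T + (- y) * r) \<partial>lborel)"
        using greater by (intro lborel_integral_real_affine) auto
      also have "(\<integral>r. indicator {T - y<..T} (T + (- y) * r) * g (T + (- y) * r) \<partial>lborel) =
          (\<integral>r. indicator {0..1} r * g (T - y * r) \<partial>lborel)"
      proof (rule integral_cong_AE)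
        show "AE r in lborel. indicator {T - y<..T} (T + (- y) * r) * g (T + (- y) * r) =
            indicator {0..1} r * g (T - y * r)"
          using AE_lborel_singleton[of 1]
          by eventually_elim (use greater in \<open>auto simp: indicator_def zero_le_mult_iff\<close>)
      qed auto
      finally show ?thesis using greater by (simp add: D_def)
    next
      case less
      have "A (T - y) - A T = (\<integral>t. indicator {T<..T - y} t * g t \<partial>lborel)"
        using less by (intro flat) auto
      also have "\<dots> = \<bar>- y\<bar> *\<^sub>R (\<integral>r. indicator {T<..T - y} (T + (- y) * r) * g (T + (- y) * r) \<partial>lborel)"
        using less by (intro lborel_integral_real_affine) auto
      also have "(\<integral>r. indicator {T<..T - y} (T + (- y) * r) * g (T + (- y) * r) \<partial>lborel) =
          (\<integral>r. indicator {0..1} r * g (T - y * r) \<partial>lborel)"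
      proof (rule integral_cong_AE)
        show "AE r in lborel. indicator {T<..T - y} (T + (- y) * r) * g (T + (- y) * r) =
            indicator {0..1} r * g (T - y * r)"
          using AE_lborel_singleton[of 0]
          by eventually_elim
            (use less in \<open>auto simp: indicator_def mult_less_0_iff\<close>)
      qed auto
      finally show ?thesis using less by (simp add: D_def)
    qed
  qed
  have i01: "integrable lborel (\<lambda>r. indicator {0..1::real} r * c)" for c :: real by simp
  have ig: "integrable lborel (\<lambda>r. indicator {0..1::real} r * g (T - y * r))" for T y
    by (rule Bochner_Integration.integrable_bound[OF i01[of B]]) (auto simp: indicator_def B0 B)
  \<comment> \<open>Vanishing increments of \<open>g\<close> give the pointwise limit; the majorant
    2 * B * |y| is integrable because the step has a first moment, so the limit passes under the
    integral against \<open>\<eta>\<close>.\<close>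
  have Dbound: "\<bar>D T y - y * g T\<bar> \<le> 2 * B * \<bar>y\<bar>" and Dlim: "((\<lambda>T. D T y - y * g T) \<longlongrightarrow> 0) at_top" for T y
  proof -
    have eq: "D T y - y * g T = y * (\<integral>r. indicator {0..1} r * (g (T - y * r) - g T) \<partial>lborel)" for T
    proof -
      have "(\<integral>r. indicator {0..1} r * (g (T - y * r) - g T) \<partial>lborel)
        = (\<integral>r. indicator {0..1} r * g (T - y * r) - indicator {0..1} r * g T \<partial>lborel)"
        by (simp add: right_diff_distrib)
      also have "\<dots> = (\<integral>r. indicator {0..1} r * g (T - y * r) \<partial>lborel) - g T"
        by (subst Bochner_Integration.integral_diff[OF ig i01]) simp
      finally show ?thesis by (simp add: Deq right_diff_distrib)
    qed
    have b: "\<bar>g (T - y * r) - g T\<bar> \<le> 2 * B" for r T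
      using B[of "T - y * r"] B[of T] by linarith
    have "norm (\<integral>r. indicator {0..1} r * (g (T - y * r) - g T) \<partial>lborel) \<le> (\<integral>r. indicator {0..1::real} r * (2 * B) \<partial>lborel)"
    proof (rule Bochner_Integration.integral_norm_bound_integral)
      show "integrable lborel (\<lambda>r. indicator {0..1} r * (g (T - y * r) - g T))"
        using Bochner_Integration.integrable_diff[OF ig i01[of "g T"]] by (simp add: right_diff_distrib)
    qed (use b[of T] i01[of "2 * B"] in \<open>auto simp: indicator_def\<close>)
    then have "abs y * norm (\<integral>r. indicator {0..1} r * (g (T - y * r) - g T) \<partial>lborel) \<le> abs y * (2 * B)"
      by (intro mult_left_mono) auto
    then show "\<bar>D T y - y * g T\<bar> \<le> 2 * B * \<bar>y\<bar>"
      unfolding eq abs_mult real_norm_def by (simp add: mult.commute)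
    have "((\<lambda>T. \<integral>r. indicator {0..1} r * (g (T - y * r) - g T) \<partial>lborel) \<longlongrightarrow> (\<integral>r. (0::real) \<partial>(lborel :: real measure))) at_top"
    proof (rule integral_dominated_convergence_at_top[where w = "\<lambda>r. indicator {0..1::real} r * (2 * B)"])
      show "AE r in lborel. ((\<lambda>T. indicator {0..1} r * (g (T - y * r) - g T)) \<longlongrightarrow> 0) at_top"
        proof (rule AE_I2)
        fix r show "((\<lambda>T. indicator {0..1} r * (g (T - y * r) - g T)) \<longlongrightarrow> 0) at_top"
          using incr[of "- y * r"] by (intro tendsto_mult_right_zero) simp
      qed
      show "\<forall>\<^sub>F T in at_top. AE r in lborel. norm (indicator {0..1::real} r * (g (T - y * r) - g T)) \<le> indicator {0..1::real} r * (2 * B)"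
        using b by (auto simp: indicator_def)
    qed auto
    then have "((\<lambda>T. y * (\<integral>r. indicator {0..1} r * (g (T - y * r) - g T) \<partial>lborel)) \<longlongrightarrow> 0) at_top"
      by (intro tendsto_mult_right_zero) simp
    then show "((\<lambda>T. D T y - y * g T) \<longlongrightarrow> 0) at_top" by (simp add: eq)
  qed
  have [measurable]: "(\<lambda>y. D T y) \<in> borel_measurable borel" for T
    unfolding Deq by measurable
  have Dint: "integrable \<eta> (D T)" for T
  proof -
    have "integrable \<eta> (\<lambda>y. D T y - y * g T)"
      by (rule Bochner_Integration.integrable_bound[of _ "\<lambda>y. 2 * B * y"])
        (use Dbound[of T] B0 in \<open>auto intro!: Bochner_Integration.integrable_mult_right yint simp: abs_mult\<close>)
    from Bochner_Integration.integrable_add[OF this Bochner_Integration.integrable_mult_left[OF yint, of "g T"]]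
    show ?thesis by (simp add: fun_eq_iff)
  qed
  have zD: "(\<integral>t. indicator {..T} t * z t \<partial>lborel) = (\<integral>y. D T y \<partial>\<eta>)" for T
  proof -
    have Aint: "integrable \<eta> (\<lambda>y. A (T - y))"
      using Bochner_Integration.integrable_diff[OF _ Dint[of T], of "\<lambda>_. A T"] by (simp add: D_def)
    have Ash: "A (T - y) = (\<integral>t. indicator {..T} t * g (t - y) \<partial>lborel)" for y
      unfolding A_def by (subst lborel_integral_real_affine[of 1 _ "- y"])
        (auto intro!: Bochner_Integration.integral_cong simp: indicator_def)
    have ish: "integrable lborel (\<lambda>t. indicator {..T} t * g (t - y))" for y
    proof -
      have "(\<lambda>t. indicator {..T} t * g (t - y)) = (\<lambda>t. indicator {..T - y} (- y + 1 * t) * g (- y + 1 * t))"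
        by (auto simp: indicator_def fun_eq_iff)
      then show ?thesis using lborel_integrable_real_affine[OF gint[of "T - y"], of 1 "- y"] by simp
    qed
    \<comment> \<open>Since \<open>g\<close> is nonnegative, the condition for Fubini reduces to
      integrability of A (T - y) in y, which is inherited from \<open>D T\<close>.\<close>
    have jint: "integrable (\<eta> \<Otimes>\<^sub>M lborel) (\<lambda>(y, t). indicator {..T} t * g (t - y))"
    proof (rule lb.Fubini_integrable)
      show "(\<lambda>(y, t). indicator {..T} t * g (t - y)) \<in> borel_measurable (\<eta> \<Otimes>\<^sub>M lborel)" by measurable
      show "AE y in \<eta>. integrable lborel (\<lambda>x. case (y, x) of (y, t) \<Rightarrow> indicator {..T} t * g (t - y))"
        using ish by simp
      have "(\<lambda>y. \<integral>x. norm (indicator {..T} x * g (x - y)) \<partial>lborel) = (\<lambda>y. A (T - y))"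
        unfolding Ash by (auto intro!: Bochner_Integration.integral_cong simp: g0 abs_mult)
      then show "integrable \<eta> (\<lambda>y. \<integral>x. norm (case (y, x) of (y, t) \<Rightarrow> indicator {..T} t * g (t - y)) \<partial>lborel)"
        using Aint by simp
    qed
    have "(\<integral>y. A (T - y) \<partial>\<eta>) = (\<integral>y. (\<integral>t. indicator {..T} t * g (t - y) \<partial>lborel) \<partial>\<eta>)"
      by (simp add: Ash)
    also have "\<dots> = (\<integral>t. (\<integral>y. indicator {..T} t * g (t - y) \<partial>\<eta>) \<partial>lborel)"
      using lb.Fubini_integral[OF jint] by simp
    also have "\<dots> = (\<integral>t. indicator {..T} t * g t - indicator {..T} t * z t \<partial>lborel)"
    proof (rule Bochner_Integration.integral_cong)
      fix t show "(\<integral>y. indicator {..T} t * g (t - y) \<partial>\<eta>) = indicator {..T} t * g t - indicator {..T} t * z t"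
        using geq[of t] by (cases "t \<le> T") simp_all
    qed simp
    also have "\<dots> = A T - (\<integral>t. indicator {..T} t * z t \<partial>lborel)"
      unfolding A_def using integrable_mult_indicator[OF _ zint, of "{..T}"]
      by (intro Bochner_Integration.integral_diff gint) simp_all
    finally have e: "(\<integral>y. A (T - y) \<partial>\<eta>) = A T - (\<integral>t. indicator {..T} t * z t \<partial>lborel)" .
    have "(\<integral>y. D T y \<partial>\<eta>) = A T - (\<integral>y. A (T - y) \<partial>\<eta>)"
      unfolding D_def by (subst Bochner_Integration.integral_diff[OF _ Aint]) (auto simp: prob_space)
    with e show ?thesis by simp
  qed
  have "((\<lambda>T. \<integral>y. D T y - y * g T \<partial>\<eta>) \<longlongrightarrow> (\<integral>y. 0 \<partial>\<eta>)) at_top"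
  proof (rule integral_dominated_convergence_at_top[where w = "\<lambda>y. 2 * B * \<bar>y\<bar>"])
    show "AE y in \<eta>. ((\<lambda>T. D T y - y * g T) \<longlongrightarrow> 0) at_top" using Dlim by simp
    show "\<forall>\<^sub>F T in at_top. AE y in \<eta>. norm (D T y - y * g T) \<le> 2 * B * \<bar>y\<bar>"
      using Dbound by simp
    show "integrable \<eta> (\<lambda>y. 2 * B * \<bar>y\<bar>)"
      using integrable_abs[OF yint] by (intro Bochner_Integration.integrable_mult_right) simp
  qed simp_all
  moreover have "(\<integral>y. D T y - y * g T \<partial>\<eta>) = (\<integral>t. indicator {..T} t * z t \<partial>lborel) - (\<integral>y. y \<partial>\<eta>) * g T" for T
    unfolding zD using yint by (subst Bochner_Integration.integral_diff[OF Dint]) auto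
  ultimately have lim0: "((\<lambda>T. (\<integral>t. indicator {..T} t * z t \<partial>lborel) - (\<integral>y. y \<partial>\<eta>) * g T) \<longlongrightarrow> 0) at_top"
    by simp
  have "((\<lambda>T. ((\<integral>t. indicator {..T} t * z t \<partial>lborel) -
      ((\<integral>t. indicator {..T} t * z t \<partial>lborel) - (\<integral>y. y \<partial>\<eta>) * g T)) / (\<integral>y. y \<partial>\<eta>))
      \<longlongrightarrow> ((\<integral>t. z t \<partial>lborel) - 0) / (\<integral>y. y \<partial>\<eta>)) at_top"
    using pos by (intro tendsto_intros integral_to_minus_infinity_tendsto zint lim0) auto
  then show ?thesis using pos by simp
qed

end

section \<open>Maxima over finitely many generations\<close>

lemma Nil_Ulam [simp, intro]: "[] \<in> Ulam"
  by (simp add: Ulam_def)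

lemma Cons_Ulam [simp]: "c # i \<in> Ulam \<longleftrightarrow> 1 \<le> c \<and> i \<in> Ulam"
  by (auto simp: Ulam_def)

lemma snoc_Ulam [simp]: "i @ [c] \<in> Ulam \<longleftrightarrow> 1 \<le> c \<and> i \<in> Ulam"
  by (auto simp: Ulam_def)

lemma children_ge_1: "c \<in> children m \<Longrightarrow> Suc 0 \<le> c"
  by (simp add: children_def)

lemma measurable_mQ [measurable]: "mQ \<in> borel_measurable mark_space"
  unfolding mQ_def mark_space_def by measurable

lemma measurable_mN [measurable]: "mN \<in> measurable mark_space (count_space UNIV)"
  unfolding mN_def mark_space_def by measurable

lemma measurable_mC: "1 \<le> j \<Longrightarrow> (\<lambda>m. mC m j) \<in> borel_measurable mark_space"
  unfolding mC_def mark_space_def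
  by (intro measurable_compose[OF measurable_compose[OF measurable_snd measurable_snd]
        measurable_component_singleton]) auto

lemma measurable_children [measurable]: "Measurable.pred mark_space (\<lambda>m. j \<in> children m)"
proof -
  have "Measurable.pred (count_space UNIV) (\<lambda>n :: enat. 1 \<le> j \<and> enat j \<le> n)" by simp
  from measurable_compose[OF measurable_mN this] show ?thesis by (simp add: children_def)
qed

text \<open>Recursion at the root rather than over generations, so that the same function applies to
  each subtree \<open>\<lambda>i. w (c # i)\<close>; \<open>max_upto_eq_SUP\<close> recovers the
  maximum over the generations up to \<open>n\<close>.\<close>

primrec max_upto :: "nat \<Rightarrow> (nat list \<Rightarrow> mark) \<Rightarrow> ennreal" where
  "max_upto 0 w = ennreal (mQ (w []))"
| "max_upto (Suc n) w = max (ennreal (mQ (w [])))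
    (SUP c\<in>children (w []). ennreal (mC (w []) c) * max_upto n (\<lambda>i. w (c # i)))"

text \<open>Moves a random index set into the terms, leaving a supremum over a fixed countable set,
  for which measurability is available. It relies on 0 being the least
  \<open>ennreal\<close>.\<close>

lemma SUP_eq_indicator:
  fixes f :: "'b \<Rightarrow> ennreal"
  assumes "A \<subseteq> B"
  shows "(SUP c\<in>A. f c) = (SUP c\<in>B. indicator A c * f c)"
proof (rule antisym)
  show "(SUP c\<in>A. f c) \<le> (SUP c\<in>B. indicator A c * f c)"
    using assms by (intro SUP_mono) (auto intro!: bexI)
  show "(SUP c\<in>B. indicator A c * f c) \<le> (SUP c\<in>A. f c)"
    by (intro SUP_least) (auto simp: indicator_def intro: SUP_upper)
qed

lemma measurable_max_upto:
  assumes "\<And>i. i \<in> Ulam \<Longrightarrow> (\<lambda>\<omega>. X \<omega> i) \<in> measurable N mark_space"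
  shows "(\<lambda>\<omega>. max_upto n (X \<omega>)) \<in> borel_measurable N"
  using assms
proof (induction n arbitrary: X)
  case 0
  have [measurable]: "(\<lambda>\<omega>. X \<omega> []) \<in> measurable N mark_space" using 0 by simp
  show ?case by simp
next
  case (Suc n)
  have [measurable]: "(\<lambda>\<omega>. X \<omega> []) \<in> measurable N mark_space" using Suc.prems by simp
  have eq: "max_upto (Suc n) (X \<omega>) = max (ennreal (mQ (X \<omega> [])))
      (SUP c\<in>{1..}. indicator (children (X \<omega> [])) c * (ennreal (mC (X \<omega> []) c) * max_upto n (\<lambda>i. X \<omega> (c # i))))" for \<omega>
    by (subst SUP_eq_indicator[symmetric]) (auto simp: children_ge_1)
  have *: "(\<lambda>\<omega>. indicator (children (X \<omega> [])) c * (ennreal (mC (X \<omega> []) c) * max_upto n (\<lambda>i. X \<omega> (c # i))))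
      \<in> borel_measurable N" if "c \<in> {1..}" for c
  proof -
    have [measurable]: "(\<lambda>m. mC m c) \<in> borel_measurable mark_space"
      using that by (intro measurable_mC) auto
    have [measurable]: "(\<lambda>\<omega>. max_upto n (\<lambda>i. X \<omega> (c # i))) \<in> borel_measurable N"
      using that by (intro Suc.IH Suc.prems) auto
    show ?thesis by (simp add: indicator_def of_bool_def)
  qed
  show ?case unfolding eq
    by (intro borel_measurable_max borel_measurable_SUP *) auto
qed

lemma max_upto_cong:
  assumes "\<And>i. i \<in> Ulam \<Longrightarrow> w i = w' i"
  shows "max_upto n w = max_upto n w'"
  using assms
proof (induction n arbitrary: w w')
  case (Suc n)
  have "max_upto n (\<lambda>i. w (c # i)) = max_upto n (\<lambda>i. w' (c # i))" if "c \<in> children (w [])" for c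
    using children_ge_1[OF that] by (intro Suc.IH Suc.prems) simp
  with Suc.prems[of "[]"] show ?case by (simp cong: SUP_cong)
qed simp

lemma max_upto_mono: "max_upto n w \<le> max_upto (Suc n) w"
proof (induction n arbitrary: w)
  case (Suc n)
  show ?case unfolding max_upto.simps(2)[of "Suc n" w] max_upto.simps(2)[of n w]
    by (intro max.mono order_refl SUP_mono') (intro mult_left_mono Suc.IH zero_le)
qed simp

lemma generation_Suc_Cons:
  "generation w (Suc n) = {c # i | c i. c \<in> children (w []) \<and> i \<in> generation (\<lambda>i. w (c # i)) n}"
proof (induction n)
  case 0
  show ?case by auto
next
  case (Suc n)
  show ?case
    unfolding generation.simps(2)[of w "Suc n"] Suc.IH by (auto; metis append_Cons)
qed

lemma path_weight_Cons: "path_weight w (c # i) = mC (w []) c * path_weight (\<lambda>i. w (c # i)) i"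
  by (simp add: path_weight_def prod.lessThan_Suc_shift del: prod.lessThan_Suc)

lemma generation_subset_Ulam: "generation w n \<subseteq> Ulam"
  by (induction n) (auto simp: children_ge_1 subset_iff)

lemma length_generation: "i \<in> generation w n \<Longrightarrow> length i = n"
  by (induction n arbitrary: i) auto

lemma max_upto_eq_SUP:
  assumes "\<And>i. i \<in> Ulam \<Longrightarrow> admissible_mark (w i)"
  shows "max_upto n w = (SUP i\<in>(\<Union>k\<le>n. generation w k). ennreal (path_weight w i * mQ (w i)))"
  using assms
proof (induction n arbitrary: w)
  case 0
  then show ?case by (simp add: path_weight_Nil)
next
  case (Suc n)
  have ch: "(\<Union>k\<le>Suc n. generation w k) =
      insert [] (\<Union>c\<in>children (w []). (#) c ` (\<Union>k\<le>n. generation (\<lambda>i. w (c # i)) k))"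
  proof -
    have "(\<Union>k\<le>Suc n. generation w k) = generation w 0 \<union> (\<Union>k\<le>n. generation w (Suc k))"
      by (simp only: atMost_Suc_eq_insert_0 UN_insert UN_simps)
    then show ?thesis unfolding generation_Suc_Cons by auto
  qed
  have "max_upto n (\<lambda>i. w (c # i)) = (SUP i\<in>(\<Union>k\<le>n. generation (\<lambda>i. w (c # i)) k).
      ennreal (path_weight (\<lambda>i. w (c # i)) i * mQ (w (c # i))))" if "c \<in> children (w [])" for c
    using children_ge_1[OF that] by (intro Suc.IH Suc.prems) simp
  moreover have "ennreal (mC (w []) c) * (SUP i\<in>(\<Union>k\<le>n. generation (\<lambda>i. w (c # i)) k).
      ennreal (path_weight (\<lambda>i. w (c # i)) i * mQ (w (c # i)))) =
      (SUP i\<in>(#) c ` (\<Union>k\<le>n. generation (\<lambda>i. w (c # i)) k). ennreal (path_weight w i * mQ (w i)))"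
    if "c \<in> children (w [])" for c
    using Suc.prems[of "[]"] children_ge_1[OF that]
    by (simp add: SUP_mult_left_ennreal image_comp path_weight_Cons ennreal_mult'[symmetric]
        admissible_mark_def mult.assoc comp_def)
  ultimately show ?case
    by (simp add: ch SUP_UNION path_weight_Nil sup_max cong: SUP_cong del: UN_simps)
qed

text \<open>A supremum exceeds a level exactly when one of its members does, so the event becomes an
  increasing union over \<open>n\<close>.\<close>

lemma max_W_gt_iff:
  assumes "\<And>i. i \<in> Ulam \<Longrightarrow> admissible_mark (w i)"
  shows "max_W w > ereal t \<longleftrightarrow> (\<exists>n. ennreal (exp t) < max_upto n w)"
proof -
  have "max_R w = (SUP n. max_upto n w)"
  proof -
    have "tree w = (\<Union>n. \<Union>k\<le>n. generation w k)" by (auto simp: tree_def)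
    then show ?thesis
      using assms by (simp add: max_R_def max_upto_eq_SUP SUP_UNION del: UN_simps)
  qed
  moreover have "max_W w > ereal t \<longleftrightarrow> \<not> elog (max_R w) \<le> ereal t"
    using max_W_eq_log_max_R[OF assms] by (simp add: not_le)
  ultimately show ?thesis by (simp add: elog_le_iff eexp_def not_le less_SUP_iff)
qed

section \<open>Independence of the root mark and the subtrees\<close>

locale branching = prob_space M
  for M :: "'a measure" and \<psi>0 :: "'a \<Rightarrow> mark" and \<psi> :: "nat list \<Rightarrow> 'a \<Rightarrow> mark" +
  assumes mark0: "random_mark M \<psi>0" and copies: "iid_copies M \<psi>0 \<psi>"
begin

lemma measurable_psi0 [measurable]: "\<psi>0 \<in> measurable M mark_space"
  using mark0 by (simp add: random_mark_def)

lemma measurable_psi: "i \<in> Ulam \<Longrightarrow> \<psi> i \<in> measurable M mark_space"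
  using copies by (simp add: iid_copies_def random_mark_def)

lemma measurable_psi_Nil [measurable]: "\<psi> [] \<in> measurable M mark_space"
  by (rule measurable_psi) simp

lemma admissible_psi: "i \<in> Ulam \<Longrightarrow> \<omega> \<in> space M \<Longrightarrow> admissible_mark (\<psi> i \<omega>)"
  using copies by (simp add: iid_copies_def random_mark_def)

lemma admissible_psi0: "\<omega> \<in> space M \<Longrightarrow> admissible_mark (\<psi>0 \<omega>)"
  using mark0 by (simp add: random_mark_def)

lemma distr_psi: "i \<in> Ulam \<Longrightarrow> distr M mark_space (\<psi> i) = distr M mark_space \<psi>0"
  using copies by (simp add: iid_copies_def)

lemma indep_psi: "indep_vars (\<lambda>_. mark_space) \<psi> Ulam"
  using copies by (simp add: iid_copies_def)

lemma nn_integral_psi: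
  "f \<in> borel_measurable mark_space \<Longrightarrow> i \<in> Ulam \<Longrightarrow> (\<integral>\<^sup>+\<omega>. f (\<psi> i \<omega>) \<partial>M) = (\<integral>\<^sup>+\<omega>. f (\<psi>0 \<omega>) \<partial>M)"
  using distr_psi[of i] nn_integral_distr[OF measurable_psi, of i f] nn_integral_distr[OF measurable_psi0, of f]
  by simp

lemma measurable_max_upto_psi [measurable]:
  "(\<lambda>\<omega>. max_upto n (\<lambda>i. \<psi> i \<omega>)) \<in> borel_measurable M"
  by (intro measurable_max_upto measurable_psi)

lemma measurable_max_upto_psi_Cons:
  "1 \<le> c \<Longrightarrow> (\<lambda>\<omega>. max_upto n (\<lambda>i. \<psi> (c # i) \<omega>)) \<in> borel_measurable M"
  by (intro measurable_max_upto measurable_psi) auto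

definition max_law :: "nat \<Rightarrow> ennreal measure" where
  "max_law n = distr M borel (\<lambda>\<omega>. max_upto n (\<lambda>i. \<psi> i \<omega>))"

lemma sets_max_law [simp, measurable_cong]: "sets (max_law n) = sets borel"
  by (simp add: max_law_def)

lemma space_max_law [simp]: "space (max_law n) = UNIV"
  by (simp add: max_law_def)

lemma prob_space_max_law: "prob_space (max_law n)"
  unfolding max_law_def by (rule prob_space_distr) measurable

text \<open>Applied to \<open>(#) c\<close>, this says that the subtree at a child has the law of
  the whole tree; applied to the identity, it gives the law of the whole tree as a product
  measure.\<close>

lemma distr_family:
  assumes f: "inj_on f Ulam" "f ` Ulam \<subseteq> Ulam"
  shows "distr M (\<Pi>\<^sub>M i\<in>Ulam. mark_space) (\<lambda>\<omega>. \<lambda>i\<in>Ulam. \<psi> (f i) \<omega>) = (\<Pi>\<^sub>M i\<in>Ulam. distr M mark_space \<psi>0)"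
proof -
  have nu: "prob_space (distr M mark_space \<psi>0)" by (rule prob_space_distr) measurable
  have all: "distr M (\<Pi>\<^sub>M i\<in>Ulam. mark_space) (\<lambda>\<omega>. \<lambda>i\<in>Ulam. \<psi> i \<omega>) = (\<Pi>\<^sub>M i\<in>Ulam. distr M mark_space \<psi>0)"
    using indep_psi measurable_psi distr_psi
    by (subst (asm) indep_vars_iff_distr_eq_PiM') (auto cong: PiM_cong)
  have meas: "(\<lambda>\<omega>. \<lambda>i\<in>Ulam. \<psi> i \<omega>) \<in> measurable M (\<Pi>\<^sub>M i\<in>Ulam. mark_space)"
    by (intro measurable_restrict measurable_psi)
  have meas2: "(\<lambda>w. \<lambda>i\<in>Ulam. w (f i)) \<in> measurable (\<Pi>\<^sub>M i\<in>Ulam. mark_space) (\<Pi>\<^sub>M i\<in>Ulam. mark_space)"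
    using f by (intro measurable_restrict measurable_component_singleton) auto
  have "(\<lambda>\<omega>. \<lambda>i\<in>Ulam. \<psi> (f i) \<omega>) = (\<lambda>w. \<lambda>i\<in>Ulam. w (f i)) \<circ> (\<lambda>\<omega>. \<lambda>i\<in>Ulam. \<psi> i \<omega>)"
    using f by (auto simp: fun_eq_iff restrict_def)
  then have "distr M (\<Pi>\<^sub>M i\<in>Ulam. mark_space) (\<lambda>\<omega>. \<lambda>i\<in>Ulam. \<psi> (f i) \<omega>)
     = distr (distr M (\<Pi>\<^sub>M i\<in>Ulam. mark_space) (\<lambda>\<omega>. \<lambda>i\<in>Ulam. \<psi> i \<omega>)) (\<Pi>\<^sub>M i\<in>Ulam. mark_space) (\<lambda>w. \<lambda>i\<in>Ulam. w (f i))"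
    by (simp add: distr_distr[OF meas2 meas])
  also have "\<dots> = distr (\<Pi>\<^sub>M i\<in>Ulam. distr M mark_space \<psi>0) (\<Pi>\<^sub>M i\<in>Ulam. distr M mark_space \<psi>0) (\<lambda>w. \<lambda>i\<in>Ulam. w (f i))"
    unfolding all by (intro distr_cong sets_PiM_cong) auto
  also have "\<dots> = (\<Pi>\<^sub>M i\<in>Ulam. distr M mark_space \<psi>0)"
    using distr_PiM_reindex[of Ulam "\<lambda>_. distr M mark_space \<psi>0" f Ulam] nu f by auto
  finally show ?thesis .
qed

lemma max_law_Cons:
  assumes c: "1 \<le> c"
  shows "distr M borel (\<lambda>\<omega>. max_upto n (\<lambda>i. \<psi> (c # i) \<omega>)) = max_law n"
proof -
  have m: "max_upto n \<in> borel_measurable (\<Pi>\<^sub>M i\<in>Ulam. mark_space)"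
    using measurable_max_upto[of "\<lambda>w. w" "\<Pi>\<^sub>M i\<in>Ulam. mark_space" n] by simp
  have "distr M borel (\<lambda>\<omega>. max_upto n (\<lambda>i. \<psi> (f i) \<omega>))
      = distr (\<Pi>\<^sub>M i\<in>Ulam. distr M mark_space \<psi>0) borel (max_upto n)"
    if f: "inj_on f Ulam" "f ` Ulam \<subseteq> Ulam" for f
  proof -
    have meas: "(\<lambda>\<omega>. \<lambda>i\<in>Ulam. \<psi> (f i) \<omega>) \<in> measurable M (\<Pi>\<^sub>M i\<in>Ulam. mark_space)"
      using f by (intro measurable_restrict measurable_psi) auto
    have "(\<lambda>\<omega>. max_upto n (\<lambda>i. \<psi> (f i) \<omega>)) = max_upto n \<circ> (\<lambda>\<omega>. \<lambda>i\<in>Ulam. \<psi> (f i) \<omega>)"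
      by (auto simp: fun_eq_iff intro!: max_upto_cong)
    then show ?thesis
      by (simp add: distr_distr[OF m meas, symmetric] distr_family[OF f])
  qed
  from this[of "(#) c"] this[of "\<lambda>i. i"] show ?thesis
    using c by (auto simp: max_law_def image_subset_iff)
qed

text \<open>The root mark and the maxima over the subtrees are functions of the marks over pairwise
  disjoint index sets: the singleton of \<open>[]\<close> and the sets of nodes starting with a
  given \<open>c\<close>. They are therefore independent, and \<open>max_law_Cons\<close> identifies
  the factors.\<close>

lemma joint_law:
  "distr M (mark_space \<Otimes>\<^sub>M (\<Pi>\<^sub>M c\<in>{1..}. borel))
      (\<lambda>\<omega>. (\<psi> [] \<omega>, \<lambda>c\<in>{1..}. max_upto n (\<lambda>i. \<psi> (c # i) \<omega>)))
    = distr M mark_space \<psi>0 \<Otimes>\<^sub>M (\<Pi>\<^sub>M c\<in>{1..}. max_law n)"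
proof -
  let ?A = "{[]} :: nat list set" and ?B = "Ulam - {[]}"
  let ?P = "\<lambda>A. \<Pi>\<^sub>M i\<in>A. mark_space"
  define Y where "Y f = (\<lambda>c\<in>{1..}. max_upto n (\<lambda>i. f (c # i)))" for f
  have iv: "indep_var (?P ?A) (\<lambda>\<omega>. restrict (\<lambda>i. \<psi> i \<omega>) ?A) (?P ?B) (\<lambda>\<omega>. restrict (\<lambda>i. \<psi> i \<omega>) ?B)"
    by (rule indep_var_restrict[OF indep_psi]) auto
  have m1: "(\<lambda>f. f []) \<in> measurable (?P ?A) mark_space" by measurable
  have m2: "Y \<in> measurable (?P ?B) (\<Pi>\<^sub>M c\<in>{1..}. borel)"
    unfolding Y_def by (intro measurable_restrict measurable_max_upto measurable_component_singleton) auto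
  have mA: "(\<lambda>\<omega>. restrict (\<lambda>i. \<psi> i \<omega>) ?A) \<in> measurable M (?P ?A)"
    by (intro measurable_restrict measurable_psi) auto
  have mB: "(\<lambda>\<omega>. restrict (\<lambda>i. \<psi> i \<omega>) ?B) \<in> measurable M (?P ?B)"
    by (intro measurable_restrict measurable_psi) auto
  have e1: "(\<lambda>f. f []) \<circ> (\<lambda>\<omega>. restrict (\<lambda>i. \<psi> i \<omega>) ?A) = \<psi> []" by (simp add: comp_def)
  have e2: "Y \<circ> (\<lambda>\<omega>. restrict (\<lambda>i. \<psi> i \<omega>) ?B) = (\<lambda>\<omega>. \<lambda>c\<in>{1..}. max_upto n (\<lambda>i. \<psi> (c # i) \<omega>))"
    by (auto simp: Y_def fun_eq_iff restrict_def intro!: max_upto_cong)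
  have e3: "(\<lambda>(f, g). (f [], Y g)) \<circ> (\<lambda>\<omega>. (restrict (\<lambda>i. \<psi> i \<omega>) ?A, restrict (\<lambda>i. \<psi> i \<omega>) ?B))
      = (\<lambda>\<omega>. (\<psi> [] \<omega>, \<lambda>c\<in>{1..}. max_upto n (\<lambda>i. \<psi> (c # i) \<omega>)))"
    using fun_cong[OF e2] by (simp add: comp_def)
  have mY: "(\<lambda>\<omega>. \<lambda>c\<in>{1..}. max_upto n (\<lambda>i. \<psi> (c # i) \<omega>)) \<in> measurable M (\<Pi>\<^sub>M c\<in>{1..}. borel)"
    by (intro measurable_restrict measurable_max_upto_psi_Cons) simp
  interpret B: prob_space "distr M (\<Pi>\<^sub>M c\<in>{1::nat..}. borel) (\<lambda>\<omega>. \<lambda>c\<in>{1..}. max_upto n (\<lambda>i. \<psi> (c # i) \<omega>))"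
    by (rule prob_space_distr[OF mY])
  have "distr M (mark_space \<Otimes>\<^sub>M (\<Pi>\<^sub>M c\<in>{1..}. borel))
      (\<lambda>\<omega>. (\<psi> [] \<omega>, \<lambda>c\<in>{1..}. max_upto n (\<lambda>i. \<psi> (c # i) \<omega>)))
    = distr (distr M (?P ?A \<Otimes>\<^sub>M ?P ?B) (\<lambda>\<omega>. (restrict (\<lambda>i. \<psi> i \<omega>) ?A, restrict (\<lambda>i. \<psi> i \<omega>) ?B)))
        (mark_space \<Otimes>\<^sub>M (\<Pi>\<^sub>M c\<in>{1..}. borel)) (\<lambda>(f, g). (f [], Y g))"
    unfolding e3[symmetric]
  proof (rule distr_distr[symmetric])
    show "(\<lambda>(f, g). (f [], Y g)) \<in> measurable (?P ?A \<Otimes>\<^sub>M ?P ?B) (mark_space \<Otimes>\<^sub>M (\<Pi>\<^sub>M c\<in>{1..}. borel))"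
      unfolding measurable_split_conv
      by (intro measurable_Pair measurable_compose[OF measurable_fst m1] measurable_compose[OF measurable_snd m2])
  qed (intro measurable_Pair mA mB)
  also have "\<dots> = distr (distr M (?P ?A) (\<lambda>\<omega>. restrict (\<lambda>i. \<psi> i \<omega>) ?A) \<Otimes>\<^sub>M distr M (?P ?B) (\<lambda>\<omega>. restrict (\<lambda>i. \<psi> i \<omega>) ?B))
        (mark_space \<Otimes>\<^sub>M (\<Pi>\<^sub>M c\<in>{1..}. borel)) (\<lambda>(f, g). (f [], Y g))"
    using iv by (simp add: indep_var_distribution_eq)
  also have "\<dots> = distr (distr M (?P ?A) (\<lambda>\<omega>. restrict (\<lambda>i. \<psi> i \<omega>) ?A)) mark_space (\<lambda>f. f []) \<Otimes>\<^sub>M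
      distr (distr M (?P ?B) (\<lambda>\<omega>. restrict (\<lambda>i. \<psi> i \<omega>) ?B)) (\<Pi>\<^sub>M c\<in>{1..}. borel) Y"
  proof (rule pair_measure_distr[symmetric])
    show "sigma_finite_measure (distr (distr M (?P ?B) (\<lambda>\<omega>. restrict (\<lambda>i. \<psi> i \<omega>) ?B)) (\<Pi>\<^sub>M c\<in>{1..}. borel) Y)"
      unfolding distr_distr[OF m2 mB] e2 by (rule B.sigma_finite_measure_axioms)
  qed (use m1 m2 in simp_all)
  also have "\<dots> = distr M mark_space (\<psi> []) \<Otimes>\<^sub>M distr M (\<Pi>\<^sub>M c\<in>{1..}. borel) (\<lambda>\<omega>. \<lambda>c\<in>{1..}. max_upto n (\<lambda>i. \<psi> (c # i) \<omega>))"
    by (simp only: distr_distr[OF m2 mB] distr_distr[OF m1 mA] e1 e2)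
  also have "distr M (\<Pi>\<^sub>M c\<in>{1..}. borel) (\<lambda>\<omega>. \<lambda>c\<in>{1..}. max_upto n (\<lambda>i. \<psi> (c # i) \<omega>)) = (\<Pi>\<^sub>M c\<in>{1..}. max_law n)"
  proof -
    have "indep_vars (\<lambda>c. ?P ((#) c ` Ulam)) (\<lambda>c \<omega>. restrict (\<lambda>i. \<psi> i \<omega>) ((#) c ` Ulam)) {1..}"
      by (rule indep_vars_restrict[OF indep_psi]) (auto simp: disjoint_family_on_def)
    from indep_vars_compose2[OF this, of "\<lambda>c f. max_upto n (\<lambda>i. f (c # i))" "\<lambda>_. borel"]
    have "indep_vars (\<lambda>_. borel) (\<lambda>c \<omega>. max_upto n (\<lambda>i. restrict (\<lambda>i. \<psi> i \<omega>) ((#) c ` Ulam) (c # i))) {1..}"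
      by (force intro: measurable_max_upto measurable_component_singleton)
    moreover have "max_upto n (\<lambda>i. restrict (\<lambda>i. \<psi> i \<omega>) ((#) c ` Ulam) (c # i)) = max_upto n (\<lambda>i. \<psi> (c # i) \<omega>)" for c \<omega>
      by (rule max_upto_cong) auto
    ultimately have "indep_vars (\<lambda>_. borel) (\<lambda>c \<omega>. max_upto n (\<lambda>i. \<psi> (c # i) \<omega>)) {1..}" by simp
    then have "distr M (\<Pi>\<^sub>M c\<in>{1..}. borel) (\<lambda>\<omega>. \<lambda>c\<in>{1..}. max_upto n (\<lambda>i. \<psi> (c # i) \<omega>)) =
        (\<Pi>\<^sub>M c\<in>{1..}. distr M borel (\<lambda>\<omega>. max_upto n (\<lambda>i. \<psi> (c # i) \<omega>)))"
      by (subst (asm) indep_vars_iff_distr_eq_PiM') (auto simp: measurable_max_upto_psi_Cons)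
    also have "\<dots> = (\<Pi>\<^sub>M c\<in>{1..}. max_law n)"
      by (rule PiM_cong) (auto simp: max_law_Cons)
    finally show ?thesis .
  qed
  finally show ?thesis unfolding distr_psi[OF Nil_Ulam] .
qed

lemma nn_integral_root:
  assumes f [measurable]: "f \<in> borel_measurable (mark_space \<Otimes>\<^sub>M (\<Pi>\<^sub>M c\<in>{1..}. borel))"
  shows "(\<integral>\<^sup>+\<omega>. f (\<psi> [] \<omega>, \<lambda>c\<in>{1..}. max_upto n (\<lambda>i. \<psi> (c # i) \<omega>)) \<partial>M)
    = (\<integral>\<^sup>+\<omega>. (\<integral>\<^sup>+r. f (\<psi>0 \<omega>, r) \<partial>(\<Pi>\<^sub>M c\<in>{1..}. max_law n)) \<partial>M)"
proof -
  have sets: "sets (\<Pi>\<^sub>M c\<in>{1::nat..}. max_law n) = sets (\<Pi>\<^sub>M c\<in>{1::nat..}. borel)"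
    by (intro sets_PiM_cong) auto
  interpret R: prob_space "\<Pi>\<^sub>M c\<in>{1::nat..}. max_law n"
    by (intro prob_space_PiM prob_space_max_law)
  have f' [measurable]: "f \<in> borel_measurable (mark_space \<Otimes>\<^sub>M (\<Pi>\<^sub>M c\<in>{1..}. max_law n))"
    by (subst measurable_cong_sets[OF sets_pair_measure_cong[OF refl sets] refl]) (rule f)
  have meas: "(\<lambda>\<omega>. (\<psi> [] \<omega>, \<lambda>c\<in>{1..}. max_upto n (\<lambda>i. \<psi> (c # i) \<omega>)))
      \<in> measurable M (mark_space \<Otimes>\<^sub>M (\<Pi>\<^sub>M c\<in>{1..}. borel))"
    by (intro measurable_Pair measurable_restrict measurable_max_upto_psi_Cons measurable_psi_Nil) auto
  have "(\<integral>\<^sup>+\<omega>. f (\<psi> [] \<omega>, \<lambda>c\<in>{1..}. max_upto n (\<lambda>i. \<psi> (c # i) \<omega>)) \<partial>M)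
     = (\<integral>\<^sup>+x. f x \<partial>(distr M mark_space \<psi>0 \<Otimes>\<^sub>M (\<Pi>\<^sub>M c\<in>{1..}. max_law n)))"
    unfolding joint_law[symmetric] by (rule nn_integral_distr[OF meas, symmetric]) (simp only: measurable_distr_eq1 f)
  also have "\<dots> = (\<integral>\<^sup>+m. (\<integral>\<^sup>+r. f (m, r) \<partial>(\<Pi>\<^sub>M c\<in>{1..}. max_law n)) \<partial>distr M mark_space \<psi>0)"
    by (rule R.nn_integral_fst[symmetric]) measurable
  also have "\<dots> = (\<integral>\<^sup>+\<omega>. (\<integral>\<^sup>+r. f (\<psi>0 \<omega>, r) \<partial>(\<Pi>\<^sub>M c\<in>{1..}. max_law n)) \<partial>M)"
    by (rule nn_integral_distr) measurable
  finally show ?thesis .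
qed

end

lemmas max_upto_Suc = max_upto.simps(2)
declare max_upto.simps(2) [simp del]

section \<open>Recursion for the tail of the maximum\<close>

text \<open>A Bonferroni-type inequality in which the sum over pairs is relaxed to the full square.
  This form survives the induction: inserting \<open>a\<close> leaves the nonnegative slack q a * S
  + q a * q a + q a * S^2.\<close>

lemma prod_one_minus_le:
  fixes q :: "'b \<Rightarrow> real"
  assumes "finite J" "\<And>c. c \<in> J \<Longrightarrow> 0 \<le> q c" "\<And>c. c \<in> J \<Longrightarrow> q c \<le> 1"
  shows "(\<Prod>c\<in>J. 1 - q c) \<le> 1 - sum q J + (sum q J)\<^sup>2"
  using assms
proof (induction J rule: finite_induct)
  case (insert a J)
  define S where "S = sum q J"
  have S: "0 \<le> S" using insert.prems unfolding S_def by (intro sum_nonneg) auto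
  have a: "0 \<le> q a" "q a \<le> 1" using insert.prems by auto
  have "(\<Prod>c\<in>insert a J. 1 - q c) = (1 - q a) * (\<Prod>c\<in>J. 1 - q c)" using insert by simp
  also have "\<dots> \<le> (1 - q a) * (1 - S + S\<^sup>2)"
    using insert.prems a unfolding S_def by (intro mult_left_mono insert.IH) auto
  also have "\<dots> \<le> 1 - (q a + S) + (q a + S)\<^sup>2"
  proof -
    have "0 \<le> q a * S + q a * q a + q a * S\<^sup>2" using S a by simp
    then show ?thesis by (simp add: power2_eq_square algebra_simps)
  qed
  finally show ?case using insert by (simp add: S_def)
qed simp

lemma ennreal_less_mult_iff:
  assumes "0 < c"
  shows "ennreal (exp t) < ennreal c * x \<longleftrightarrow> ennreal (exp (t - ln c)) < x"
proof -
  have e: "ennreal (exp t) = ennreal c * ennreal (exp (t - ln c))"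
    using assms by (simp add: ennreal_mult'[symmetric] exp_diff)
  show ?thesis
  proof
    assume "ennreal (exp t) < ennreal c * x"
    then show "ennreal (exp (t - ln c)) < x"
      unfolding e by (meson linorder_not_le mult_left_mono zero_le)
  next
    assume "ennreal (exp (t - ln c)) < x"
    then show "ennreal (exp t) < ennreal c * x"
      unfolding e using assms by (intro ennreal_mult_strict_left_mono) auto
  qed
qed

text \<open>Children of weight zero are excluded by hand: with \<open>ln 0 = 0\<close> in HOL they
  would otherwise contribute \<open>f t\<close>, whereas they cannot exceed any level.\<close>

definition child_sum :: "(real \<Rightarrow> ennreal) \<Rightarrow> real \<Rightarrow> mark \<Rightarrow> ennreal" where
  "child_sum f t m = (\<Sum>c. indicator (children m) c * (if 0 < mC m c then f (t - ln (mC m c)) else 0))"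

lemma measurable_child_term [measurable (raw)]:
  assumes [measurable]: "f \<in> borel_measurable borel" "t \<in> borel_measurable N" "X \<in> measurable N mark_space"
  shows "(\<lambda>\<omega>. indicator (children (X \<omega>)) c * (if 0 < mC (X \<omega>) c then f (t \<omega> - ln (mC (X \<omega>) c)) else 0 :: ennreal))
    \<in> borel_measurable N"
proof (cases "1 \<le> c")
  case True
  then have [measurable]: "(\<lambda>m. mC m c) \<in> borel_measurable mark_space" by (rule measurable_mC)
  show ?thesis unfolding indicator_def of_bool_def by measurable
next
  case False
  then have "\<And>m. c \<notin> children m" by (auto simp: children_def)
  then show ?thesis by simp
qed

lemma measurable_child_sum [measurable (raw)]:
  assumes [measurable]: "f \<in> borel_measurable borel" "t \<in> borel_measurable N" "X \<in> measurable N mark_space"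
  shows "(\<lambda>\<omega>. child_sum f (t \<omega>) (X \<omega>)) \<in> borel_measurable N"
  unfolding child_sum_def by measurable

section \<open>Counting exceedances\<close>

context branching
begin

definition tail :: "nat \<Rightarrow> real \<Rightarrow> ennreal" where
  "tail n t = emeasure M {\<omega> \<in> space M. ennreal (exp t) < max_upto n (\<lambda>i. \<psi> i \<omega>)}"

lemma tail_eq_nn_integral:
  "tail n t = (\<integral>\<^sup>+\<omega>. indicator {ennreal (exp t)<..} (max_upto n (\<lambda>i. \<psi> i \<omega>)) \<partial>M)"
proof -
  have "(\<integral>\<^sup>+\<omega>. indicator {ennreal (exp t)<..} (max_upto n (\<lambda>i. \<psi> i \<omega>)) \<partial>M)
    = (\<integral>\<^sup>+\<omega>. indicator {\<omega> \<in> space M. ennreal (exp t) < max_upto n (\<lambda>i. \<psi> i \<omega>)} \<omega> \<partial>M)"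
    by (intro nn_integral_cong) (auto simp: indicator_def)
  then show ?thesis by (simp add: tail_def)
qed

lemma tail_0: "tail 0 t = (\<integral>\<^sup>+\<omega>. indicator {ennreal (exp t)<..} (ennreal (mQ (\<psi>0 \<omega>))) \<partial>M)"
proof -
  have "(\<integral>\<^sup>+\<omega>. indicator {ennreal (exp t)<..} (ennreal (mQ (\<psi> [] \<omega>))) \<partial>M)
     = (\<integral>\<^sup>+\<omega>. indicator {ennreal (exp t)<..} (ennreal (mQ (\<psi>0 \<omega>))) \<partial>M)"
    by (rule nn_integral_psi) auto
  then show ?thesis by (simp add: tail_eq_nn_integral)
qed

lemma tail_le_1: "tail n t \<le> 1"
  unfolding tail_def by (rule emeasure_le_1)

lemma tail_mono_n: "tail n t \<le> tail (Suc n) t"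
  unfolding tail_def using max_upto_mono[of n]
  by (intro emeasure_mono) (auto intro: less_le_trans)

lemma tail_antimono: "s \<le> t \<Longrightarrow> tail n t \<le> tail n s"
  unfolding tail_def
  by (intro emeasure_mono) (auto intro: le_less_trans[of "ennreal (exp s)" "ennreal (exp t)"])

lemma measurable_tail [measurable]: "tail n \<in> borel_measurable borel"
  unfolding tail_eq_nn_integral indicator_def of_bool_def greaterThan_iff by measurable

lemma emeasure_max_law_mult:
  assumes "0 \<le> c"
  shows "emeasure (max_law n) {x. ennreal (exp t) < ennreal c * x} = (if 0 < c then tail n (t - ln c) else 0)"
proof (cases "0 < c")
  case True
  have "emeasure (max_law n) {x. ennreal (exp t) < ennreal c * x} = emeasure (max_law n) {ennreal (exp (t - ln c))<..}"
    by (rule arg_cong[of _ _ "emeasure (max_law n)"]) (auto simp: ennreal_less_mult_iff[OF True])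
  also have "\<dots> = tail n (t - ln c)"
    unfolding max_law_def tail_def by (subst emeasure_distr) (auto intro!: arg_cong[of _ _ "emeasure M"])
  finally show ?thesis using True by simp
qed (use assms in simp)

text \<open>Each child subtree counts at most once, however many of its nodes exceed. Since
  subtraction on \<open>ennreal\<close> is truncated, \<open>excess\<close> is the mean of the
  positive part of the count minus one, that is, the loss in the union bound.\<close>

definition overcount :: "nat \<Rightarrow> real \<Rightarrow> 'a \<Rightarrow> ennreal" where
  "overcount n t \<omega> = indicator {ennreal (exp t)<..} (ennreal (mQ (\<psi> [] \<omega>))) +
     (\<Sum>c. indicator (children (\<psi> [] \<omega>)) c *
        indicator {ennreal (exp t)<..} (ennreal (mC (\<psi> [] \<omega>) c) * max_upto n (\<lambda>i. \<psi> (c # i) \<omega>)))"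

definition excess :: "nat \<Rightarrow> real \<Rightarrow> ennreal" where
  "excess n t = (\<integral>\<^sup>+\<omega>. overcount n t \<omega> - 1 \<partial>M)"

lemma measurable_overcount_term:
  "(\<lambda>(t, \<omega>). indicator (children (\<psi> [] \<omega>)) c *
        indicator {ennreal (exp t)<..} (ennreal (mC (\<psi> [] \<omega>) c) * max_upto n (\<lambda>i. \<psi> (c # i) \<omega>)) :: ennreal)
    \<in> borel_measurable (borel \<Otimes>\<^sub>M M)"
proof (cases "1 \<le> c")
  case True
  then have [measurable]: "(\<lambda>m. mC m c) \<in> borel_measurable mark_space" by (rule measurable_mC)
  have [measurable]: "(\<lambda>\<omega>. max_upto n (\<lambda>i. \<psi> (c # i) \<omega>)) \<in> borel_measurable M"
    using True by (rule measurable_max_upto_psi_Cons)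
  show ?thesis unfolding indicator_def of_bool_def greaterThan_iff by measurable
next
  case False
  then have "\<And>m. c \<notin> children m" by (auto simp: children_def)
  then show ?thesis by simp
qed

lemma measurable_overcount [measurable]: "(\<lambda>(t, \<omega>). overcount n t \<omega>) \<in> borel_measurable (borel \<Otimes>\<^sub>M M)"
proof -
  note [measurable] = measurable_overcount_term[unfolded split_beta']
  have [measurable]: "(\<lambda>x. indicator {ennreal (exp (fst x))<..} (ennreal (mQ (\<psi> [] (snd x)))) :: ennreal)
    \<in> borel_measurable (borel \<Otimes>\<^sub>M M)"
    unfolding indicator_def of_bool_def greaterThan_iff by measurable
  show ?thesis unfolding overcount_def split_beta' by measurable
qed

lemma measurable_overcount1 [measurable]: "overcount n t \<in> borel_measurable M"
  using measurable_compose[OF measurable_Pair1'[of t borel M] measurable_overcount[of n]] by simp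

lemma measurable_excess [measurable]: "excess n \<in> borel_measurable borel"
  unfolding excess_def by measurable

lemma excess_mono: "excess n t \<le> excess (Suc n) t"
proof -
  have "indicator {ennreal (exp t)<..} (c * max_upto n w) \<le> (indicator {ennreal (exp t)<..} (c * max_upto (Suc n) w) :: ennreal)"
    for c w
    using mult_left_mono[OF max_upto_mono[of n w], of c] by (auto simp: indicator_def)
  then show ?thesis
    unfolding excess_def overcount_def
    by (intro nn_integral_mono ennreal_minus_mono add_mono suminf_le summableI mult_mono) auto
qed

lemma tail_recursion:
  "tail (Suc n) t + excess n t = tail 0 t + (\<integral>\<^sup>+\<omega>. child_sum (tail n) t (\<psi>0 \<omega>) \<partial>M)"
proof -
  let ?R = "\<lambda>c \<omega>. max_upto n (\<lambda>i. \<psi> (c # i) \<omega>)"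
  \<comment> \<open>For a count N this is 1(N \<ge> 1) + (N - 1)^+ = N; the additive form stays
    meaningful when N or its mean is infinite.\<close>
  have pt: "indicator {ennreal (exp t)<..} (max_upto (Suc n) (\<lambda>i. \<psi> i \<omega>)) + (overcount n t \<omega> - 1) = overcount n t \<omega>" for \<omega>
  proof (cases "ennreal (exp t) < max_upto (Suc n) (\<lambda>i. \<psi> i \<omega>)")
    case True
    then consider "ennreal (exp t) < ennreal (mQ (\<psi> [] \<omega>))" |
      c where "c \<in> children (\<psi> [] \<omega>)" "ennreal (exp t) < ennreal (mC (\<psi> [] \<omega>) c) * ?R c \<omega>"
      by (auto simp: max_upto_Suc less_max_iff_disj less_SUP_iff)
    then have "1 \<le> overcount n t \<omega>"
    proof cases
      case 1
      then show ?thesis by (simp add: overcount_def)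
    next
      case 2
      have "1 \<le> (\<Sum>c. indicator (children (\<psi> [] \<omega>)) c *
        indicator {ennreal (exp t)<..} (ennreal (mC (\<psi> [] \<omega>) c) * ?R c \<omega>) :: ennreal)"
        using sum_le_suminf[OF summableI, of "{c}"
            "\<lambda>c. indicator (children (\<psi> [] \<omega>)) c * indicator {ennreal (exp t)<..} (ennreal (mC (\<psi> [] \<omega>) c) * ?R c \<omega>) :: ennreal"] 2
        by simp
      then show ?thesis unfolding overcount_def by (simp add: add_increasing)
    qed
    with True show ?thesis by (simp add: add_diff_eq_ennreal add_diff_inverse_ennreal)
  next
    case False
    then have "\<not> ennreal (exp t) < ennreal (mQ (\<psi> [] \<omega>))"
      "\<And>c. c \<in> children (\<psi> [] \<omega>) \<Longrightarrow> \<not> ennreal (exp t) < ennreal (mC (\<psi> [] \<omega>) c) * ?R c \<omega>"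
      by (auto simp: max_upto_Suc less_max_iff_disj less_SUP_iff)
    then have z: "indicator {ennreal (exp t)<..} (ennreal (mQ (\<psi> [] \<omega>))) = (0 :: ennreal)"
      "\<And>c. indicator (children (\<psi> [] \<omega>)) c *
        indicator {ennreal (exp t)<..} (ennreal (mC (\<psi> [] \<omega>) c) * ?R c \<omega>) = (0 :: ennreal)"
      by (auto simp: indicator_def)
    have "overcount n t \<omega> = 0"
      unfolding overcount_def z by simp
    with False show ?thesis by simp
  qed
  have "tail (Suc n) t + excess n t = (\<integral>\<^sup>+\<omega>. overcount n t \<omega> \<partial>M)"
    unfolding tail_eq_nn_integral excess_def
    by (subst nn_integral_add[symmetric]) (simp_all add: pt)
  also have "\<dots> = tail 0 t + (\<Sum>c. \<integral>\<^sup>+\<omega>. indicator (children (\<psi> [] \<omega>)) c *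
        indicator {ennreal (exp t)<..} (ennreal (mC (\<psi> [] \<omega>) c) * ?R c \<omega>) \<partial>M)"
  proof -
    have m: "(\<lambda>\<omega>. indicator (children (\<psi> [] \<omega>)) c *
        indicator {ennreal (exp t)<..} (ennreal (mC (\<psi> [] \<omega>) c) * ?R c \<omega>) :: ennreal) \<in> borel_measurable M" for c
      using measurable_compose[OF measurable_Pair1'[of t borel M] measurable_overcount_term[of c n]] by simp
    show ?thesis unfolding overcount_def using m
      by (subst nn_integral_add) (auto simp: nn_integral_suminf tail_eq_nn_integral)
  qed
  also have "(\<lambda>c. \<integral>\<^sup>+\<omega>. indicator (children (\<psi> [] \<omega>)) c *
        indicator {ennreal (exp t)<..} (ennreal (mC (\<psi> [] \<omega>) c) * ?R c \<omega>) \<partial>M)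
    = (\<lambda>c. \<integral>\<^sup>+\<omega>. indicator (children (\<psi>0 \<omega>)) c *
        (if 0 < mC (\<psi>0 \<omega>) c then tail n (t - ln (mC (\<psi>0 \<omega>) c)) else 0) \<partial>M)"
  proof
    fix c
    show "(\<integral>\<^sup>+\<omega>. indicator (children (\<psi> [] \<omega>)) c *
        indicator {ennreal (exp t)<..} (ennreal (mC (\<psi> [] \<omega>) c) * ?R c \<omega>) \<partial>M)
      = (\<integral>\<^sup>+\<omega>. indicator (children (\<psi>0 \<omega>)) c *
        (if 0 < mC (\<psi>0 \<omega>) c then tail n (t - ln (mC (\<psi>0 \<omega>) c)) else 0) \<partial>M)"
    proof (cases "1 \<le> c")
      case True
      then have [measurable]: "(\<lambda>m. mC m c) \<in> borel_measurable mark_space" by (rule measurable_mC)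
      interpret R: product_prob_space "\<lambda>_. max_law n" "{1::nat..}"
        using prob_space_max_law by (simp add: product_prob_space_def product_sigma_finite_def
            product_prob_space_axioms_def prob_space_imp_sigma_finite)
      let ?f = "\<lambda>(m, r). indicator (children m) c * indicator {ennreal (exp t)<..} (ennreal (mC m c) * r c) :: ennreal"
      have rc [measurable]: "(\<lambda>r. r c) \<in> measurable (\<Pi>\<^sub>M c\<in>{1::nat..}. borel) (borel :: ennreal measure)"
        using True by (intro measurable_component_singleton) auto
      have f: "?f \<in> borel_measurable (mark_space \<Otimes>\<^sub>M (\<Pi>\<^sub>M c\<in>{1..}. borel))"
        unfolding indicator_def of_bool_def greaterThan_iff by measurable
      have "(\<integral>\<^sup>+\<omega>. indicator (children (\<psi> [] \<omega>)) c *
          indicator {ennreal (exp t)<..} (ennreal (mC (\<psi> [] \<omega>) c) * ?R c \<omega>) \<partial>M)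
        = (\<integral>\<^sup>+\<omega>. ?f (\<psi> [] \<omega>, \<lambda>c\<in>{1..}. ?R c \<omega>) \<partial>M)"
        using True by simp
      also have "\<dots> = (\<integral>\<^sup>+\<omega>. (\<integral>\<^sup>+r. ?f (\<psi>0 \<omega>, r) \<partial>(\<Pi>\<^sub>M c\<in>{1..}. max_law n)) \<partial>M)"
        by (rule nn_integral_root[OF f])
      also have "\<dots> = (\<integral>\<^sup>+\<omega>. indicator (children (\<psi>0 \<omega>)) c *
        (if 0 < mC (\<psi>0 \<omega>) c then tail n (t - ln (mC (\<psi>0 \<omega>) c)) else 0) \<partial>M)"
      proof (rule nn_integral_cong)
        fix \<omega> assume \<omega>: "\<omega> \<in> space M"
        let ?m = "\<psi>0 \<omega>"
        let ?A = "{x. ennreal (exp t) < ennreal (mC ?m c) * x}"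
        have A: "?A \<in> sets (max_law n)" by simp
        have "(\<integral>\<^sup>+r. ?f (?m, r) \<partial>(\<Pi>\<^sub>M c\<in>{1..}. max_law n))
          = (\<integral>\<^sup>+r. indicator (children ?m) c * indicator {r \<in> space (\<Pi>\<^sub>M c\<in>{1..}. max_law n). r c \<in> ?A} r \<partial>(\<Pi>\<^sub>M c\<in>{1..}. max_law n))"
          by (intro nn_integral_cong) (auto simp: indicator_def)
        also have "\<dots> = indicator (children ?m) c * emeasure (\<Pi>\<^sub>M c\<in>{1..}. max_law n) {r \<in> space (\<Pi>\<^sub>M c\<in>{1..}. max_law n). r c \<in> ?A}"
          using True A by (intro nn_integral_cmult_indicator sets_Collect_single') auto
        also have "emeasure (\<Pi>\<^sub>M c\<in>{1..}. max_law n) {r \<in> space (\<Pi>\<^sub>M c\<in>{1..}. max_law n). r c \<in> ?A} = emeasure (max_law n) ?A"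
          using True A by (intro R.emeasure_PiM_Collect_single) auto
        also have "\<dots> = (if 0 < mC ?m c then tail n (t - ln (mC ?m c)) else 0)"
          using admissible_psi0[OF \<omega>] True by (intro emeasure_max_law_mult) (auto simp: admissible_mark_def)
        finally show "(\<integral>\<^sup>+r. ?f (?m, r) \<partial>(\<Pi>\<^sub>M c\<in>{1..}. max_law n)) = indicator (children ?m) c *
          (if 0 < mC ?m c then tail n (t - ln (mC ?m c)) else 0)" .
      qed
      finally show ?thesis .
    next
      case False
      then have "\<And>m. c \<notin> children m" by (auto simp: children_def)
      then show ?thesis by simp
    qed
  qed
  also have "(\<Sum>c. \<integral>\<^sup>+\<omega>. indicator (children (\<psi>0 \<omega>)) c *
        (if 0 < mC (\<psi>0 \<omega>) c then tail n (t - ln (mC (\<psi>0 \<omega>) c)) else 0) \<partial>M)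
    = (\<integral>\<^sup>+\<omega>. child_sum (tail n) t (\<psi>0 \<omega>) \<partial>M)"
    unfolding child_sum_def by (rule nn_integral_suminf[symmetric]) measurable
  finally show ?thesis .
qed

text \<open>Given the root mark, the subtrees are independent, so the probability that none of them exceeds
  is a product, to which the second-order bound \<open>1 - \<Prod>(1 - q\<^sub>c) \<ge> s - s\<^sup>2\<close>, \<open>s = \<Sum> q\<^sub>c\<close>, applies.\<close>
lemma tail_lower_bound:
  assumes lm [measurable]: "l \<in> borel_measurable borel" and l: "\<And>t. l t \<le> tail n t"
    and p: "p \<le> 1"
    and s_def: "\<And>\<omega>. s \<omega> = p * indicator {ennreal (exp t)<..} (ennreal (mQ (\<psi>0 \<omega>))) + child_sum l t (\<psi>0 \<omega>)"
    and fin: "AE \<omega> in M. s \<omega> < \<infinity>"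
  shows "(\<integral>\<^sup>+\<omega>. s \<omega> - s \<omega> * s \<omega> \<partial>M) \<le> tail (Suc n) t"
proof -
  interpret L: prob_space "max_law n" by (rule prob_space_max_law)
  interpret R: product_prob_space "\<lambda>_. max_law n" "{1::nat..}"
    using prob_space_max_law by (simp add: product_prob_space_def product_sigma_finite_def
        product_prob_space_axioms_def prob_space_imp_sigma_finite)
  let ?P = "\<Pi>\<^sub>M c\<in>{1::nat..}. max_law n"
  \<comment> \<open>Exceedance as an event of the root mark and the subtree maxima alone, which is
    the form that \<open>nn_integral_root\<close> separates.\<close>
  define E where "E m r \<longleftrightarrow> ennreal (exp t) < ennreal (mQ m) \<or>
    (\<exists>c\<in>{1..}. c \<in> children m \<and> ennreal (exp t) < ennreal (mC m c) * r c)" for m and r :: "nat \<Rightarrow> ennreal"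
  have E_meas: "Measurable.pred (mark_space \<Otimes>\<^sub>M (\<Pi>\<^sub>M c\<in>{1..}. borel)) (\<lambda>(m, r). E m r)"
  proof -
    have *: "Measurable.pred (mark_space \<Otimes>\<^sub>M (\<Pi>\<^sub>M c\<in>{1..}. borel))
        (\<lambda>x. c \<in> children (fst x) \<and> ennreal (exp t) < ennreal (mC (fst x) c) * snd x c)" if "c \<in> {1..}" for c
    proof -
      have [measurable]: "(\<lambda>m. mC m c) \<in> borel_measurable mark_space" using that by (intro measurable_mC) auto
      have [measurable]: "(\<lambda>r. r c) \<in> measurable (\<Pi>\<^sub>M c\<in>{1::nat..}. borel) (borel :: ennreal measure)"
        using that by (intro measurable_component_singleton) auto
      show ?thesis by measurable
    qed
    have "Measurable.pred (mark_space \<Otimes>\<^sub>M (\<Pi>\<^sub>M c\<in>{1..}. borel))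
        (\<lambda>x. \<exists>c\<in>{1..}. c \<in> children (fst x) \<and> ennreal (exp t) < ennreal (mC (fst x) c) * snd x c)"
      by (intro pred_intros_countable_bounded *) auto
    then show ?thesis unfolding E_def split_beta' by measurable
  qed
  then have f: "(\<lambda>x. of_bool (case x of (m, r) \<Rightarrow> E m r) :: ennreal) \<in> borel_measurable (mark_space \<Otimes>\<^sub>M (\<Pi>\<^sub>M c\<in>{1..}. borel))"
    unfolding of_bool_def by measurable
  have "tail (Suc n) t = (\<integral>\<^sup>+\<omega>. of_bool (E (\<psi> [] \<omega>) (\<lambda>c\<in>{1..}. max_upto n (\<lambda>i. \<psi> (c # i) \<omega>))) \<partial>M)"
    unfolding tail_eq_nn_integral
  proof (rule nn_integral_cong)
    fix \<omega>
    have "ennreal (exp t) < max_upto (Suc n) (\<lambda>i. \<psi> i \<omega>) \<longleftrightarrow> E (\<psi> [] \<omega>) (\<lambda>c\<in>{1..}. max_upto n (\<lambda>i. \<psi> (c # i) \<omega>))"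
      unfolding E_def by (auto simp: max_upto_Suc less_max_iff_disj less_SUP_iff dest: children_ge_1)
    then show "indicator {ennreal (exp t)<..} (max_upto (Suc n) (\<lambda>i. \<psi> i \<omega>)) =
      (of_bool (E (\<psi> [] \<omega>) (\<lambda>c\<in>{1..}. max_upto n (\<lambda>i. \<psi> (c # i) \<omega>))) :: ennreal)"
      by (simp add: indicator_def)
  qed
  also have "\<dots> = (\<integral>\<^sup>+\<omega>. (\<integral>\<^sup>+r. of_bool (E (\<psi>0 \<omega>) r) \<partial>?P) \<partial>M)"
    using nn_integral_root[OF f, of n] by simp
  finally have eq: "tail (Suc n) t = (\<integral>\<^sup>+\<omega>. (\<integral>\<^sup>+r. of_bool (E (\<psi>0 \<omega>) r) \<partial>?P) \<partial>M)" .
  show ?thesis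
    unfolding eq using fin AE_space[of M]
  proof (intro nn_integral_mono_AE, eventually_elim)
    case (elim \<omega>)
    then have sfin: "s \<omega> < \<infinity>" and \<omega>: "\<omega> \<in> space M" by auto
    let ?m = "\<psi>0 \<omega>"
    have adm: "mC ?m c \<ge> 0" if "1 \<le> c" for c using admissible_psi0[OF \<omega>] that by (auto simp: admissible_mark_def)
    show "s \<omega> - s \<omega> * s \<omega> \<le> (\<integral>\<^sup>+r. of_bool (E ?m r) \<partial>?P)"
    \<comment> \<open>If the root exceeds, the inner probability is 1, and x - x * x is at most 1
      for every real x. Otherwise the \<open>p\<close>-term of \<open>s\<close> vanishes and only
      the children matter.\<close>
    proof (cases "ennreal (exp t) < ennreal (mQ ?m)")
      case True
      obtain x where x: "0 \<le> x" "s \<omega> = ennreal x" using sfin by (cases "s \<omega>") auto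
      have "x - x * x \<le> 1"
      proof -
        have "0 \<le> (x - 1/2)\<^sup>2" by simp
        then show ?thesis by (simp add: power2_eq_square algebra_simps)
      qed
      then have "s \<omega> - s \<omega> * s \<omega> \<le> 1"
        using x by (simp add: ennreal_mult[symmetric] ennreal_minus)
      also have "1 = (\<integral>\<^sup>+r. of_bool (E ?m r) \<partial>?P)"
        using True R.P.emeasure_space_1 by (simp add: E_def del: One_nat_def)
      finally show ?thesis .
    next
      case False
      define y where "y c = indicator (children ?m) c * (if 0 < mC ?m c then l (t - ln (mC ?m c)) else 0)" for c
      have s: "s \<omega> = (\<Sum>c. y c)" using False by (simp add: s_def child_sum_def y_def)
      have y1: "y c \<le> 1" for c
        using order_trans[OF l tail_le_1] by (auto simp: y_def indicator_def)
      define z where "z c = enn2real (y c)" for c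
      have yz: "y c = ennreal (z c)" and z0: "0 \<le> z c" for c
        using y1[of c] by (auto simp: z_def intro!: ennreal_enn2real[symmetric] intro: le_less_trans)
      have y_0: "y 0 = 0" by (simp add: y_def children_def)
      \<comment> \<open>The product bound concerns finitely many children. Finiteness of
        \<open>s\<close> makes the subtraction continuous when the number of children considered
        tends to infinity.\<close>
      have fin_bound: "(\<Sum>c<N. y c) - (\<Sum>c<N. y c) * (\<Sum>c<N. y c) \<le> (\<integral>\<^sup>+r. of_bool (E ?m r) \<partial>?P)" for N
      proof -
        define J where "J = {1..<N} \<inter> children ?m"
        define B where "B c = {x. \<not> ennreal (exp t) < ennreal (mC ?m c) * x}" for c
        define q where "q c = 1 - measure (max_law n) (B c)" for c
        have Bs: "B c \<in> sets (max_law n)" for c by (simp add: B_def)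
        have zq: "z c \<le> q c" if "c \<in> J" for c
        proof -
          have c: "1 \<le> c" using that by (auto simp: J_def)
          have "q c = measure (max_law n) {x. ennreal (exp t) < ennreal (mC ?m c) * x}"
          proof -
            have "UNIV - B c = {x. ennreal (exp t) < ennreal (mC ?m c) * x}" by (auto simp: B_def)
            then show ?thesis using L.prob_compl[OF Bs, of c] by (simp add: q_def)
          qed
          then have "ennreal (q c) = emeasure (max_law n) {x. ennreal (exp t) < ennreal (mC ?m c) * x}"
            by (simp add: L.emeasure_eq_measure)
          also have "\<dots> = (if 0 < mC ?m c then tail n (t - ln (mC ?m c)) else 0)"
            using adm[OF c] by (rule emeasure_max_law_mult)
          also have "\<dots> \<ge> y c" using l by (auto simp: y_def indicator_def)
          finally have "ennreal (z c) \<le> ennreal (q c)" by (simp add: yz)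
          moreover have "0 \<le> q c" by (simp add: q_def)
          ultimately show ?thesis by simp
        qed
        have q1: "q c \<le> 1" "0 \<le> q c" for c by (auto simp: q_def)
        have sumJ: "(\<Sum>c<N. y c) = ennreal (\<Sum>c\<in>J. z c)"
        proof -
          have "(\<Sum>c<N. y c) = (\<Sum>c\<in>J. y c)"
          proof (rule sum.mono_neutral_right)
            show "\<forall>c\<in>{..<N} - J. y c = 0"
            proof
              fix c assume "c \<in> {..<N} - J"
              then have "c = 0 \<or> c \<notin> children ?m" by (auto simp: J_def)
              then show "y c = 0" using y_0 by (auto simp: y_def)
            qed
          qed (auto simp: J_def)
          then show ?thesis using z0 by (simp add: yz)
        qed
        let ?N = "prod_emb {1..} (\<lambda>_. max_law n) J (Pi\<^sub>E J B)"
        have J: "J \<subseteq> {1..}" "finite J" by (auto simp: J_def)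
        have Ns: "?N \<in> sets ?P" using Bs by (intro sets_PiM_I) (auto simp: J_def)
        have "measure ?P ?N = (\<Prod>c\<in>J. 1 - q c)"
          using R.measure_PiM_emb[of J B, OF J Bs] by (simp add: q_def del: One_nat_def)
        also have "\<dots> \<le> (\<Prod>c\<in>J. 1 - z c)"
          using zq q1 by (intro prod_mono) auto
        also have "\<dots> \<le> 1 - sum z J + (sum z J)\<^sup>2"
          using zq z0 q1 by (intro prod_one_minus_le) (auto simp: J_def intro: order_trans)
        finally have pN: "sum z J - (sum z J)\<^sup>2 \<le> measure ?P (space ?P - ?N)"
          using R.P.prob_compl[OF Ns] by simp
        have "(\<Sum>c<N. y c) - (\<Sum>c<N. y c) * (\<Sum>c<N. y c) = ennreal (sum z J - (sum z J)\<^sup>2)"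
          unfolding sumJ using z0 by (simp add: ennreal_mult[symmetric] sum_nonneg ennreal_minus power2_eq_square)
        also have "\<dots> \<le> emeasure ?P (space ?P - ?N)"
          unfolding R.P.emeasure_eq_measure using pN by (rule ennreal_leI)
        also have "\<dots> = (\<integral>\<^sup>+r. indicator (space ?P - ?N) r \<partial>?P)"
          using Ns by simp
        also have "\<dots> \<le> (\<integral>\<^sup>+r. of_bool (E ?m r) \<partial>?P)"
        proof (rule nn_integral_mono)
          fix r assume r: "r \<in> space ?P"
          show "indicator (space ?P - ?N) r \<le> (of_bool (E ?m r) :: ennreal)"
          proof (cases "r \<in> space ?P - ?N")
            case True
            then have "\<exists>c\<in>J. r c \<notin> B c"
              using r by (auto simp: prod_emb_def space_PiM restrict_PiE_iff)
            then have "E ?m r" by (auto simp: E_def B_def J_def)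
            then show ?thesis by (simp add: indicator_def)
          qed simp
        qed
        finally show ?thesis .
      qed
      have "(\<lambda>N. \<Sum>c<N. y c) \<longlonglongrightarrow> s \<omega>"
        unfolding s by (rule summable_LIMSEQ[OF summableI])
      then have "(\<lambda>N. (\<Sum>c<N. y c) - (\<Sum>c<N. y c) * (\<Sum>c<N. y c)) \<longlonglongrightarrow> s \<omega> - s \<omega> * s \<omega>"
        using sfin by (intro tendsto_diff_ennreal tendsto_mult_ennreal) (auto simp: ennreal_mult_eq_top_iff)
      then show ?thesis by (rule LIMSEQ_le_const2) (use fin_bound in auto)
    qed
  qed
qed

end

section \<open>The tilted step distribution\<close>

locale tilted_branching = branching M \<psi>0 \<psi>
  for M :: "'a measure" and \<psi>0 :: "'a \<Rightarrow> mark" and \<psi> :: "nat list \<Rightarrow> 'a \<Rightarrow> mark" +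
  fixes \<alpha> \<beta> \<mu> :: real
  assumes alpha_pos: "\<alpha> > 0"
    and mean_one: "(\<integral>\<^sup>+\<omega>. power_sum \<alpha> (\<psi>0 \<omega>) \<partial>M) = 1"
    and log_summable: "AE \<omega> in M. summable (\<lambda>j. \<bar>log_term \<alpha> (\<psi>0 \<omega>) j\<bar>)"
    and log_integrable: "integrable M (\<lambda>\<omega>. \<Sum>j. log_term \<alpha> (\<psi>0 \<omega>) j)"
    and mu_eq: "\<mu> = (\<integral>\<omega>. (\<Sum>j. log_term \<alpha> (\<psi>0 \<omega>) j) \<partial>M)"
    and mu_pos: "\<mu> > 0"
    and beta: "0 < \<beta>" "\<beta> < \<alpha>" "(\<integral>\<^sup>+\<omega>. power_sum \<beta> (\<psi>0 \<omega>) \<partial>M) < 1"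
    and Q_moment: "(\<integral>\<^sup>+\<omega>. ennreal (mQ (\<psi>0 \<omega>) powr \<alpha>) \<partial>M) < \<infinity>"
    and nonarith: "\<not> arithmetic (eta M \<alpha> \<psi>0)"
begin

abbreviation "\<eta> \<equiv> eta M \<alpha> \<psi>0"

lemma sets_eta [simp, measurable_cong]: "sets \<eta> = sets borel"
  unfolding eta_def using sets.sigma_sets_eq[of "borel :: real measure"]
  by (simp add: sets_measure_of_conv)

definition eta_term :: "(real \<Rightarrow> ennreal) \<Rightarrow> nat \<Rightarrow> 'a \<Rightarrow> ennreal" where
  "eta_term f j \<omega> = indicator (children (\<psi>0 \<omega>)) j * ennreal (mC (\<psi>0 \<omega>) j powr \<alpha>) * f (ln (mC (\<psi>0 \<omega>) j))"

lemma measurable_mark_term: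
  fixes F :: "real \<Rightarrow> ennreal"
  assumes [measurable]: "F \<in> borel_measurable borel"
  shows "(\<lambda>\<omega>. indicator (children (\<psi>0 \<omega>)) j * F (mC (\<psi>0 \<omega>) j)) \<in> borel_measurable M"
proof (cases "1 \<le> j")
  case True
  then have [measurable]: "(\<lambda>m. mC m j) \<in> borel_measurable mark_space" by (rule measurable_mC)
  show ?thesis unfolding indicator_def of_bool_def by measurable
next
  case False
  then have "\<And>m. j \<notin> children m" by (auto simp: children_def)
  then show ?thesis by simp
qed

lemma measurable_eta_term [measurable]:
  assumes [measurable]: "f \<in> borel_measurable borel"
  shows "eta_term f j \<in> borel_measurable M"
  unfolding eta_term_def mult.assoc
  by (rule measurable_mark_term[of "\<lambda>x. ennreal (x powr \<alpha>) * f (ln x)"]) measurable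

text \<open>The defining formula of \<open>eta\<close> for sets, extended to functions by monotone
  classes. During the induction the sum over \<open>j\<close> stays outside the expectation, where
  linearity and monotone convergence act on each term separately.\<close>

lemma nn_integral_eta:
  assumes "f \<in> borel_measurable borel"
  shows "(\<integral>\<^sup>+x. f x \<partial>\<eta>) = (\<integral>\<^sup>+\<omega>. (\<Sum>j. eta_term f j \<omega>) \<partial>M)"
proof -
  have "f \<in> borel_measurable \<eta>" using assms by simp
  then have "(\<integral>\<^sup>+x. f x \<partial>\<eta>) = (\<Sum>j. \<integral>\<^sup>+\<omega>. eta_term f j \<omega> \<partial>M)"
  proof (induction rule: borel_measurable_induct)
    case (cong f g)
    moreover have "space \<eta> = UNIV" using sets_eq_imp_space_eq[OF sets_eta] by simp
    ultimately have "f = g" by auto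
    with cong show ?case by simp
  next
    case (set A)
    then have [measurable]: "A \<in> sets borel" by simp
    have "(\<integral>\<^sup>+x. indicator A x \<partial>\<eta>) = eta_fun M \<alpha> \<psi>0 A"
      using emeasure_eta[OF mark0, of A \<alpha>] set by simp
    also have "\<dots> = (\<Sum>j. \<integral>\<^sup>+\<omega>. eta_term (indicator A) j \<omega> \<partial>M)"
      unfolding eta_fun_def eta_term_def[symmetric] by (rule nn_integral_suminf) measurable
    finally show ?case .
  next
    case (mult u c)
    then have [measurable]: "u \<in> borel_measurable borel" by simp
    have e: "eta_term (\<lambda>x. c * u x) j \<omega> = c * eta_term u j \<omega>" for j \<omega>
      by (simp add: eta_term_def mult_ac)
    show ?case using mult by (simp add: e nn_integral_cmult)
  next
    case (add u v)
    then have [measurable]: "u \<in> borel_measurable borel" "v \<in> borel_measurable borel" by simp_all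
    have e: "eta_term (\<lambda>x. f x + g x) j \<omega> = eta_term f j \<omega> + eta_term g j \<omega>" for f g j \<omega>
      by (simp add: eta_term_def distrib_left)
    show ?case using add by (simp add: e nn_integral_add suminf_add[OF summableI summableI])
  next
    case (seq U)
    then have [measurable]: "\<And>i. U i \<in> borel_measurable borel" by simp
    have S: "Sup (range U) = (\<lambda>x. SUP i. U i x)" by (simp add: fun_eq_iff image_comp)
    have inc: "incseq (\<lambda>i. eta_term (U i) j)" for j
      using \<open>incseq U\<close> by (auto simp: eta_term_def mono_def le_fun_def intro!: mult_left_mono)
    have e: "eta_term (\<lambda>x. SUP i. U i x) j \<omega> = (SUP i. eta_term (U i) j \<omega>)" for j \<omega>
      by (simp add: eta_term_def SUP_mult_left_ennreal)
    have "(\<integral>\<^sup>+x. (SUP i. U i x) \<partial>\<eta>) = (SUP i. \<integral>\<^sup>+x. U i x \<partial>\<eta>)"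
      using seq by (intro nn_integral_monotone_convergence_SUP) auto
    also have "\<dots> = (SUP i. \<Sum>j. \<integral>\<^sup>+\<omega>. eta_term (U i) j \<omega> \<partial>M)" using seq by simp
    also have "\<dots> = (\<Sum>j. SUP i. \<integral>\<^sup>+\<omega>. eta_term (U i) j \<omega> \<partial>M)"
      using inc by (intro ennreal_suminf_SUP_eq[symmetric])
        (auto simp: mono_def le_fun_def intro!: nn_integral_mono)
    also have "\<dots> = (\<Sum>j. \<integral>\<^sup>+\<omega>. (SUP i. eta_term (U i) j \<omega>) \<partial>M)"
      using inc by (simp add: nn_integral_monotone_convergence_SUP)
    finally show ?case by (simp add: S e)
  qed
  also have "\<dots> = (\<integral>\<^sup>+\<omega>. (\<Sum>j. eta_term f j \<omega>) \<partial>M)"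
    using assms by (intro nn_integral_suminf[symmetric]) measurable
  finally show ?thesis .
qed

text \<open>At \<open>b = \<alpha>\<close> this is the total mass 1 of \<open>\<eta>\<close>; at
  \<open>b = \<beta>\<close> it turns the \<beta>-moment into an exponential moment below 1.
  Children of weight zero contribute nothing on either side.\<close>

lemma exp_moment_eta: "(\<integral>\<^sup>+y. ennreal (exp ((b - \<alpha>) * y)) \<partial>\<eta>) = (\<integral>\<^sup>+\<omega>. power_sum b (\<psi>0 \<omega>) \<partial>M)"
proof -
  have "(\<integral>\<^sup>+y. ennreal (exp ((b - \<alpha>) * y)) \<partial>\<eta>) = (\<integral>\<^sup>+\<omega>. (\<Sum>j. eta_term (\<lambda>y. ennreal (exp ((b - \<alpha>) * y))) j \<omega>) \<partial>M)"
    by (rule nn_integral_eta) measurable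
  also have "\<dots> = (\<integral>\<^sup>+\<omega>. power_sum b (\<psi>0 \<omega>) \<partial>M)"
  proof (rule nn_integral_cong)
    fix \<omega> assume \<omega>: "\<omega> \<in> space M"
    have "eta_term (\<lambda>y. ennreal (exp ((b - \<alpha>) * y))) j \<omega> =
      indicator (children (\<psi>0 \<omega>)) j * ennreal (mC (\<psi>0 \<omega>) j powr b)" for j
    proof (cases "j \<in> children (\<psi>0 \<omega>)")
      case True
      then have "0 \<le> mC (\<psi>0 \<omega>) j"
        using admissible_psi0[OF \<omega>] by (auto simp: admissible_mark_def children_def)
      then have "mC (\<psi>0 \<omega>) j powr \<alpha> * exp ((b - \<alpha>) * ln (mC (\<psi>0 \<omega>) j)) = mC (\<psi>0 \<omega>) j powr b"
        by (auto simp: powr_def exp_add[symmetric] algebra_simps)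
      then show ?thesis by (simp add: eta_term_def ennreal_mult'[symmetric] mult.assoc)
    qed (simp add: eta_term_def)
    then show "(\<Sum>j. eta_term (\<lambda>y. ennreal (exp ((b - \<alpha>) * y))) j \<omega>) = power_sum b (\<psi>0 \<omega>)"
      by (simp add: power_sum_def)
  qed
  finally show ?thesis .
qed

sublocale step: real_step \<eta>
proof -
  have "emeasure \<eta> (space \<eta>) = (\<integral>\<^sup>+y. ennreal (exp ((\<alpha> - \<alpha>) * y)) \<partial>\<eta>)" by simp
  also have "\<dots> = 1" unfolding exp_moment_eta mean_one ..
  finally have "prob_space \<eta>" by (rule prob_spaceI)
  then show "real_step \<eta>" by (simp add: real_step_def real_step_axioms_def)
qed

text \<open>The exponential tilt behind the renewal equation: at \<open>b = \<alpha>\<close> the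
  first factor on the right is 1 and what remains is a convolution with
  \<open>\<eta>\<close>.\<close>

lemma child_sum_eta:
  assumes [measurable]: "f \<in> borel_measurable borel"
  shows "ennreal (exp (b * t)) * (\<integral>\<^sup>+\<omega>. child_sum f t (\<psi>0 \<omega>) \<partial>M)
    = (\<integral>\<^sup>+y. ennreal (exp ((b - \<alpha>) * y)) * (ennreal (exp (b * (t - y))) * f (t - y)) \<partial>\<eta>)"
proof -
  have "(\<integral>\<^sup>+y. ennreal (exp ((b - \<alpha>) * y)) * (ennreal (exp (b * (t - y))) * f (t - y)) \<partial>\<eta>)
      = (\<integral>\<^sup>+\<omega>. (\<Sum>j. eta_term (\<lambda>y. ennreal (exp ((b - \<alpha>) * y)) * (ennreal (exp (b * (t - y))) * f (t - y))) j \<omega>) \<partial>M)"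
    by (rule nn_integral_eta) measurable
  also have "\<dots> = (\<integral>\<^sup>+\<omega>. ennreal (exp (b * t)) * child_sum f t (\<psi>0 \<omega>) \<partial>M)"
  proof (rule nn_integral_cong)
    fix \<omega> assume \<omega>: "\<omega> \<in> space M"
    have "eta_term (\<lambda>y. ennreal (exp ((b - \<alpha>) * y)) * (ennreal (exp (b * (t - y))) * f (t - y))) j \<omega> = ennreal (exp (b * t)) *
        (indicator (children (\<psi>0 \<omega>)) j * (if 0 < mC (\<psi>0 \<omega>) j then f (t - ln (mC (\<psi>0 \<omega>) j)) else 0))" for j
    proof (cases "j \<in> children (\<psi>0 \<omega>) \<and> 0 < mC (\<psi>0 \<omega>) j")
      case True
      let ?C = "mC (\<psi>0 \<omega>) j"
      have "?C powr \<alpha> * (exp ((b - \<alpha>) * ln ?C) * exp (b * (t - ln ?C))) = exp (b * t)"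
        using True by (simp add: powr_def exp_add[symmetric] algebra_simps)
      then have "ennreal (?C powr \<alpha>) * (ennreal (exp ((b - \<alpha>) * ln ?C)) * ennreal (exp (b * (t - ln ?C)))) = ennreal (exp (b * t))"
        by (simp add: ennreal_mult'[symmetric])
      with True show ?thesis by (simp add: eta_term_def mult.assoc[symmetric])
    next
      case False
      then show ?thesis
        using admissible_psi0[OF \<omega>] by (auto simp: eta_term_def admissible_mark_def children_def indicator_def)
    qed
    then show "(\<Sum>j. eta_term (\<lambda>y. ennreal (exp ((b - \<alpha>) * y)) * (ennreal (exp (b * (t - y))) * f (t - y))) j \<omega>) = ennreal (exp (b * t)) * child_sum f t (\<psi>0 \<omega>)"
      by (simp add: child_sum_def)
  qed
  also have "\<dots> = ennreal (exp (b * t)) * (\<integral>\<^sup>+\<omega>. child_sum f t (\<psi>0 \<omega>) \<partial>M)"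
    by (rule nn_integral_cmult) measurable
  finally show ?thesis by simp
qed

text \<open>Integrability of the series controls only the difference of its positive and negative
  parts, which may cancel inside the sum. The negative part is bounded by the exponential moment at
  \<open>\<beta>\<close>, and the identity P + D2 = N + D1 then bounds the positive part.\<close>

lemma eta_first_moment: "integrable \<eta> (\<lambda>y. y)" "(\<integral>y. y \<partial>\<eta>) = \<mu>"
proof -
  define D where "D \<omega> = (\<Sum>j. log_term \<alpha> (\<psi>0 \<omega>) j)" for \<omega>
  have Dint: "integrable M D" using log_integrable by (simp add: D_def[abs_def])
  have pos: "eta_term (\<lambda>y. ennreal y) j \<omega> = ennreal (log_term \<alpha> (\<psi>0 \<omega>) j)"
    and neg: "eta_term (\<lambda>y. ennreal (- y)) j \<omega> = ennreal (- log_term \<alpha> (\<psi>0 \<omega>) j)" for j \<omega>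
    by (auto simp: eta_term_def log_term_def ennreal_mult'[symmetric] indicator_def)
  \<comment> \<open>With A and B the sums of the positive and the negative parts, this reads A + (A
    - B)^- = B + (A - B)^+, which needs no subtraction after integration.\<close>
  have pt: "(\<Sum>j. eta_term (\<lambda>y. ennreal y) j \<omega>) + ennreal (- D \<omega>)
      = (\<Sum>j. eta_term (\<lambda>y. ennreal (- y)) j \<omega>) + ennreal (D \<omega>)"
    if sm: "summable (\<lambda>j. \<bar>log_term \<alpha> (\<psi>0 \<omega>) j\<bar>)" for \<omega>
  proof -
    let ?x = "log_term \<alpha> (\<psi>0 \<omega>)"
    have me: "ennreal (max 0 x) = ennreal x" for x by (simp add: max_def ennreal_neg)
    have s1: "summable (\<lambda>j. max 0 (?x j))" by (rule summable_comparison_test'[OF sm]) auto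
    have s2: "summable (\<lambda>j. max 0 (- ?x j))" by (rule summable_comparison_test'[OF sm]) auto
    define A where "A = (\<Sum>j. max 0 (?x j))"
    define B where "B = (\<Sum>j. max 0 (- ?x j))"
    have AB: "0 \<le> A" "0 \<le> B" unfolding A_def B_def by (intro suminf_nonneg s1 s2; simp)+
    have "D \<omega> = A - B" unfolding D_def A_def B_def
      by (subst suminf_diff[OF s1 s2]) (auto intro!: suminf_cong)
    moreover have "(\<Sum>j. eta_term (\<lambda>y. ennreal y) j \<omega>) = ennreal A"
      using suminf_ennreal2[OF _ s1] by (simp add: pos A_def me)
    moreover have "(\<Sum>j. eta_term (\<lambda>y. ennreal (- y)) j \<omega>) = ennreal B"
      using suminf_ennreal2[OF _ s2] by (simp add: neg B_def me)
    ultimately show ?thesis using AB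
      by (cases "A \<le> B") (auto simp: ennreal_neg ennreal_plus[symmetric] simp del: ennreal_plus)
  qed
  define P where "P = (\<integral>\<^sup>+y. ennreal y \<partial>\<eta>)"
  define N where "N = (\<integral>\<^sup>+y. ennreal (- y) \<partial>\<eta>)"
  define D1 where "D1 = (\<integral>\<^sup>+\<omega>. ennreal (D \<omega>) \<partial>M)"
  define D2 where "D2 = (\<integral>\<^sup>+\<omega>. ennreal (- D \<omega>) \<partial>M)"
  have [measurable]: "D \<in> borel_measurable M" using Dint by simp
  have "P + D2 = (\<integral>\<^sup>+\<omega>. (\<Sum>j. eta_term (\<lambda>y. ennreal y) j \<omega>) + ennreal (- D \<omega>) \<partial>M)"
    unfolding P_def D2_def by (subst nn_integral_eta) (auto simp: nn_integral_add)
  also have "\<dots> = (\<integral>\<^sup>+\<omega>. (\<Sum>j. eta_term (\<lambda>y. ennreal (- y)) j \<omega>) + ennreal (D \<omega>) \<partial>M)"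
    using log_summable by (intro nn_integral_cong_AE) (auto elim!: eventually_mono intro: pt)
  also have "\<dots> = N + D1"
    unfolding N_def D1_def by (subst nn_integral_eta) (auto simp: nn_integral_add)
  finally have eq: "P + D2 = N + D1" .
  have Dfin: "D1 < \<infinity>" "D2 < \<infinity>"
    using Dint unfolding D1_def D2_def real_integrable_def by (auto simp: less_top)
  have "N < \<infinity>"
  proof -
    have "N \<le> (\<integral>\<^sup>+y. ennreal (1 / (\<alpha> - \<beta>)) * ennreal (exp ((\<beta> - \<alpha>) * y)) \<partial>\<eta>)"
      unfolding N_def
    proof (rule nn_integral_mono)
      fix y :: real
      have "1 + (\<beta> - \<alpha>) * y \<le> exp ((\<beta> - \<alpha>) * y)" by (rule exp_ge_add_one_self)
      then have "- y \<le> 1 / (\<alpha> - \<beta>) * exp ((\<beta> - \<alpha>) * y)"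
        using beta(2) by (simp add: field_simps)
      then show "ennreal (- y) \<le> ennreal (1 / (\<alpha> - \<beta>)) * ennreal (exp ((\<beta> - \<alpha>) * y))"
        using beta(2) by (simp add: ennreal_mult'[symmetric] ennreal_leI)
    qed
    also have "\<dots> = ennreal (1 / (\<alpha> - \<beta>)) * (\<integral>\<^sup>+\<omega>. power_sum \<beta> (\<psi>0 \<omega>) \<partial>M)"
      by (subst nn_integral_cmult) (auto simp: exp_moment_eta)
    also have "\<dots> < \<infinity>"
      using beta(3) by (auto simp: ennreal_mult_less_top intro: order.strict_trans)
    finally show ?thesis .
  qed
  moreover from this have "P < \<infinity>"
    using Dfin eq by (metis ennreal_add_eq_top infinity_ennreal_def less_top)
  ultimately show int: "integrable \<eta> (\<lambda>y. y)"
    unfolding real_integrable_def P_def N_def by auto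
  have "enn2real P + enn2real D2 = enn2real N + enn2real D1"
    using eq Dfin \<open>N < \<infinity>\<close> \<open>P < \<infinity>\<close> by (metis enn2real_plus infinity_ennreal_def)
  moreover have "\<mu> = enn2real D1 - enn2real D2"
    unfolding mu_eq D_def[symmetric] D1_def D2_def by (rule real_lebesgue_integral_def[OF Dint])
  moreover have "(\<integral>y. y \<partial>\<eta>) = enn2real P - enn2real N"
    unfolding P_def N_def by (rule real_lebesgue_integral_def[OF int])
  ultimately show "(\<integral>y. y \<partial>\<eta>) = \<mu>" by simp
qed

end

section \<open>Tail asymptotics\<close>

lemma nn_integral_exp_below:
  assumes a: "0 < (a :: real)"
  shows "(\<integral>\<^sup>+t. ennreal (exp (a * t)) * indicator {..<x} t \<partial>lborel) = ennreal (exp (a * x) / a)"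
proof -
  have "(\<integral>\<^sup>+t. ennreal (exp (a * t)) * indicator {..<x} t \<partial>lborel)
      = (\<integral>\<^sup>+t. ennreal (exp (a * t)) * indicator {..x} t \<partial>lborel)"
  proof (rule nn_integral_cong_AE)
    show "AE t in lborel. ennreal (exp (a * t)) * indicator {..<x} t = ennreal (exp (a * t)) * indicator {..x} t"
      using AE_lborel_singleton[of x] by eventually_elim (auto simp: indicator_def)
  qed
  also have "\<dots> = ennreal \<bar>-1\<bar> * (\<integral>\<^sup>+t. ennreal (exp (a * (0 + (-1) * t))) * indicator {..x} (0 + (-1) * t) \<partial>lborel)"
    by (rule nn_integral_real_affine) auto
  also have "\<dots> = (\<integral>\<^sup>+t. ennreal (exp (- a * t)) * indicator {- x..} t \<partial>lborel)"
    by (auto intro!: nn_integral_cong simp: indicator_def)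
  also have "\<dots> = 0 - (- exp (- a * (- x)) / a)"
  proof (rule nn_integral_FTC_atLeast)
    show "((\<lambda>t. - exp (- a * t) / a) has_real_derivative exp (- a * t)) (at t)" for t
      using a by (auto intro!: derivative_eq_intros)
    have "((\<lambda>t. exp (- (a * t))) \<longlongrightarrow> 0) at_top"
      using a by (intro filterlim_compose[OF exp_at_bot] filterlim_uminus_at_bot_at_top[THEN filterlim_compose]
          filterlim_tendsto_pos_mult_at_top[OF tendsto_const _ filterlim_ident])
    then show "((\<lambda>t. - exp (- a * t) / a) \<longlongrightarrow> 0) at_top"
      using tendsto_minus[OF tendsto_divide[OF _ tendsto_const, of _ 0 at_top a]] a by fastforce
  qed auto
  finally show ?thesis by simp
qed

lemma nn_integral_exp_less:
  assumes a: "0 < (a :: real)" and q: "0 \<le> q"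
  shows "(\<integral>\<^sup>+t. ennreal (exp (a * t)) * indicator {ennreal (exp t)<..} (ennreal q) \<partial>lborel) = ennreal (q powr a / a)"
proof (cases "q = 0")
  case False
  then have "indicator {ennreal (exp t)<..} (ennreal q) = (indicator {..<ln q} t :: ennreal)" for t
    using q exp_less_cancel_iff[of t "ln q"] by (simp add: indicator_def ennreal_less_iff)
  then show ?thesis using nn_integral_exp_below[OF a, of "ln q"] False q
    by (simp add: powr_def)
qed simp

section \<open>Mass and uniform boundedness of the scaled tails\<close>

context tilted_branching
begin

definition gtail :: "nat \<Rightarrow> real \<Rightarrow> ennreal" where
  "gtail n t = ennreal (exp (\<alpha> * t)) * tail n t"

definition gexcess :: "nat \<Rightarrow> real \<Rightarrow> ennreal" where
  "gexcess n t = ennreal (exp (\<alpha> * t)) * excess n t"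

lemma measurable_gtail [measurable]: "gtail n \<in> borel_measurable borel"
  unfolding gtail_def by measurable

lemma measurable_gexcess [measurable]: "gexcess n \<in> borel_measurable borel"
  unfolding gexcess_def by measurable

lemma gtail_mono: "gtail n t \<le> gtail (Suc n) t"
  unfolding gtail_def by (intro mult_left_mono tail_mono_n) auto

lemma gexcess_mono: "gexcess n t \<le> gexcess (Suc n) t"
  unfolding gexcess_def by (intro mult_left_mono excess_mono) auto

lemma gtail_recursion: "gtail (Suc n) t + gexcess n t = gtail 0 t + (\<integral>\<^sup>+y. gtail n (t - y) \<partial>\<eta>)"
proof -
  have "gtail (Suc n) t + gexcess n t = ennreal (exp (\<alpha> * t)) * (tail (Suc n) t + excess n t)"
    by (simp add: gtail_def gexcess_def distrib_left)
  also have "\<dots> = gtail 0 t + ennreal (exp (\<alpha> * t)) * (\<integral>\<^sup>+\<omega>. child_sum (tail n) t (\<psi>0 \<omega>) \<partial>M)"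
    unfolding tail_recursion by (simp add: gtail_def distrib_left)
  also have "ennreal (exp (\<alpha> * t)) * (\<integral>\<^sup>+\<omega>. child_sum (tail n) t (\<psi>0 \<omega>) \<partial>M) = (\<integral>\<^sup>+y. gtail n (t - y) \<partial>\<eta>)"
    by (subst child_sum_eta[OF measurable_tail]) (simp add: gtail_def)
  finally show ?thesis .
qed

text \<open>By the layer-cake formula this is the \<alpha>-th moment of the maximum up to generation
  \<open>n\<close>, divided by \<alpha>; it is evaluated explicitly only for
  \<open>n = 0\<close>.\<close>

definition tail_int :: "nat \<Rightarrow> ennreal" where
  "tail_int n = (\<integral>\<^sup>+t. gtail n t \<partial>lborel)"

lemma tail_int_0: "tail_int 0 = (\<integral>\<^sup>+\<omega>. ennreal (mQ (\<psi>0 \<omega>) powr \<alpha> / \<alpha>) \<partial>M)"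
proof -
  interpret P: pair_sigma_finite lborel M ..
  have [measurable]: "(\<lambda>x. indicator {ennreal (exp (fst x))<..} (ennreal (mQ (\<psi>0 (snd x)))) :: ennreal)
      \<in> borel_measurable (lborel \<Otimes>\<^sub>M M)"
    unfolding indicator_def of_bool_def greaterThan_iff by measurable
  have "tail_int 0 = (\<integral>\<^sup>+t. (\<integral>\<^sup>+\<omega>. ennreal (exp (\<alpha> * t)) * indicator {ennreal (exp t)<..} (ennreal (mQ (\<psi>0 \<omega>))) \<partial>M) \<partial>lborel)"
    unfolding tail_int_def gtail_def tail_0
    by (intro nn_integral_cong nn_integral_cmult[symmetric])
      (simp add: indicator_def of_bool_def)
  also have "\<dots> = (\<integral>\<^sup>+\<omega>. (\<integral>\<^sup>+t. ennreal (exp (\<alpha> * t)) * indicator {ennreal (exp t)<..} (ennreal (mQ (\<psi>0 \<omega>))) \<partial>lborel) \<partial>M)"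
    by (rule P.Fubini'[symmetric]) (simp add: split_beta')
  also have "\<dots> = (\<integral>\<^sup>+\<omega>. ennreal (mQ (\<psi>0 \<omega>) powr \<alpha> / \<alpha>) \<partial>M)"
    using alpha_pos admissible_psi0 by (intro nn_integral_cong nn_integral_exp_less) (auto simp: admissible_mark_def)
  finally show ?thesis .
qed

lemma tail_int_0_finite: "tail_int 0 < \<infinity>"
proof -
  have "tail_int 0 = (\<integral>\<^sup>+\<omega>. ennreal (1 / \<alpha>) * ennreal (mQ (\<psi>0 \<omega>) powr \<alpha>) \<partial>M)"
    unfolding tail_int_0 using alpha_pos by (intro nn_integral_cong) (simp add: ennreal_mult'[symmetric])
  also have "\<dots> = ennreal (1 / \<alpha>) * (\<integral>\<^sup>+\<omega>. ennreal (mQ (\<psi>0 \<omega>) powr \<alpha>) \<partial>M)"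
    by (rule nn_integral_cmult) measurable
  finally show ?thesis using Q_moment by (simp add: ennreal_mult_less_top)
qed

lemma nn_integral_lborel_shift:
  fixes c :: real
  assumes [measurable]: "f \<in> borel_measurable borel"
  shows "(\<integral>\<^sup>+t. f (t + c) \<partial>lborel) = (\<integral>\<^sup>+t. f t \<partial>lborel)"
  using nn_integral_real_affine[of f 1 c] by (simp add: add.commute)

text \<open>Duality of the step operator with respect to Lebesgue measure. With \<open>h = 1\<close>
  it shows that convolution preserves mass; with a superharmonic \<open>h\<close> it yields the
  uniform bound.\<close>

lemma nn_integral_convolution:
  assumes [measurable]: "f \<in> borel_measurable borel" "h \<in> borel_measurable borel"
  shows "(\<integral>\<^sup>+t. (\<integral>\<^sup>+y. f (t - y) \<partial>\<eta>) * h t \<partial>lborel) = (\<integral>\<^sup>+t. f t * (\<integral>\<^sup>+y. h (t + y) \<partial>\<eta>) \<partial>lborel)"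
proof -
  interpret P: pair_sigma_finite lborel \<eta> ..
  have "(\<integral>\<^sup>+t. (\<integral>\<^sup>+y. f (t - y) \<partial>\<eta>) * h t \<partial>lborel) = (\<integral>\<^sup>+t. (\<integral>\<^sup>+y. f (t - y) * h t \<partial>\<eta>) \<partial>lborel)"
    by (intro nn_integral_cong nn_integral_multc[symmetric]) measurable
  also have "\<dots> = (\<integral>\<^sup>+y. (\<integral>\<^sup>+t. f (t - y) * h t \<partial>lborel) \<partial>\<eta>)"
    by (rule P.Fubini'[symmetric]) measurable
  also have "\<dots> = (\<integral>\<^sup>+y. (\<integral>\<^sup>+t. f t * h (t + y) \<partial>lborel) \<partial>\<eta>)"
  proof (rule nn_integral_cong)
    fix y show "(\<integral>\<^sup>+t. f (t - y) * h t \<partial>lborel) = (\<integral>\<^sup>+t. f t * h (t + y) \<partial>lborel)"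
      using nn_integral_lborel_shift[of "\<lambda>t. f (t - y) * h t" y] by simp
  qed
  also have "\<dots> = (\<integral>\<^sup>+t. (\<integral>\<^sup>+y. f t * h (t + y) \<partial>\<eta>) \<partial>lborel)"
    by (rule P.Fubini') measurable
  also have "\<dots> = (\<integral>\<^sup>+t. f t * (\<integral>\<^sup>+y. h (t + y) \<partial>\<eta>) \<partial>lborel)"
    by (intro nn_integral_cong nn_integral_cmult) measurable
  finally show ?thesis .
qed

lemma tail_int_recursion: "tail_int (Suc n) + (\<integral>\<^sup>+t. gexcess n t \<partial>lborel) = tail_int 0 + tail_int n"
proof -
  have "tail_int (Suc n) + (\<integral>\<^sup>+t. gexcess n t \<partial>lborel) = (\<integral>\<^sup>+t. gtail 0 t + (\<integral>\<^sup>+y. gtail n (t - y) \<partial>\<eta>) * 1 \<partial>lborel)"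
    unfolding tail_int_def by (subst nn_integral_add[symmetric]) (auto simp: gtail_recursion)
  also have "\<dots> = tail_int 0 + (\<integral>\<^sup>+t. (\<integral>\<^sup>+y. gtail n (t - y) \<partial>\<eta>) * 1 \<partial>lborel)"
    unfolding tail_int_def by (rule nn_integral_add) measurable
  also have "(\<integral>\<^sup>+t. (\<integral>\<^sup>+y. gtail n (t - y) \<partial>\<eta>) * 1 \<partial>lborel) = tail_int n"
    using step.emeasure_space_1 by (subst nn_integral_convolution) (auto simp: tail_int_def)
  finally show ?thesis .
qed

text \<open>Each generation adds at most \<open>tail_int 0\<close>. The bound grows with
  \<open>n\<close>, so it permits cancellation for fixed \<open>n\<close> but says nothing about the
  limit.\<close>

lemma tail_int_finite: "tail_int n < \<infinity>"
proof (induction n)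
  case (Suc n)
  have "tail_int (Suc n) \<le> tail_int 0 + tail_int n"
    unfolding tail_int_recursion[symmetric] by simp
  also have "\<dots> < \<infinity>" using Suc tail_int_0_finite by (simp add: ennreal_add_less_top)
  finally show ?case .
qed (rule tail_int_0_finite)

text \<open>The weight \<open>h(t) = min(1, exp (-\<theta> (t - T)))\<close> is superharmonic for the walk, strictly so on
  \<open>[T, T + 1]\<close>; testing the recursion against it bounds the mass of \<open>gtail\<close> on that interval.\<close>
lemma gtail_bounded: "\<exists>B. \<forall>n t. gtail n t \<le> ennreal B"
proof -
  define \<theta> where "\<theta> = \<alpha> - \<beta>"
  have \<theta>: "\<theta> > 0" using beta by (simp add: \<theta>_def)
  obtain r where r: "(\<integral>\<^sup>+\<omega>. power_sum \<beta> (\<psi>0 \<omega>) \<partial>M) = ennreal r" "0 \<le> r" "r < 1"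
    using beta(3) by (cases "\<integral>\<^sup>+\<omega>. power_sum \<beta> (\<psi>0 \<omega>) \<partial>M") (auto simp: ennreal_less_one_iff)
  \<comment> \<open>The least drop of the weight under one step on [T, T + 1]: there h t is at least
    exp (-\<theta>), while the step multiplies the exponential by \<open>r\<close>.\<close>
  define \<kappa> where "\<kappa> = (1 - r) * exp (- \<theta>)"
  have \<kappa>: "\<kappa> > 0" using r by (simp add: \<kappa>_def)
  obtain c where c: "tail_int 0 = ennreal c" "0 \<le> c" using tail_int_0_finite by (cases "tail_int 0") auto
  have "gtail n (T + 1) \<le> ennreal (exp \<alpha> * c / \<kappa>)" for n T
  proof -
    define h where "h t = min 1 (exp (- \<theta> * (t - T)))" for t
    have h: "0 \<le> h t" "h t \<le> 1" for t by (auto simp: h_def)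
    have [measurable]: "h \<in> borel_measurable borel" unfolding h_def by measurable
    define Ph where "Ph t = (\<integral>\<^sup>+y. ennreal (h (t + y)) \<partial>\<eta>)" for t
    have [measurable]: "Ph \<in> borel_measurable borel" unfolding Ph_def by measurable
    have Ph1: "Ph t \<le> 1" for t
    proof -
      have "Ph t \<le> (\<integral>\<^sup>+y. 1 \<partial>\<eta>)" unfolding Ph_def using h by (intro nn_integral_mono) auto
      then show ?thesis using step.emeasure_space_1 by simp
    qed
    have Phr: "Ph t \<le> ennreal (r * exp (- \<theta> * (t - T)))" for t
    proof -
      have "Ph t \<le> (\<integral>\<^sup>+y. ennreal (exp (- \<theta> * (t - T))) * ennreal (exp ((\<beta> - \<alpha>) * y)) \<partial>\<eta>)"
        unfolding Ph_def
        by (intro nn_integral_mono) (simp add: ennreal_mult'[symmetric] h_def exp_add[symmetric] \<theta>_def algebra_simps min.coboundedI2)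
      also have "\<dots> = ennreal (exp (- \<theta> * (t - T))) * (\<integral>\<^sup>+y. ennreal (exp ((\<beta> - \<alpha>) * y)) \<partial>\<eta>)"
        by (rule nn_integral_cmult) measurable
      also have "\<dots> = ennreal (r * exp (- \<theta> * (t - T)))"
        unfolding exp_moment_eta r using r by (simp add: ennreal_mult'[symmetric] mult.commute)
      finally show ?thesis .
    qed
    have super: "Ph t + ennreal \<kappa> * indicator {T..T + 1} t \<le> ennreal (h t)" for t
    proof (cases "t \<in> {T..T + 1}")
      case True
      have e: "exp (- \<theta>) \<le> exp (- \<theta> * (t - T))" "exp (- \<theta> * (t - T)) \<le> 1"
        using True \<theta> by (auto simp: mult_le_cancel_left2)
      then have "h t = exp (- \<theta> * (t - T))" by (simp add: h_def)
      moreover have "(1 - r) * exp (- \<theta>) \<le> (1 - r) * exp (- \<theta> * (t - T))"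
        using e r by (intro mult_left_mono) auto
      ultimately have "r * exp (- \<theta> * (t - T)) + \<kappa> \<le> h t" by (simp add: \<kappa>_def algebra_simps)
      then have "ennreal (r * exp (- \<theta> * (t - T))) + ennreal \<kappa> \<le> ennreal (h t)"
        using r \<kappa> by (simp add: ennreal_plus[symmetric] ennreal_leI del: ennreal_plus)
      then show ?thesis using True Phr[of t] by (auto intro: order_trans[OF add_right_mono])
    next
      case False
      have "Ph t \<le> ennreal (h t)"
      proof (cases "t \<le> T")
        case True
        then have "h t = 1" using \<theta> by (simp add: h_def mult_nonneg_nonpos)
        then show ?thesis using Ph1 by simp
      next
        case f: False
        then have "h t = exp (- \<theta> * (t - T))" using \<theta> by (simp add: h_def)
        moreover have "r * exp (- \<theta> * (t - T)) \<le> exp (- \<theta> * (t - T))" using r by simp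
        ultimately show ?thesis using Phr[of t] by (metis ennreal_leI order_trans)
      qed
      with False show ?thesis by simp
    qed
    define X where "X = (\<integral>\<^sup>+t. gtail n t * ennreal (h t) \<partial>lborel)"
    define Y where "Y = (\<integral>\<^sup>+t. gtail n t * Ph t \<partial>lborel)"
    define L where "L = (\<integral>\<^sup>+t. gtail n t * indicator {T..T + 1} t \<partial>lborel)"
    have "Y + ennreal \<kappa> * L = (\<integral>\<^sup>+t. gtail n t * Ph t + ennreal \<kappa> * (gtail n t * indicator {T..T + 1} t) \<partial>lborel)"
      unfolding Y_def L_def by (subst nn_integral_add) (auto simp: nn_integral_cmult)
    also have "\<dots> \<le> X"
      unfolding X_def
    proof (rule nn_integral_mono)
      fix t
      show "gtail n t * Ph t + ennreal \<kappa> * (gtail n t * indicator {T..T + 1} t) \<le> gtail n t * ennreal (h t)"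
        using mult_left_mono[OF super[of t], of "gtail n t"] by (simp add: distrib_left mult_ac)
    qed
    \<comment> \<open>Monotonicity in \<open>n\<close> turns the recursion, which links
      \<open>n\<close> and \<open>Suc n\<close>, into an inequality for \<open>gtail n\<close>
      alone.\<close>
    also have "X \<le> (\<integral>\<^sup>+t. (gtail 0 t + (\<integral>\<^sup>+y. gtail n (t - y) \<partial>\<eta>)) * ennreal (h t) \<partial>lborel)"
      unfolding X_def gtail_recursion[symmetric]
    proof (intro nn_integral_mono mult_right_mono)
      fix t show "gtail n t \<le> gtail (Suc n) t + gexcess n t"
        using gtail_mono[of n t] by (simp add: add_increasing2)
    qed simp
    also have "\<dots> = (\<integral>\<^sup>+t. gtail 0 t * ennreal (h t) \<partial>lborel) + (\<integral>\<^sup>+t. (\<integral>\<^sup>+y. gtail n (t - y) \<partial>\<eta>) * ennreal (h t) \<partial>lborel)"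
      by (subst nn_integral_add[symmetric]) (auto simp: distrib_right)
    also have "(\<integral>\<^sup>+t. (\<integral>\<^sup>+y. gtail n (t - y) \<partial>\<eta>) * ennreal (h t) \<partial>lborel) = Y"
      unfolding Y_def Ph_def by (rule nn_integral_convolution) measurable
    also have "(\<integral>\<^sup>+t. gtail 0 t * ennreal (h t) \<partial>lborel) \<le> ennreal c"
      unfolding c(1)[symmetric] tail_int_def
    proof (rule nn_integral_mono)
      fix t show "gtail 0 t * ennreal (h t) \<le> gtail 0 t"
        using mult_left_mono[of "ennreal (h t)" 1 "gtail 0 t"] h[of t] by simp
    qed
    finally have "Y + ennreal \<kappa> * L \<le> ennreal c + Y" by (simp add: add_right_mono)
    \<comment> \<open>Finiteness allows \<open>Y\<close> to be cancelled; what remains depends on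
      neither \<open>n\<close> nor \<open>T\<close>.\<close>
    moreover have "Y < \<infinity>"
    proof -
      have "Y \<le> tail_int n"
        unfolding Y_def tail_int_def
      proof (rule nn_integral_mono)
        fix t show "gtail n t * Ph t \<le> gtail n t"
          using mult_left_mono[OF Ph1[of t], of "gtail n t"] by simp
      qed
      then show ?thesis using tail_int_finite[of n] by (rule le_less_trans)
    qed
    ultimately have KL: "ennreal \<kappa> * L \<le> ennreal c" by (auto simp: add.commute[of _ Y])
    \<comment> \<open>The tail decreases, so its value at the right end is controlled by the mass
      over the interval; the factor exp \<alpha> in the final bound pays for passing from T to T +
      1.\<close>
    have "ennreal (exp (\<alpha> * T)) * tail n (T + 1) = (\<integral>\<^sup>+t. ennreal (exp (\<alpha> * T)) * tail n (T + 1) * indicator {T..T + 1} t \<partial>lborel)"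
      by (subst nn_integral_cmult_indicator) auto
    also have "\<dots> \<le> L"
      unfolding L_def gtail_def
    proof (rule nn_integral_mono)
      fix t show "ennreal (exp (\<alpha> * T)) * tail n (T + 1) * indicator {T..T + 1} t
          \<le> ennreal (exp (\<alpha> * t)) * tail n t * indicator {T..T + 1} t"
        using alpha_pos by (cases "t \<in> {T..T + 1}") (simp_all add: mult_mono tail_antimono)
    qed
    finally have "ennreal \<kappa> * (ennreal (exp (\<alpha> * T)) * tail n (T + 1)) \<le> ennreal c"
      using KL by (meson mult_left_mono order_trans zero_le)
    then have "ennreal (exp \<alpha> / \<kappa>) * (ennreal \<kappa> * (ennreal (exp (\<alpha> * T)) * tail n (T + 1))) \<le> ennreal (exp \<alpha> / \<kappa>) * ennreal c"
      by (rule mult_left_mono) simp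
    moreover have "ennreal (exp \<alpha> / \<kappa>) * (ennreal \<kappa> * (ennreal (exp (\<alpha> * T)) * tail n (T + 1))) = gtail n (T + 1)"
    proof -
      have "ennreal (exp \<alpha> / \<kappa>) * (ennreal \<kappa> * ennreal (exp (\<alpha> * T))) = ennreal (exp (\<alpha> * (T + 1)))"
        using \<kappa> by (simp add: ennreal_mult'[symmetric] exp_add[symmetric] algebra_simps)
      then show ?thesis by (simp add: gtail_def mult.assoc[symmetric])
    qed
    ultimately show ?thesis using \<kappa> by (simp add: ennreal_mult'[symmetric])
  qed
  from this[of _ "t - 1" for t] have "gtail n t \<le> ennreal (exp \<alpha> * c / \<kappa>)" for n t
    by (metis diff_add_cancel)
  then show ?thesis by blast
qed

end

section \<open>The limiting renewal equation and its forcing term\<close>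

context tilted_branching
begin

definition W_tail :: "real \<Rightarrow> real" where
  "W_tail t = measure M {\<omega> \<in> space M. max_W (\<lambda>i. \<psi> i \<omega>) > ereal t}"

definition gW :: "real \<Rightarrow> real" where
  "gW t = exp (\<alpha> * t) * W_tail t"

lemma W_tail_SUP: "ennreal (W_tail t) = (SUP n. tail n t)"
proof -
  let ?A = "\<lambda>n. {\<omega> \<in> space M. ennreal (exp t) < max_upto n (\<lambda>i. \<psi> i \<omega>)}"
  have "{\<omega> \<in> space M. max_W (\<lambda>i. \<psi> i \<omega>) > ereal t} = (\<Union>n. ?A n)"
    using admissible_psi by (auto simp: max_W_gt_iff)
  then have "ennreal (W_tail t) = emeasure M (\<Union>n. ?A n)"
    by (simp add: W_tail_def emeasure_eq_measure)
  also have "\<dots> = (SUP n. emeasure M (?A n))"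
  proof (rule SUP_emeasure_incseq[symmetric])
    show "incseq ?A"
      by (rule incseq_SucI) (auto intro: less_le_trans max_upto_mono)
  qed auto
  finally show ?thesis by (simp add: tail_def)
qed

lemma gW_SUP: "ennreal (gW t) = (SUP n. gtail n t)"
  unfolding gW_def gtail_def by (simp add: ennreal_mult' W_tail_SUP SUP_mult_left_ennreal)

lemma W_tail_nonneg: "0 \<le> W_tail t"
  by (simp add: W_tail_def)

lemma W_tail_le_1: "W_tail t \<le> 1"
  by (simp add: W_tail_def)

lemma gW_nonneg: "0 \<le> gW t"
  by (simp add: gW_def W_tail_nonneg)

lemma W_tail_antimono: "s \<le> t \<Longrightarrow> W_tail t \<le> W_tail s"
proof -
  assume "s \<le> t"
  then have "ennreal (W_tail t) \<le> ennreal (W_tail s)"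
    unfolding W_tail_SUP by (intro SUP_mono') (rule tail_antimono)
  then show ?thesis by (simp add: W_tail_nonneg)
qed

lemma gW_le_exp: "gW t \<le> exp (\<alpha> * t)"
  using W_tail_le_1[of t] by (simp add: gW_def)

lemma gW_shift: "0 \<le> r \<Longrightarrow> r \<le> s \<Longrightarrow> gW (t + r) \<le> exp (\<alpha> * s) * gW t"
  unfolding gW_def mult.assoc[symmetric] exp_add[symmetric]
  using alpha_pos W_tail_antimono[of t "t + r"] W_tail_nonneg
  by (intro mult_mono) (auto simp: distrib_left)

lemma measurable_gW [measurable]: "gW \<in> borel_measurable borel"
proof -
  have "(\<lambda>t. enn2real (SUP n. gtail n t)) \<in> borel_measurable borel" by measurable
  moreover have "enn2real (SUP n. gtail n t) = gW t" for t
    using gW_nonneg[of t] by (simp add: gW_SUP[symmetric])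
  ultimately show ?thesis by simp
qed

lemma gW_bounded: "\<exists>B. \<forall>t. gW t \<le> B"
proof -
  obtain B where B: "\<And>n t. gtail n t \<le> ennreal B" using gtail_bounded by blast
  have "ennreal (gW t) \<le> ennreal (max 0 B)" for t
    unfolding gW_SUP using B by (intro SUP_least) (auto intro: order_trans ennreal_leI)
  then have "gW t \<le> max 0 B" for t by (metis ennreal_le_iff max.cobounded1)
  then show ?thesis by blast
qed

definition gexcess_lim :: "real \<Rightarrow> ennreal" where
  "gexcess_lim t = (SUP n. gexcess n t)"

lemma measurable_gexcess_lim [measurable]: "gexcess_lim \<in> borel_measurable borel"
  unfolding gexcess_lim_def by measurable

lemma incseq_gtail: "incseq (\<lambda>n. gtail n t)"
  by (rule incseq_SucI) (rule gtail_mono)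

lemma incseq_gexcess: "incseq (\<lambda>n. gexcess n t)"
  by (rule incseq_SucI) (rule gexcess_mono)

text \<open>The tails and the excesses increase with the generation, so the finite recursion passes
  to the limit term by term, before anything is subtracted.\<close>

lemma gW_equation: "ennreal (gW t) + gexcess_lim t = gtail 0 t + (\<integral>\<^sup>+y. ennreal (gW (t - y)) \<partial>\<eta>)"
proof -
  have l1: "(\<lambda>n. gtail (Suc n) t) \<longlonglongrightarrow> ennreal (gW t)"
    unfolding gW_SUP by (rule LIMSEQ_Suc[OF LIMSEQ_SUP[OF incseq_gtail]])
  have l2: "(\<lambda>n. gexcess n t) \<longlonglongrightarrow> gexcess_lim t"
    unfolding gexcess_lim_def by (rule LIMSEQ_SUP[OF incseq_gexcess])
  have "(\<integral>\<^sup>+y. ennreal (gW (t - y)) \<partial>\<eta>) = (SUP n. \<integral>\<^sup>+y. gtail n (t - y) \<partial>\<eta>)"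
    unfolding gW_SUP
  proof (rule nn_integral_monotone_convergence_SUP)
    show "incseq (\<lambda>n y. gtail n (t - y))"
      using gtail_mono by (intro incseq_SucI) (auto simp: le_fun_def)
  qed measurable
  moreover have "incseq (\<lambda>n. \<integral>\<^sup>+y. gtail n (t - y) \<partial>\<eta>)"
    by (intro incseq_SucI nn_integral_mono gtail_mono)
  ultimately have l3: "(\<lambda>n. \<integral>\<^sup>+y. gtail n (t - y) \<partial>\<eta>) \<longlonglongrightarrow> (\<integral>\<^sup>+y. ennreal (gW (t - y)) \<partial>\<eta>)"
    using LIMSEQ_SUP by metis
  have "(\<lambda>n. gtail (Suc n) t + gexcess n t) \<longlonglongrightarrow> ennreal (gW t) + gexcess_lim t"
    by (intro tendsto_add l1 l2)
  moreover have "(\<lambda>n. gtail (Suc n) t + gexcess n t) \<longlonglongrightarrow> gtail 0 t + (\<integral>\<^sup>+y. ennreal (gW (t - y)) \<partial>\<eta>)"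
    unfolding gtail_recursion by (intro tendsto_add tendsto_const l3)
  ultimately show ?thesis by (rule LIMSEQ_unique)
qed

definition qW :: "real \<Rightarrow> real" where
  "qW t = enn2real (gtail 0 t) - enn2real (gexcess_lim t)"

lemma measurable_qW [measurable]: "qW \<in> borel_measurable borel"
  unfolding qW_def by measurable

lemma gtail_finite: "gtail n t < \<infinity>"
  unfolding gtail_def
  by (auto simp: ennreal_mult_less_top intro: le_less_trans[OF tail_le_1])

lemma integrable_gW_shift: "integrable \<eta> (\<lambda>y. gW (t - y))"
proof -
  obtain B where "\<And>t. gW t \<le> B" using gW_bounded by blast
  then show ?thesis
    by (intro step.integrable_const_bound[of _ B]) (use gW_nonneg in auto)
qed

text \<open>The excess is one summand on the left of \<open>gW_equation\<close>, and the right-hand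
  side is finite because \<open>gW\<close> is bounded. Only now can the equation be rewritten over
  the reals.\<close>

lemma gexcess_lim_finite: "gexcess_lim t < \<infinity>"
proof -
  have "gexcess_lim t \<le> ennreal (gW t) + gexcess_lim t" by (simp add: add_increasing)
  also have "\<dots> < \<infinity>"
    unfolding gW_equation
    using gtail_finite[of 0 t] integrable_gW_shift[of t] gW_nonneg
    by (simp add: ennreal_add_less_top nn_integral_eq_integral)
  finally show ?thesis .
qed

lemma gW_renewal: "gW t = qW t + (\<integral>y. gW (t - y) \<partial>\<eta>)"
proof -
  have "(\<integral>\<^sup>+y. ennreal (gW (t - y)) \<partial>\<eta>) = ennreal (\<integral>y. gW (t - y) \<partial>\<eta>)"
    using gW_nonneg by (intro nn_integral_eq_integral integrable_gW_shift) auto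
  moreover have "gtail 0 t = ennreal (enn2real (gtail 0 t))" "gexcess_lim t = ennreal (enn2real (gexcess_lim t))"
    using gtail_finite[of 0 t] gexcess_lim_finite[of t] by simp_all
  ultimately have "ennreal (gW t + enn2real (gexcess_lim t)) = ennreal (enn2real (gtail 0 t) + (\<integral>y. gW (t - y) \<partial>\<eta>))"
    using gW_equation[of t] gW_nonneg by (metis ennreal_plus enn2real_nonneg Bochner_Integration.integral_nonneg)
  then have "gW t + enn2real (gexcess_lim t) = enn2real (gtail 0 t) + (\<integral>y. gW (t - y) \<partial>\<eta>)"
    using gW_nonneg by (subst (asm) ennreal_inj) (auto intro!: add_nonneg_nonneg Bochner_Integration.integral_nonneg)
  then show ?thesis by (simp add: qW_def)
qed

definition tail_mass :: "nat \<Rightarrow> real" where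
  "tail_mass n = enn2real (tail_int n)"

lemma tail_int_eq_mass: "tail_int n = ennreal (tail_mass n)"
  using tail_int_finite[of n] by (simp add: tail_mass_def)

lemma tail_mass_mono: "tail_mass n \<le> tail_mass (Suc n)"
  unfolding tail_mass_def using tail_int_finite[of "Suc n"] unfolding tail_int_def
  by (intro enn2real_mono nn_integral_mono gtail_mono) auto

definition qW_int :: real where
  "qW_int = (\<integral>t. qW t \<partial>lborel)"

text \<open>Cancelling the finite \<open>tail_int n\<close> in the mass recursion bounds the mass of
  every \<open>gexcess n\<close> by \<open>tail_int 0\<close>, so \<open>qW\<close> is integrable
  even when \<open>gW\<close> is not. The same recursion writes each mass increment as
  \<open>tail_mass 0\<close> minus the mass of \<open>gexcess n\<close>, and monotone convergence
  gives the limit.\<close>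

lemma qW_integrable: "integrable lborel qW"
  and tail_mass_increment: "(\<lambda>n. tail_mass (Suc n) - tail_mass n) \<longlonglongrightarrow> qW_int"
proof -
  define X where "X n = (\<integral>\<^sup>+t. gexcess n t \<partial>lborel)" for n
  have X: "tail_int (Suc n) + X n = tail_int 0 + tail_int n" for n
    unfolding X_def by (rule tail_int_recursion)
  have Xle: "X n \<le> tail_int 0" for n
  proof -
    have "tail_int n + X n \<le> tail_int (Suc n) + X n"
      unfolding tail_int_def by (intro add_right_mono nn_integral_mono gtail_mono)
    also have "\<dots> = tail_int n + tail_int 0" by (simp only: X add.commute[of "tail_int 0"])
    finally show ?thesis using tail_int_finite[of n] by auto
  qed
  have E: "(\<integral>\<^sup>+t. gexcess_lim t \<partial>lborel) = (SUP n. X n)"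
    unfolding X_def gexcess_lim_def
  proof (rule nn_integral_monotone_convergence_SUP)
    show "incseq gexcess"
      using gexcess_mono by (intro incseq_SucI) (auto simp: le_fun_def)
  qed measurable
  then have Ele: "(\<integral>\<^sup>+t. gexcess_lim t \<partial>lborel) \<le> tail_int 0" using Xle by (auto intro: SUP_least)
  have Xinc: "incseq X" unfolding X_def by (intro incseq_SucI nn_integral_mono gexcess_mono)
  have p0: "ennreal (enn2real (gtail 0 t)) = gtail 0 t" for t using gtail_finite[of 0 t] by simp
  have e0: "ennreal (enn2real (gexcess_lim t)) = gexcess_lim t" for t using gexcess_lim_finite[of t] by simp
  have i1: "integrable lborel (\<lambda>t. enn2real (gtail 0 t))"
    by (rule integrableI_nonneg) (use tail_int_0_finite in \<open>auto simp: p0 tail_int_def\<close>)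
  have i2: "integrable lborel (\<lambda>t. enn2real (gexcess_lim t))"
    by (rule integrableI_nonneg) (use le_less_trans[OF Ele tail_int_0_finite] in \<open>auto simp: e0\<close>)
  show "integrable lborel qW" unfolding qW_def[abs_def] using i1 i2 by (rule Bochner_Integration.integrable_diff)
  have v1: "(\<integral>t. enn2real (gtail 0 t) \<partial>lborel) = tail_mass 0"
    by (subst integral_eq_nn_integral) (auto simp: p0 tail_mass_def tail_int_def)
  have v2: "(\<integral>t. enn2real (gexcess_lim t) \<partial>lborel) = enn2real (SUP n. X n)"
    by (subst integral_eq_nn_integral) (auto simp: e0 E)
  have qi: "qW_int = tail_mass 0 - enn2real (SUP n. X n)"
    unfolding qW_int_def qW_def[abs_def] using Bochner_Integration.integral_diff[OF i1 i2] v1 v2 by simp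
  have Xfin: "X n < \<infinity>" for n using Xle[of n] tail_int_0_finite by (rule le_less_trans)
  have "tail_mass (Suc n) + enn2real (X n) = tail_mass 0 + tail_mass n" for n
    using X[of n] Xfin[of n] tail_int_finite unfolding tail_mass_def by (metis enn2real_plus infinity_ennreal_def)
  then have inc: "tail_mass (Suc n) - tail_mass n = tail_mass 0 - enn2real (X n)" for n by (metis add_diff_cancel_right' add_diff_eq diff_add_eq)
  have "(\<lambda>n. enn2real (X n)) \<longlonglongrightarrow> enn2real (SUP n. X n)"
    using le_less_trans[OF Ele tail_int_0_finite] LIMSEQ_SUP[OF Xinc] unfolding E
    by (intro tendsto_enn2real) auto
  then show "(\<lambda>n. tail_mass (Suc n) - tail_mass n) \<longlonglongrightarrow> qW_int"
    unfolding inc qi by (rule tendsto_diff[OF tendsto_const])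
qed

lemma qW_int_nonneg: "0 \<le> qW_int"
  using tail_mass_mono by (intro LIMSEQ_le_const[OF tail_mass_increment]) auto

text \<open>Averaging makes the bounded but possibly jumping \<open>gW\<close> Lipschitz. The factor
  \<open>s\<close> is divided out only in \<open>gW_tendsto\<close>.\<close>

definition box_int :: "real \<Rightarrow> (real \<Rightarrow> real) \<Rightarrow> real \<Rightarrow> real" where
  "box_int s f t = (\<integral>r. indicator {0..s} r * f (t + r) \<partial>lborel)"

lemma box_int_alt: "box_int s f t = (\<integral>u. indicator {t..t + s} u * f u \<partial>lborel)"
  unfolding box_int_def by (subst lborel_integral_real_affine[of 1 _ t])
    (auto intro!: Bochner_Integration.integral_cong simp: indicator_def)

text \<open>Box integration commutes with the convolution, so the box integral solves the same
  equation with the box integral of \<open>qW\<close> as forcing term, whose total mass is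
  \<open>s * qW_int\<close> by Fubini. All hypotheses of \<open>renewal_limit\<close> then
  hold.\<close>

lemma box_int_gW_tendsto:
  assumes s: "s > 0"
  shows "(box_int s gW \<longlongrightarrow> s * qW_int / \<mu>) at_top"
proof -
  obtain B where B: "\<And>t. gW t \<le> B" using gW_bounded by blast
  have B0: "0 \<le> B" using gW_nonneg[of 0] B[of 0] by simp
  have nb: "norm (gW t) \<le> B" for t using gW_nonneg[of t] B[of t] by simp
  interpret P: pair_sigma_finite \<eta> lborel ..
  have iind: "integrable lborel (\<lambda>r. indicator {a..b::real} r * c)" for a b c :: real
    by (intro Bochner_Integration.integrable_mult_left integrable_real_indicator)
      (auto simp: emeasure_lborel_Icc_eq)
  have ig: "integrable lborel (\<lambda>r. indicator {a..b} r * gW (t + r))" for a b t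
    by (rule Bochner_Integration.integrable_bound[OF iind[of a b B]])
      (use nb B0 in \<open>auto simp: indicator_def\<close>)
  have ig': "integrable lborel (\<lambda>r. indicator {a..b} r * gW r)" for a b
    using ig[of a b 0] by simp
  have qsh: "integrable lborel (\<lambda>r. qW (t + r))" for t
    using lborel_integrable_real_affine[OF qW_integrable, of 1 t] by simp
  have iq: "integrable lborel (\<lambda>r. indicator {a..b} r * qW (t + r))" for a b t
    using integrable_mult_indicator[OF _ qsh, of "{a..b}" t] by simp
  have box0: "0 \<le> box_int s gW t" for t
    unfolding box_int_def using gW_nonneg by (intro Bochner_Integration.integral_nonneg) auto
  have boxB: "box_int s gW t \<le> s * B" for t
  proof -
    have "box_int s gW t \<le> (\<integral>r. indicator {0..s} r * B \<partial>lborel)"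
      unfolding box_int_def using B by (intro integral_mono ig iind) (auto simp: indicator_def)
    then show ?thesis using s by simp
  qed
  have eq: "box_int s gW t = box_int s qW t + (\<integral>y. box_int s gW (t - y) \<partial>\<eta>)" for t
  proof -
    have ji: "integrable (\<eta> \<Otimes>\<^sub>M lborel) (\<lambda>(y, r). indicator {0..s} r * gW (t - y + r))"
    proof (rule P.Fubini_integrable)
      show "(\<lambda>(y, r). indicator {0..s} r * gW (t - y + r)) \<in> borel_measurable (\<eta> \<Otimes>\<^sub>M lborel)" by measurable
      show "AE y in \<eta>. integrable lborel (\<lambda>r. case (y, r) of (y, r) \<Rightarrow> indicator {0..s} r * gW (t - y + r))"
        using ig by simp
      have "(\<lambda>y. \<integral>r. norm (indicator {0..s} r * gW (t - y + r)) \<partial>lborel) = (\<lambda>y. box_int s gW (t - y))"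
        unfolding box_int_def by (auto intro!: Bochner_Integration.integral_cong simp: gW_nonneg abs_mult)
      moreover have "integrable \<eta> (\<lambda>y. box_int s gW (t - y))"
      proof (rule step.integrable_const_bound[of _ "s * B"])
        show "(\<lambda>y. box_int s gW (t - y)) \<in> borel_measurable \<eta>" unfolding box_int_def by measurable
      qed (use box0 boxB in auto)
      ultimately show "integrable \<eta> (\<lambda>y. \<integral>r. norm (case (y, r) of (y, r) \<Rightarrow> indicator {0..s} r * gW (t - y + r)) \<partial>lborel)"
        by simp
    qed
    have "(\<integral>y. box_int s gW (t - y) \<partial>\<eta>) = (\<integral>r. (\<integral>y. indicator {0..s} r * gW (t - y + r) \<partial>\<eta>) \<partial>lborel)"
      unfolding box_int_def using P.Fubini_integral[OF ji] by simp
    also have "\<dots> = (\<integral>r. indicator {0..s} r * gW (t + r) - indicator {0..s} r * qW (t + r) \<partial>lborel)"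
    proof (rule Bochner_Integration.integral_cong)
      fix r
      show "(\<integral>y. indicator {0..s} r * gW (t - y + r) \<partial>\<eta>) = indicator {0..s} r * gW (t + r) - indicator {0..s} r * qW (t + r)"
        using gW_renewal[of "t + r"] by (cases "r \<in> {0..s}") (simp_all add: algebra_simps)
    qed simp
    also have "\<dots> = box_int s gW t - box_int s qW t"
      unfolding box_int_def by (intro Bochner_Integration.integral_diff ig iq)
    finally show ?thesis by simp
  qed
  \<comment> \<open>Windows at x and y differ only near their two ends, on a set of measure at most
    2 * |x - y|.\<close>
  have lip: "\<bar>box_int s gW x - box_int s gW y\<bar> \<le> (2 * B) * \<bar>x - y\<bar>" for x y
  proof -
    let ?m = "min x y" and ?M = "max x y"
    have "norm (box_int s gW x - box_int s gW y) = norm (\<integral>u. indicator {x..x + s} u * gW u - indicator {y..y + s} u * gW u \<partial>lborel)"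
      unfolding box_int_alt by (subst Bochner_Integration.integral_diff[OF ig' ig']) simp
    also have "\<dots> \<le> (\<integral>u. indicator {?m..?M} u * B + indicator {?m + s..?M + s} u * B \<partial>lborel)"
    proof (rule Bochner_Integration.integral_norm_bound_integral)
      fix u
      have "\<bar>indicator {x..x + s} u - indicator {y..y + s} u :: real\<bar> \<le> indicator {?m..?M} u + indicator {?m + s..?M + s} u"
        by (auto simp: indicator_def)
      then have "\<bar>indicator {x..x + s} u - indicator {y..y + s} u :: real\<bar> * \<bar>gW u\<bar> \<le>
          (indicator {?m..?M} u + indicator {?m + s..?M + s} u) * B"
        using nb[of u] by (intro mult_mono) auto
      then show "norm (indicator {x..x + s} u * gW u - indicator {y..y + s} u * gW u)
          \<le> indicator {?m..?M} u * B + indicator {?m + s..?M + s} u * B"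
        by (simp add: left_diff_distrib[symmetric] abs_mult distrib_right)
    qed (intro Bochner_Integration.integrable_diff Bochner_Integration.integrable_add ig' iind)+
    also have "\<dots> = 2 * B * \<bar>x - y\<bar>"
      by (subst Bochner_Integration.integral_add[OF iind iind]) (auto simp: max_def min_def)
    finally show ?thesis by simp
  qed
  \<comment> \<open>Near minus infinity \<open>gW\<close> is at most exp (\<alpha> * t), because
    \<open>W_tail\<close> is a probability.\<close>
  have gint: "integrable lborel (\<lambda>t. indicator {..T} t * box_int s gW t)" for T
  proof -
    have ie: "integrable lborel (\<lambda>t. exp (\<alpha> * t) * indicator {..<T + 1} t)"
    proof (rule integrableI_nonneg)
      have "(\<integral>\<^sup>+t. ennreal (exp (\<alpha> * t) * indicator {..<T + 1} t) \<partial>lborel) =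
          (\<integral>\<^sup>+t. ennreal (exp (\<alpha> * t)) * indicator {..<T + 1} t \<partial>lborel)"
        by (intro nn_integral_cong) (auto simp: indicator_def)
      then show "(\<integral>\<^sup>+t. ennreal (exp (\<alpha> * t) * indicator {..<T + 1} t) \<partial>lborel) < \<infinity>"
        using nn_integral_exp_below[OF alpha_pos, of "T + 1"] by simp
    qed auto
    have le: "box_int s gW t \<le> s * exp (\<alpha> * s) * exp (\<alpha> * t)" for t
    proof -
      have "box_int s gW t \<le> (\<integral>r. indicator {0..s} r * exp (\<alpha> * (t + s)) \<partial>lborel)"
        unfolding box_int_def
      proof (intro integral_mono ig iind)
        fix r show "indicator {0..s} r * gW (t + r) \<le> indicator {0..s} r * exp (\<alpha> * (t + s))"
          using gW_le_exp[of "t + r"] alpha_pos by (cases "r \<in> {0..s}") (auto intro: order_trans)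
      qed
      then show ?thesis using s by (simp add: distrib_left exp_add mult_ac)
    qed
    have "integrable lborel (\<lambda>t. (s * exp (\<alpha> * s)) * (exp (\<alpha> * t) * indicator {..<T + 1} t))"
      using ie by (rule Bochner_Integration.integrable_mult_right)
    then show ?thesis
    proof (rule Bochner_Integration.integrable_bound)
      show "(\<lambda>t. indicator {..T} t * box_int s gW t) \<in> borel_measurable lborel"
        unfolding box_int_def by measurable
      show "AE t in lborel. norm (indicator {..T} t * box_int s gW t) \<le> norm ((s * exp (\<alpha> * s)) * (exp (\<alpha> * t) * indicator {..<T + 1} t))"
      proof (rule AE_I2)
        fix t show "norm (indicator {..T} t * box_int s gW t) \<le> norm ((s * exp (\<alpha> * s)) * (exp (\<alpha> * t) * indicator {..<T + 1} t))"
          using le[of t] box0[of t] s by (cases "t \<le> T") (simp_all add: mult.assoc)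
      qed
    qed
  qed
  have q0: "(box_int s qW \<longlongrightarrow> 0) at_top"
  proof -
    have "((\<lambda>t. \<integral>u. indicator {t..t + s} u * qW u \<partial>lborel) \<longlongrightarrow> (\<integral>u. (0::real) \<partial>(lborel :: real measure))) at_top"
    proof (rule integral_dominated_convergence_at_top[where w = "\<lambda>u. \<bar>qW u\<bar>"])
      show "AE u in lborel. ((\<lambda>t. indicator {t..t + s} u * qW u) \<longlongrightarrow> 0) at_top"
      proof (rule AE_I2)
        fix u :: real
        have "eventually (\<lambda>t. 0 = indicator {t..t + s} u * qW u) at_top"
          using eventually_gt_at_top[of u] by eventually_elim auto
        then show "((\<lambda>t. indicator {t..t + s} u * qW u) \<longlongrightarrow> 0) at_top"
          by (rule Lim_transform_eventually[OF tendsto_const])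
      qed
      show "\<forall>\<^sub>F t in at_top. AE u in lborel. norm (indicator {t..t + s} u * qW u) \<le> \<bar>qW u\<bar>"
        by (auto simp: indicator_def)
    qed (use qW_integrable in auto)
    then show ?thesis by (simp add: box_int_alt[abs_def])
  qed
  have jq: "integrable (lborel \<Otimes>\<^sub>M lborel) (\<lambda>(r, t). indicator {0..s} r * qW (t + r))"
  proof (rule lborel_pair.Fubini_integrable)
    show "(\<lambda>(r, t). indicator {0..s} r * qW (t + r)) \<in> borel_measurable (lborel \<Otimes>\<^sub>M lborel)" by measurable
    show "AE r in lborel. integrable lborel (\<lambda>t. case (r, t) of (r, t) \<Rightarrow> indicator {0..s} r * qW (t + r))"
      using qsh by (simp add: add.commute)
    have "(\<integral>t. norm (indicator {0..s} r * qW (t + r)) \<partial>lborel) = indicator {0..s} r * (\<integral>t. norm (qW t) \<partial>lborel)" for r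
      using lborel_integral_real_affine[of 1 "\<lambda>t. \<bar>qW t\<bar>" r] by (simp add: abs_mult add.commute)
    then show "integrable lborel (\<lambda>r. \<integral>t. norm (case (r, t) of (r, t) \<Rightarrow> indicator {0..s} r * qW (t + r)) \<partial>lborel)"
      using iind[of 0 s] by simp
  qed
  have zint: "integrable lborel (box_int s qW)"
    using lborel_pair.integrable_snd[OF jq] by (simp add: box_int_def[abs_def])
  have zval: "(\<integral>t. box_int s qW t \<partial>lborel) = s * qW_int"
  proof -
    have "(\<integral>t. box_int s qW t \<partial>lborel) = (\<integral>r. (\<integral>t. indicator {0..s} r * qW (t + r) \<partial>lborel) \<partial>lborel)"
      unfolding box_int_def using lborel_pair.Fubini_integral[OF jq] by simp
    also have "\<dots> = (\<integral>r. indicator {0..s} r * qW_int \<partial>lborel)"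
      using lborel_integral_real_affine[of 1 qW] by (simp add: qW_int_def add.commute)
    finally show ?thesis using s by simp
  qed
  from step.renewal_limit[OF eq lip box0 boxB gint q0 zint nonarith eta_first_moment(1)] mu_pos
  show ?thesis unfolding eta_first_moment(2) zval by simp
qed

text \<open>Since exp (- \<alpha> * t) * gW t is nonincreasing, the average of \<open>gW\<close>
  over [t, t + s] lies between exp (- \<alpha> * s) * gW (t + s) and exp (\<alpha> * s) * gW t. For
  a given level on either side of the limit, a fixed small \<open>s\<close> makes these exponential
  factors harmless, and then t tends to infinity.\<close>

theorem gW_tendsto: "(gW \<longlongrightarrow> qW_int / \<mu>) at_top"
proof -
  obtain B where B: "\<And>t. gW t \<le> B" using gW_bounded by blast
  have B0: "0 \<le> B" using gW_nonneg[of 0] B[of 0] by simp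
  have nb: "norm (gW t) \<le> B" for t using gW_nonneg[of t] B[of t] by simp
  have iind: "integrable lborel (\<lambda>r. indicator {a..b::real} r * c)" for a b c :: real
    by (intro Bochner_Integration.integrable_mult_left integrable_real_indicator)
      (auto simp: emeasure_lborel_Icc_eq)
  have ig: "integrable lborel (\<lambda>r. indicator {a..b} r * gW (t + r))" for a b t
    by (rule Bochner_Integration.integrable_bound[OF iind[of a b B]])
      (use nb B0 in \<open>auto simp: indicator_def\<close>)
  let ?H = "qW_int / \<mu>"
  have up: "box_int s gW t \<le> s * exp (\<alpha> * s) * gW t" if s: "s > 0" for s t
  proof -
    have "box_int s gW t \<le> (\<integral>r. indicator {0..s} r * (exp (\<alpha> * s) * gW t) \<partial>lborel)"
      unfolding box_int_def by (intro integral_mono ig iind) (auto simp: indicator_def gW_shift)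
    then show ?thesis using s by (simp add: mult_ac)
  qed
  have low: "s * gW (t + s) \<le> exp (\<alpha> * s) * box_int s gW t" if s: "s > 0" for s t
  proof -
    have "(\<integral>r. indicator {0..s} r * gW (t + s) \<partial>lborel) \<le> (\<integral>r. exp (\<alpha> * s) * (indicator {0..s} r * gW (t + r)) \<partial>lborel)"
    proof (intro integral_mono Bochner_Integration.integrable_mult_right ig iind)
      fix r show "indicator {0..s} r * gW (t + s) \<le> exp (\<alpha> * s) * (indicator {0..s} r * gW (t + r))"
        using gW_shift[of "s - r" s "t + r"] by (cases "r \<in> {0..s}") (auto simp: algebra_simps)
    qed
    then show ?thesis using s by (simp add: box_int_def)
  qed
  have lim1: "((\<lambda>s. exp (c * s) * ?H) \<longlongrightarrow> ?H) (at_right 0)" for c :: real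
    by (rule tendsto_eq_intros | simp)+
  show ?thesis
  proof (rule order_tendstoI)
    fix a assume a: "a < ?H"
    have "eventually (\<lambda>s. a < exp (- \<alpha> * s) * ?H) (at_right 0)"
      using lim1[of "- \<alpha>"] a by (rule order_tendstoD)
    with eventually_at_right_less[of "0::real"] have "eventually (\<lambda>s. 0 < s \<and> a < exp (- \<alpha> * s) * ?H) (at_right 0)"
      by eventually_elim auto
    then obtain s where s: "0 < s" "a < exp (- \<alpha> * s) * ?H"
      using eventually_happens[of _ "at_right (0::real)"] by auto
    have "((\<lambda>t. exp (- \<alpha> * s) * (box_int s gW t / s)) \<longlongrightarrow> exp (- \<alpha> * s) * (s * qW_int / \<mu> / s)) at_top"
      using s(1) by (intro tendsto_intros box_int_gW_tendsto) auto
    then have "eventually (\<lambda>t. a < exp (- \<alpha> * s) * (box_int s gW t / s)) at_top"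
      using s by (intro order_tendstoD) auto
    then show "eventually (\<lambda>t. a < gW t) at_top"
    proof eventually_elim
      case (elim t)
      have "exp (- \<alpha> * s) * (box_int s gW t / s) \<le> exp (- \<alpha> * s) * (exp (\<alpha> * s) * gW t)"
        using up[OF s(1), of t] s(1) by (intro mult_left_mono) (auto simp: field_simps)
      also have "\<dots> = gW t" by (simp add: mult.assoc[symmetric] exp_add[symmetric])
      finally show ?case using elim by simp
    qed
  next
    fix a assume a: "?H < a"
    have "eventually (\<lambda>s. exp (\<alpha> * s) * ?H < a) (at_right 0)"
      using lim1[of \<alpha>] a by (rule order_tendstoD)
    with eventually_at_right_less[of "0::real"] have "eventually (\<lambda>s. 0 < s \<and> exp (\<alpha> * s) * ?H < a) (at_right 0)"
      by eventually_elim auto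
    then obtain s where s: "0 < s" "exp (\<alpha> * s) * ?H < a"
      using eventually_happens[of _ "at_right (0::real)"] by auto
    have sh: "filterlim (\<lambda>t. t + - s) at_top at_top"
      using filterlim_tendsto_add_at_top[OF tendsto_const[of "- s"] filterlim_ident]
      by (simp add: add.commute)
    have "((\<lambda>t. exp (\<alpha> * s) * (box_int s gW (t + - s) / s)) \<longlongrightarrow> exp (\<alpha> * s) * (s * qW_int / \<mu> / s)) at_top"
      using s(1) by (intro tendsto_intros filterlim_compose[OF box_int_gW_tendsto sh]) auto
    then have "eventually (\<lambda>t. exp (\<alpha> * s) * (box_int s gW (t + - s) / s) < a) at_top"
      using s by (intro order_tendstoD) auto
    then show "eventually (\<lambda>t. gW t < a) at_top"
    proof eventually_elim
      case (elim t)
      have "gW t \<le> exp (\<alpha> * s) * (box_int s gW (t + - s) / s)"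
        using low[OF s(1), of "t + - s"] s(1) by (simp add: field_simps)
      with elim show ?case by simp
    qed
  qed
qed

end

section \<open>Positivity of the constant\<close>

text \<open>The comparison of the l^a and l^k norms: every \<open>mC m j powr k\<close> is a term of
  the sum, hence at most \<open>S\<close>, so the surplus power a - k can be pulled out as S powr
  ((a - k) / k).\<close>

lemma power_sum_le:
  assumes k: "0 < k" "k \<le> a" and S: "power_sum k m = ennreal S" "0 \<le> S"
  shows "power_sum a m \<le> ennreal (S powr (a / k))"
proof -
  have "power_sum a m \<le> (\<Sum>j. ennreal (S powr ((a - k) / k)) * (indicator (children m) j * ennreal (mC m j powr k)))"
    unfolding power_sum_def
  proof (rule suminf_le)
    fix j
    show "indicator (children m) j * ennreal (mC m j powr a) \<le>
      ennreal (S powr ((a - k) / k)) * (indicator (children m) j * ennreal (mC m j powr k))"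
    proof (cases "j \<in> children m")
      case True
      then have "ennreal (mC m j powr k) \<le> power_sum k m"
        using sum_le_suminf[OF summableI, of "{j}" "\<lambda>j. indicator (children m) j * ennreal (mC m j powr k)"]
        by (simp add: power_sum_def)
      then have "mC m j powr k \<le> S" using S by simp
      then have "(mC m j powr k) powr ((a - k) / k) \<le> S powr ((a - k) / k)"
        using k by (intro powr_mono2) auto
      then have "mC m j powr (a - k) \<le> S powr ((a - k) / k)" using k by (simp add: powr_powr)
      then have "mC m j powr (a - k) * mC m j powr k \<le> S powr ((a - k) / k) * mC m j powr k"
        by (intro mult_right_mono) auto
      then show ?thesis using True by (simp add: powr_add[symmetric] ennreal_mult'[symmetric] ennreal_leI)
    qed simp
  qed auto
  also have "\<dots> = ennreal (S powr ((a - k) / k)) * power_sum k m"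
    unfolding power_sum_def by (rule ennreal_suminf_cmult)
  also have "\<dots> = ennreal (S powr (a / k))"
  proof -
    have "S powr ((a - k) / k) * S = S powr (a / k)"
    proof -
      have "(a - k) / k + 1 = a / k" using k by (simp add: field_simps)
      then have "S powr (a / k) = S powr ((a - k) / k) * S powr 1" by (metis powr_add)
      then show ?thesis using S(2) by simp
    qed
    then show ?thesis using S by (simp add: ennreal_mult'[symmetric])
  qed
  finally show ?thesis .
qed

lemma child_sum_le_power_sum:
  assumes D: "0 \<le> D" and f: "\<And>t. f t \<le> ennreal (D * exp (- a * t))"
  shows "child_sum f t m \<le> ennreal (D * exp (- a * t)) * power_sum a m"
proof -
  have "child_sum f t m \<le> (\<Sum>j. ennreal (D * exp (- a * t)) * (indicator (children m) j * ennreal (mC m j powr a)))"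
    unfolding child_sum_def
  proof (rule suminf_le)
    fix j
    show "indicator (children m) j * (if 0 < mC m j then f (t - ln (mC m j)) else 0)
      \<le> ennreal (D * exp (- a * t)) * (indicator (children m) j * ennreal (mC m j powr a))"
    proof (cases "j \<in> children m \<and> 0 < mC m j")
      case True
      have "f (t - ln (mC m j)) \<le> ennreal (D * exp (- a * (t - ln (mC m j))))" by (rule f)
      also have "D * exp (- a * (t - ln (mC m j))) = D * exp (- a * t) * mC m j powr a"
        using True by (simp add: powr_def exp_add[symmetric] algebra_simps)
      finally show ?thesis using True D by (simp add: ennreal_mult'[symmetric])
    qed auto
  qed auto
  then show ?thesis by (simp add: power_sum_def)
qed

lemma nn_integral_exp_above:
  assumes a: "0 < (a :: real)"
  shows "(\<integral>\<^sup>+t. ennreal (exp (- a * t)) * indicator {x..} t \<partial>lborel) = ennreal (exp (- a * x) / a)"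
proof -
  have "(\<integral>\<^sup>+t. ennreal (exp (- a * t)) * indicator {x..} t \<partial>lborel) = 0 - (- exp (- a * x) / a)"
  proof (rule nn_integral_FTC_atLeast)
    show "((\<lambda>t. - exp (- a * t) / a) has_real_derivative exp (- a * t)) (at t)" for t
      using a by (auto intro!: derivative_eq_intros)
    have "((\<lambda>t. exp (- (a * t))) \<longlongrightarrow> 0) at_top"
      using a by (intro filterlim_compose[OF exp_at_bot] filterlim_uminus_at_bot_at_top[THEN filterlim_compose]
          filterlim_tendsto_pos_mult_at_top[OF tendsto_const _ filterlim_ident])
    then show "((\<lambda>t. - exp (- a * t) / a) \<longlongrightarrow> 0) at_top"
      using tendsto_minus[OF tendsto_divide[OF _ tendsto_const, of _ 0 at_top a]] a by fastforce
  qed auto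
  then show ?thesis by simp
qed

text \<open>The two arguments of the minimum cross where v * exp (- a * t) = 1, at t = ln v / a. To
  the left the linear one is integrable because a < \<alpha>, to the right the square is integrable
  because \<alpha> < 2 * a; scaling produces the power \<alpha> / a.\<close>

lemma nn_integral_exp_min_le:
  fixes a \<alpha> v :: real
  assumes a: "a < \<alpha>" "\<alpha> < 2 * a" and v: "0 \<le> v"
  shows "(\<integral>\<^sup>+t. ennreal (exp (\<alpha> * t) * min (v * exp (- a * t)) ((v * exp (- a * t))\<^sup>2)) \<partial>lborel)
    \<le> ennreal ((1 / (\<alpha> - a) + 1 / (2 * a - \<alpha>)) * v powr (\<alpha> / a))"
proof (cases "v = 0")
  case False
  then have v: "v > 0" using v by simp
  define x where "x = ln v / a"
  have a0: "a > 0" using a by linarith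
  have ex: "exp (c * x) = v powr (c / a)" for c using v by (simp add: powr_def x_def)
  have "(\<integral>\<^sup>+t. ennreal (exp (\<alpha> * t) * min (v * exp (- a * t)) ((v * exp (- a * t))\<^sup>2)) \<partial>lborel)
    \<le> (\<integral>\<^sup>+t. ennreal v * (ennreal (exp ((\<alpha> - a) * t)) * indicator {..<x} t)
         + ennreal (v\<^sup>2) * (ennreal (exp (- (2 * a - \<alpha>) * t)) * indicator {x..} t) \<partial>lborel)"
  proof (rule nn_integral_mono)
    fix t
    have 1: "exp (\<alpha> * t) * (v * exp (- a * t)) = v * exp ((\<alpha> - a) * t)"
      by (simp add: exp_add[symmetric] algebra_simps)
    have 2: "exp (\<alpha> * t) * (v * exp (- a * t))\<^sup>2 = v\<^sup>2 * exp (- (2 * a - \<alpha>) * t)"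
      by (simp add: power2_eq_square exp_add[symmetric] algebra_simps)
    have "exp (\<alpha> * t) * min (v * exp (- a * t)) ((v * exp (- a * t))\<^sup>2) =
        min (v * exp ((\<alpha> - a) * t)) (v\<^sup>2 * exp (- (2 * a - \<alpha>) * t))"
      unfolding 1[symmetric] 2[symmetric] by (simp add: min_mult_distrib_left)
    then show "ennreal (exp (\<alpha> * t) * min (v * exp (- a * t)) ((v * exp (- a * t))\<^sup>2)) \<le>
        ennreal v * (ennreal (exp ((\<alpha> - a) * t)) * indicator {..<x} t)
         + ennreal (v\<^sup>2) * (ennreal (exp (- (2 * a - \<alpha>) * t)) * indicator {x..} t)"
      using v by (cases "t < x") (auto simp: ennreal_mult'[symmetric] intro!: ennreal_leI)
  qed
  also have "\<dots> = ennreal v * ennreal (exp ((\<alpha> - a) * x) / (\<alpha> - a)) + ennreal (v\<^sup>2) * ennreal (exp (- (2 * a - \<alpha>) * x) / (2 * a - \<alpha>))"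
    using a nn_integral_exp_below[of "\<alpha> - a" x] nn_integral_exp_above[of "2 * a - \<alpha>" x]
    by (subst nn_integral_add) (simp_all add: nn_integral_cmult)
  also have "\<dots> = ennreal (v * (exp ((\<alpha> - a) * x) / (\<alpha> - a)) + v\<^sup>2 * (exp (- (2 * a - \<alpha>) * x) / (2 * a - \<alpha>)))"
    using v a by (simp add: ennreal_mult'[symmetric] ennreal_plus[symmetric] del: ennreal_plus)
  also have "v * (exp ((\<alpha> - a) * x) / (\<alpha> - a)) + v\<^sup>2 * (exp (- (2 * a - \<alpha>) * x) / (2 * a - \<alpha>))
     = (1 / (\<alpha> - a) + 1 / (2 * a - \<alpha>)) * v powr (\<alpha> / a)"
  proof -
    have e1: "v * exp ((\<alpha> - a) * x) = v powr (\<alpha> / a)"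
    proof -
      have "v * exp ((\<alpha> - a) * x) = v powr 1 * v powr ((\<alpha> - a) / a)" unfolding ex using v by simp
      also have "\<dots> = v powr (1 + (\<alpha> - a) / a)" by (rule powr_add[symmetric])
      also have "1 + (\<alpha> - a) / a = \<alpha> / a" using a0 by (simp add: field_simps)
      finally show ?thesis .
    qed
    have e2: "v\<^sup>2 * exp (- (2 * a - \<alpha>) * x) = v powr (\<alpha> / a)"
    proof -
      have "v\<^sup>2 * exp (- (2 * a - \<alpha>) * x) = v powr 2 * v powr (- (2 * a - \<alpha>) / a)"
        unfolding ex using v by (simp add: powr_numeral)
      also have "\<dots> = v powr (\<alpha> / a)" using a0 by (simp add: powr_add[symmetric] diff_divide_distrib)
      finally show ?thesis .
    qed
    show ?thesis using e1 e2 by (simp add: distrib_right)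
  qed
  finally show ?thesis .
qed simp

context tilted_branching
begin

text \<open>Convexity of the exponential: the moment is below 1 at \<open>\<beta>\<close> and equal
  to 1 at \<open>\<alpha>\<close>. The weight \<open>l\<close> is chosen so that a = l * \<beta> +
  (1 - l) * \<alpha>.\<close>

lemma power_sum_between_less_1:
  assumes a: "\<beta> < a" "a < \<alpha>"
  shows "(\<integral>\<^sup>+\<omega>. power_sum a (\<psi>0 \<omega>) \<partial>M) < 1"
proof -
  define l where "l = (\<alpha> - a) / (\<alpha> - \<beta>)"
  have l: "0 < l" "l < 1" using a by (auto simp: l_def field_simps)
  obtain r where r: "(\<integral>\<^sup>+\<omega>. power_sum \<beta> (\<psi>0 \<omega>) \<partial>M) = ennreal r" "0 \<le> r" "r < 1"
    using beta(3) by (cases "\<integral>\<^sup>+\<omega>. power_sum \<beta> (\<psi>0 \<omega>) \<partial>M") (auto simp: ennreal_less_one_iff)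
  have "(\<integral>\<^sup>+\<omega>. power_sum a (\<psi>0 \<omega>) \<partial>M) = (\<integral>\<^sup>+y. ennreal (exp ((a - \<alpha>) * y)) \<partial>\<eta>)"
    by (rule exp_moment_eta[symmetric])
  also have "\<dots> \<le> (\<integral>\<^sup>+y. ennreal l * ennreal (exp ((\<beta> - \<alpha>) * y)) + ennreal (1 - l) \<partial>\<eta>)"
  proof (rule nn_integral_mono)
    fix y :: real
    have e: "(a - \<alpha>) * y = l * ((\<beta> - \<alpha>) * y) + (1 - l) * 0"
      using beta(2) by (simp add: l_def field_simps)
    have "exp ((a - \<alpha>) * y) \<le> l * exp ((\<beta> - \<alpha>) * y) + (1 - l) * exp 0"
      unfolding e using l convex_onD[OF exp_convex, of "1 - l" "(\<beta> - \<alpha>) * y" 0] by simp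
    then show "ennreal (exp ((a - \<alpha>) * y)) \<le> ennreal l * ennreal (exp ((\<beta> - \<alpha>) * y)) + ennreal (1 - l)"
      using l by (simp add: ennreal_mult'[symmetric] ennreal_plus[symmetric] ennreal_leI del: ennreal_plus)
  qed
  also have "\<dots> = ennreal l * ennreal r + ennreal (1 - l)"
    using step.emeasure_space_1 by (subst nn_integral_add) (auto simp: nn_integral_cmult exp_moment_eta r)
  also have "\<dots> = ennreal (l * r + (1 - l))"
    using l r by (simp add: ennreal_mult'[symmetric] ennreal_plus[symmetric] del: ennreal_plus)
  also have "\<dots> < 1"
  proof -
    have "l * r < l * 1" using l r by (intro mult_strict_left_mono)
    then have "l * r + (1 - l) < 1" by simp
    then show ?thesis using l r by (simp add: ennreal_less_one_iff del: ennreal_plus)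
  qed
  finally show ?thesis .
qed

lemma measurable_power_sum [measurable]: "(\<lambda>\<omega>. power_sum a (\<psi>0 \<omega>)) \<in> borel_measurable M"
  unfolding power_sum_def
  by (intro borel_measurable_suminf_order measurable_mark_term[of "\<lambda>x. ennreal (x powr a)"]) measurable

text \<open>Counting each exceedance only with weight \<open>p\<close> makes multiple exceedances in one cluster negligible
  as \<open>p \<rightarrow> 0\<close>: the first-order gain per generation is of order \<open>p\<close>, the second-order loss of order
  \<open>p powr (\<alpha> / a)\<close> with \<open>a < \<alpha>\<close>.\<close>
lemma qW_int_pos:
  assumes Qpos: "measure M {\<omega> \<in> space M. 0 < mQ (\<psi>0 \<omega>)} > 0"
    and k: "0 < k" "k < \<alpha>"
    and mom: "(\<integral>\<^sup>+\<omega>. epowr (power_sum k (\<psi>0 \<omega>)) (\<alpha> / k) \<partial>M) < \<infinity>"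
  shows "0 < qW_int"
proof -
  \<comment> \<open>Any point strictly between the largest of \<open>\<beta>\<close>,
    \<open>k\<close>, \<alpha> / 2 and \<open>\<alpha>\<close> would do: above
    \<open>\<beta>\<close> for a mean below 1, above \<open>k\<close> to use the moment hypothesis,
    above \<alpha> / 2 for integrability of the quadratic loss, and below \<open>\<alpha>\<close> so
    that the loss has order higher than \<open>p\<close>.\<close>
  define a where "a = (max (max \<beta> k) (\<alpha> / 2) + \<alpha>) / 2"
  have a: "\<beta> < a" "k < a" "\<alpha> < 2 * a" "a < \<alpha>" "0 < a"
    using beta k alpha_pos by (auto simp: a_def max_def)
  obtain \<rho> where \<rho>: "(\<integral>\<^sup>+\<omega>. power_sum a (\<psi>0 \<omega>) \<partial>M) = ennreal \<rho>" "0 \<le> \<rho>" "\<rho> < 1"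
    using power_sum_between_less_1[OF a(1,4)]
    by (cases "\<integral>\<^sup>+\<omega>. power_sum a (\<psi>0 \<omega>) \<partial>M") (auto simp: ennreal_less_one_iff)
  have Q0: "0 \<le> mQ (\<psi>0 \<omega>)" if "\<omega> \<in> space M" for \<omega>
    using admissible_psi0[OF that] by (simp add: admissible_mark_def)
  have Qa: "(\<integral>\<^sup>+\<omega>. ennreal (mQ (\<psi>0 \<omega>) powr a) \<partial>M) < \<infinity>"
  proof -
    have "(\<integral>\<^sup>+\<omega>. ennreal (mQ (\<psi>0 \<omega>) powr a) \<partial>M) \<le> (\<integral>\<^sup>+\<omega>. 1 + ennreal (mQ (\<psi>0 \<omega>) powr \<alpha>) \<partial>M)"
    proof (rule nn_integral_mono)
      fix \<omega> assume "\<omega> \<in> space M"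
      have "mQ (\<psi>0 \<omega>) powr a \<le> 1 + mQ (\<psi>0 \<omega>) powr \<alpha>"
      proof (cases "1 \<le> mQ (\<psi>0 \<omega>)")
        case True
        then have "mQ (\<psi>0 \<omega>) powr a \<le> mQ (\<psi>0 \<omega>) powr \<alpha>" using a by (intro powr_mono) auto
        then show ?thesis by simp
      next
        case False
        then have "mQ (\<psi>0 \<omega>) powr a \<le> 1" using Q0[OF \<open>\<omega> \<in> space M\<close>] a by (intro powr_le1) auto
        then show ?thesis by (rule order_trans) simp
      qed
      then show "ennreal (mQ (\<psi>0 \<omega>) powr a) \<le> 1 + ennreal (mQ (\<psi>0 \<omega>) powr \<alpha>)"
        by (simp add: ennreal_leI ennreal_1[symmetric] ennreal_plus[symmetric] del: ennreal_1 ennreal_plus)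
    qed
    also have "\<dots> = 1 + (\<integral>\<^sup>+\<omega>. ennreal (mQ (\<psi>0 \<omega>) powr \<alpha>) \<partial>M)"
      by (subst nn_integral_add) (auto simp: emeasure_space_1)
    also have "\<dots> < \<infinity>" using Q_moment by (simp add: ennreal_add_less_top)
    finally show ?thesis .
  qed
  then obtain EQ where EQ: "(\<integral>\<^sup>+\<omega>. ennreal (mQ (\<psi>0 \<omega>) powr a) \<partial>M) = ennreal EQ" "0 \<le> EQ"
    by (cases "\<integral>\<^sup>+\<omega>. ennreal (mQ (\<psi>0 \<omega>) powr a) \<partial>M") auto
  \<comment> \<open>The fixed point of C = EQ + C * \<rho>, chosen so that the envelope p * C * exp
    (- a * t) reproduces itself from one generation to the next.\<close>
  define C where "C = EQ / (1 - \<rho>)"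
  have C: "0 \<le> C" "EQ + C * \<rho> = C" using \<rho> EQ by (auto simp: C_def field_simps)
  define S where "S \<omega> = enn2real (power_sum k (\<psi>0 \<omega>))" for \<omega>
  \<comment> \<open>A pathwise bound on the cluster at the root: the weighted count \<open>s\<close>
    below is at most p * Y * exp (- a * t). Raised to the power \<alpha> / a, its two parts become
    Q^\<alpha> and S^(\<alpha> / k), both with finite mean.\<close>
  define Y where "Y \<omega> = mQ (\<psi>0 \<omega>) powr a + C * S \<omega> powr (a / k)" for \<omega>
  have [measurable]: "S \<in> borel_measurable M" unfolding S_def by measurable
  have [measurable]: "Y \<in> borel_measurable M" unfolding Y_def by measurable
  have Y0: "0 \<le> Y \<omega>" for \<omega> using C by (simp add: Y_def)
  have [measurable]: "(\<lambda>\<omega>. epowr (power_sum k (\<psi>0 \<omega>)) (\<alpha> / k)) \<in> borel_measurable M"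
    unfolding epowr_def by measurable
  have Sfin: "AE \<omega> in M. power_sum k (\<psi>0 \<omega>) = ennreal (S \<omega>)"
  proof -
    have "AE \<omega> in M. epowr (power_sum k (\<psi>0 \<omega>)) (\<alpha> / k) \<noteq> \<infinity>"
      using mom by (intro nn_integral_PInf_AE) auto
    then show ?thesis
      by eventually_elim (auto simp: epowr_def S_def less_top split: if_splits)
  qed
  have EY: "(\<integral>\<^sup>+\<omega>. ennreal (Y \<omega> powr (\<alpha> / a)) \<partial>M) < \<infinity>"
  proof -
    let ?c = "2 powr (\<alpha> / a)"
    have "(\<integral>\<^sup>+\<omega>. ennreal (Y \<omega> powr (\<alpha> / a)) \<partial>M) \<le> (\<integral>\<^sup>+\<omega>. ennreal ?c * ennreal (mQ (\<psi>0 \<omega>) powr \<alpha>)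
        + ennreal (?c * C powr (\<alpha> / a)) * epowr (power_sum k (\<psi>0 \<omega>)) (\<alpha> / k) \<partial>M)"
      using Sfin
    proof (intro nn_integral_mono_AE, eventually_elim)
      case (elim \<omega>)
      define A where "A = mQ (\<psi>0 \<omega>) powr a"
      define B where "B = C * S \<omega> powr (a / k)"
      have AB: "0 \<le> A" "0 \<le> B" using C by (auto simp: A_def B_def)
      have S0: "0 \<le> S \<omega>" by (simp add: S_def)
      have "(A + B) powr (\<alpha> / a) \<le> (2 * max A B) powr (\<alpha> / a)"
        using AB a alpha_pos by (intro powr_mono2) auto
      also have "\<dots> = ?c * max A B powr (\<alpha> / a)" using AB by (simp add: powr_mult)
      also have "\<dots> \<le> ?c * (A powr (\<alpha> / a) + B powr (\<alpha> / a))"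
        by (intro mult_left_mono) (auto simp: max_def)
      also have "A powr (\<alpha> / a) = mQ (\<psi>0 \<omega>) powr \<alpha>" using a by (simp add: A_def powr_powr)
      also have "B powr (\<alpha> / a) = C powr (\<alpha> / a) * S \<omega> powr (\<alpha> / k)"
        using a C S0 by (simp add: B_def powr_mult powr_powr)
      finally have "Y \<omega> powr (\<alpha> / a) \<le> ?c * mQ (\<psi>0 \<omega>) powr \<alpha> + ?c * C powr (\<alpha> / a) * S \<omega> powr (\<alpha> / k)"
        by (simp add: Y_def A_def B_def distrib_left mult.assoc)
      moreover have "epowr (power_sum k (\<psi>0 \<omega>)) (\<alpha> / k) = ennreal (S \<omega> powr (\<alpha> / k))"
        using elim S0 by (simp add: epowr_def)
      ultimately show ?case
        by (simp add: ennreal_leI ennreal_mult'[symmetric] ennreal_plus[symmetric] del: ennreal_plus)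
    qed
    also have "\<dots> = ennreal ?c * (\<integral>\<^sup>+\<omega>. ennreal (mQ (\<psi>0 \<omega>) powr \<alpha>) \<partial>M)
        + ennreal (?c * C powr (\<alpha> / a)) * (\<integral>\<^sup>+\<omega>. epowr (power_sum k (\<psi>0 \<omega>)) (\<alpha> / k) \<partial>M)"
      by (subst nn_integral_add) (auto simp: nn_integral_cmult)
    also have "\<dots> < \<infinity>" using mom Q_moment by (simp add: ennreal_add_less_top ennreal_mult_less_top)
    finally show ?thesis .
  qed
  then obtain y where y: "(\<integral>\<^sup>+\<omega>. ennreal (Y \<omega> powr (\<alpha> / a)) \<partial>M) = ennreal y" "0 \<le> y"
    by (cases "\<integral>\<^sup>+\<omega>. ennreal (Y \<omega> powr (\<alpha> / a)) \<partial>M") auto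
  define K where "K = 1 / (\<alpha> - a) + 1 / (2 * a - \<alpha>)"
  have K: "0 < K" using a by (simp add: K_def add_pos_pos)
  obtain c where c: "tail_int 0 = ennreal c" "0 \<le> c" using tail_int_0_finite by (cases "tail_int 0") auto
  have cpos: "0 < c"
  proof (rule ccontr)
    assume "\<not> 0 < c"
    then have "tail_int 0 = 0" using c by simp
    then have "AE \<omega> in M. mQ (\<psi>0 \<omega>) powr \<alpha> / \<alpha> \<le> 0"
      unfolding tail_int_0 by (subst (asm) nn_integral_0_iff_AE) (auto simp: ennreal_eq_0_iff)
    then have "AE \<omega> in M. \<not> 0 < mQ (\<psi>0 \<omega>)"
      by eventually_elim (use alpha_pos in \<open>auto simp: divide_le_0_iff\<close>)
    then have "prob {\<omega> \<in> space M. 0 < mQ (\<psi>0 \<omega>)} = 0" by (subst prob_eq_0) auto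
    with Qpos show False by simp
  qed
  \<comment> \<open>Possible because \<alpha> / a > 1: the loss K * p powr (\<alpha> / a) * y is of
    smaller order than p, so it can be held to half of the gain p * c.\<close>
  obtain p where p: "0 < p" "p \<le> 1" "K * p powr (\<alpha> / a) * y \<le> p * c / 2"
  proof -
    have "((\<lambda>p. K * p powr (\<alpha> / a - 1) * y) \<longlongrightarrow> K * 0 * y) (at_right 0)"
    proof (intro tendsto_intros)
      have "0 < \<alpha> / a - 1" using a by (simp add: field_simps)
      moreover have "((\<lambda>p::real. p) \<longlongrightarrow> 0) (at_right 0)" by (rule tendsto_ident_at)
      ultimately show "((\<lambda>p. p powr (\<alpha> / a - 1)) \<longlongrightarrow> 0) (at_right 0)"
        by (intro tendsto_zero_powrI[OF _ tendsto_const]) (auto simp: eventually_at_right_less eventually_at_filter)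
    qed
    then have "eventually (\<lambda>p. K * p powr (\<alpha> / a - 1) * y < c / 2) (at_right 0)"
      using cpos by (intro order_tendstoD) auto
    moreover have "eventually (\<lambda>p::real. 0 < p \<and> p < 1) (at_right 0)"
      by (simp add: eventually_at_right_field) (metis zero_less_one)
    ultimately have "eventually (\<lambda>p. 0 < p \<and> p < 1 \<and> K * p powr (\<alpha> / a - 1) * y < c / 2) (at_right 0)"
      by eventually_elim auto
    then obtain p where p: "0 < p" "p < 1" "K * p powr (\<alpha> / a - 1) * y < c / 2"
      using eventually_happens[of _ "at_right (0::real)"] by auto
    have "p powr (\<alpha> / a) = p * p powr (\<alpha> / a - 1)"
      using p powr_add[of p 1 "\<alpha> / a - 1"] by simp
    then have "K * p powr (\<alpha> / a) * y = p * (K * p powr (\<alpha> / a - 1) * y)" by simp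
    also have "\<dots> \<le> p * (c / 2)" using p by (intro mult_left_mono) auto
    finally show thesis using p by (intro that[of p]) auto
  qed
  \<comment> \<open>The lower bound \<open>l\<close> on the tail gains weighted mass p * c / 2 per
    generation. The envelope, which does not depend on \<open>n\<close>, keeps the quadratic loss
    from growing along the induction.\<close>
  have step: "\<exists>l. l \<in> borel_measurable borel \<and> (\<forall>t. l t \<le> tail n t) \<and>
      (\<forall>t. l t \<le> ennreal (p * C * exp (- a * t))) \<and>
      ennreal (real n * (p * c / 2)) \<le> (\<integral>\<^sup>+t. ennreal (exp (\<alpha> * t)) * l t \<partial>lborel)" for n
  proof (induction n)
    case 0
    show ?case by (intro exI[of _ "\<lambda>_. 0"]) simp
  next
    case (Suc n)
    then obtain l where l [measurable]: "l \<in> borel_measurable borel" and lt: "\<And>t. l t \<le> tail n t"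
      and lC: "\<And>t. l t \<le> ennreal (p * C * exp (- a * t))"
      and lint: "ennreal (real n * (p * c / 2)) \<le> (\<integral>\<^sup>+t. ennreal (exp (\<alpha> * t)) * l t \<partial>lborel)"
      by blast
    interpret P: pair_sigma_finite lborel M ..
    have pC: "0 \<le> p * C" using p C by simp
    define ind where "ind t \<omega> = (indicator {ennreal (exp t)<..} (ennreal (mQ (\<psi>0 \<omega>))) :: ennreal)" for t \<omega>
    have [measurable]: "(\<lambda>x. ind (fst x) (snd x)) \<in> borel_measurable (borel \<Otimes>\<^sub>M M)"
      unfolding ind_def indicator_def of_bool_def greaterThan_iff by measurable
    have [measurable]: "ind t \<in> borel_measurable M" for t
      unfolding ind_def indicator_def of_bool_def greaterThan_iff by measurable
    define s where "s t \<omega> = ennreal p * ind t \<omega> + child_sum l t (\<psi>0 \<omega>)" for t \<omega>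
    have [measurable]: "(\<lambda>x. s (fst x) (snd x)) \<in> borel_measurable (borel \<Otimes>\<^sub>M M)"
      unfolding s_def by measurable
    have [measurable]: "s t \<in> borel_measurable M" for t unfolding s_def by measurable
    have ind_le: "ind t \<omega> \<le> ennreal (exp (- a * t) * mQ (\<psi>0 \<omega>) powr a)" for t \<omega>
    proof (cases "exp t < mQ (\<psi>0 \<omega>)")
      case True
      then have "exp t powr a \<le> mQ (\<psi>0 \<omega>) powr a" using a by (intro powr_mono2) auto
      then have "exp (- a * t) * exp (a * t) \<le> exp (- a * t) * mQ (\<psi>0 \<omega>) powr a"
        by (intro mult_left_mono) (auto simp: powr_def mult.commute)
      then have "1 \<le> exp (- a * t) * mQ (\<psi>0 \<omega>) powr a" by (simp add: exp_add[symmetric])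
      then show ?thesis using True by (auto simp: ind_def indicator_def)
    next
      case False
      then show ?thesis by (auto simp: ind_def indicator_def ennreal_less_iff)
    qed
    have s_le: "AE \<omega> in M. \<forall>t. s t \<omega> \<le> ennreal (p * Y \<omega> * exp (- a * t))"
      using Sfin AE_space[of M]
    proof eventually_elim
      case (elim \<omega>)
      have S0: "0 \<le> S \<omega>" by (simp add: S_def)
      show ?case
      proof
        fix t
        have "child_sum l t (\<psi>0 \<omega>) \<le> ennreal (p * C * exp (- a * t)) * power_sum a (\<psi>0 \<omega>)"
          by (rule child_sum_le_power_sum[OF pC lC])
        also have "\<dots> \<le> ennreal (p * C * exp (- a * t)) * ennreal (S \<omega> powr (a / k))"
          using a k elim S0 by (intro mult_left_mono power_sum_le) auto
        also have "\<dots> = ennreal (p * C * exp (- a * t) * S \<omega> powr (a / k))"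
          using pC by (simp add: ennreal_mult'[symmetric])
        finally have 1: "child_sum l t (\<psi>0 \<omega>) \<le> ennreal (p * C * exp (- a * t) * S \<omega> powr (a / k))" .
        have "ennreal p * ind t \<omega> \<le> ennreal p * ennreal (exp (- a * t) * mQ (\<psi>0 \<omega>) powr a)"
          by (intro mult_left_mono ind_le) simp
        also have "\<dots> = ennreal (p * (exp (- a * t) * mQ (\<psi>0 \<omega>) powr a))"
          using p by (simp add: ennreal_mult'[symmetric])
        finally have "s t \<omega> \<le> ennreal (p * (exp (- a * t) * mQ (\<psi>0 \<omega>) powr a)) + ennreal (p * C * exp (- a * t) * S \<omega> powr (a / k))"
          unfolding s_def using 1 by (rule add_mono)
        also have "\<dots> = ennreal (p * Y \<omega> * exp (- a * t))"
        proof (subst ennreal_plus[symmetric])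
          show "0 \<le> p * (exp (- a * t) * mQ (\<psi>0 \<omega>) powr a)" "0 \<le> p * C * exp (- a * t) * S \<omega> powr (a / k)"
            using p pC by auto
        qed (simp add: Y_def algebra_simps)
        finally show "s t \<omega> \<le> ennreal (p * Y \<omega> * exp (- a * t))" .
      qed
    qed
    define l' where "l' t = (\<integral>\<^sup>+\<omega>. s t \<omega> - s t \<omega> * s t \<omega> \<partial>M)" for t
    have l' [measurable]: "l' \<in> borel_measurable borel" unfolding l'_def by measurable
    have l'_tail: "l' t \<le> tail (Suc n) t" for t
      unfolding l'_def
    proof (rule tail_lower_bound[OF l lt])
      show "ennreal p \<le> 1" using p by simp
      show "s t \<omega> = ennreal p * indicator {ennreal (exp t)<..} (ennreal (mQ (\<psi>0 \<omega>))) + child_sum l t (\<psi>0 \<omega>)" for \<omega>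
        by (simp add: s_def ind_def)
      show "AE \<omega> in M. s t \<omega> < \<infinity>"
        using s_le by eventually_elim (metis ennreal_less_top infinity_ennreal_def order_le_less_trans)
    qed
    have l'_C: "l' t \<le> ennreal (p * C * exp (- a * t))" for t
    proof -
      have "l' t \<le> (\<integral>\<^sup>+\<omega>. ennreal (p * exp (- a * t)) * ennreal (mQ (\<psi>0 \<omega>) powr a) +
          ennreal (p * C * exp (- a * t)) * power_sum a (\<psi>0 \<omega>) \<partial>M)"
        unfolding l'_def
      proof (rule nn_integral_mono)
        fix \<omega> assume \<omega>: "\<omega> \<in> space M"
        have "ennreal p * ind t \<omega> \<le> ennreal p * ennreal (exp (- a * t) * mQ (\<psi>0 \<omega>) powr a)"
          by (intro mult_left_mono ind_le) simp
        also have "\<dots> = ennreal (p * exp (- a * t)) * ennreal (mQ (\<psi>0 \<omega>) powr a)"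
          using p by (simp add: ennreal_mult'[symmetric] mult.assoc)
        finally have "s t \<omega> \<le> ennreal (p * exp (- a * t)) * ennreal (mQ (\<psi>0 \<omega>) powr a) +
          ennreal (p * C * exp (- a * t)) * power_sum a (\<psi>0 \<omega>)"
          unfolding s_def by (intro add_mono child_sum_le_power_sum[OF pC lC])
        then show "s t \<omega> - s t \<omega> * s t \<omega> \<le> ennreal (p * exp (- a * t)) * ennreal (mQ (\<psi>0 \<omega>) powr a) +
          ennreal (p * C * exp (- a * t)) * power_sum a (\<psi>0 \<omega>)"
          using diff_le_self_ennreal order_trans by blast
      qed
      also have "\<dots> = ennreal (p * exp (- a * t)) * ennreal EQ + ennreal (p * C * exp (- a * t)) * ennreal \<rho>"
        by (subst nn_integral_add) (auto simp: nn_integral_cmult EQ \<rho>)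
      also have "\<dots> = ennreal (p * exp (- a * t) * EQ + p * C * exp (- a * t) * \<rho>)"
        using p pC EQ \<rho> by (simp add: ennreal_mult'[symmetric] ennreal_plus[symmetric] del: ennreal_plus)
      also have "p * exp (- a * t) * EQ + p * C * exp (- a * t) * \<rho> = p * exp (- a * t) * (EQ + C * \<rho>)"
        by (simp add: algebra_simps)
      also have "\<dots> = ennreal (p * C * exp (- a * t))" unfolding C(2) by (simp add: mult_ac)
      finally show ?thesis .
    qed
    \<comment> \<open>Mass balance of one generation. The child sums carry exactly the mass of
      \<open>l\<close>, because convolution with the probability measure \<open>\<eta>\<close>
      preserves it; the root adds p * c, and the replacement of \<open>s\<close> by s - s * s costs
      at most p * c / 2.\<close>
    have main: "ennreal (p * c) + (\<integral>\<^sup>+t. ennreal (exp (\<alpha> * t)) * l t \<partial>lborel)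
        \<le> (\<integral>\<^sup>+t. ennreal (exp (\<alpha> * t)) * l' t \<partial>lborel) + ennreal (p * c / 2)"
    proof -
      have "ennreal (p * c) = (\<integral>\<^sup>+t. ennreal (exp (\<alpha> * t)) * (\<integral>\<^sup>+\<omega>. ennreal p * ind t \<omega> \<partial>M) \<partial>lborel)"
      proof -
        have "(\<integral>\<^sup>+t. ennreal (exp (\<alpha> * t)) * (\<integral>\<^sup>+\<omega>. ennreal p * ind t \<omega> \<partial>M) \<partial>lborel) =
          (\<integral>\<^sup>+t. ennreal p * gtail 0 t \<partial>lborel)"
          by (simp add: nn_integral_cmult gtail_def tail_0 ind_def mult_ac)
        also have "\<dots> = ennreal p * ennreal c"
          unfolding c(1)[symmetric] tail_int_def by (rule nn_integral_cmult) measurable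
        finally show ?thesis using p by (simp add: ennreal_mult'[symmetric])
      qed
      moreover have "(\<integral>\<^sup>+t. ennreal (exp (\<alpha> * t)) * l t \<partial>lborel) =
          (\<integral>\<^sup>+t. ennreal (exp (\<alpha> * t)) * (\<integral>\<^sup>+\<omega>. child_sum l t (\<psi>0 \<omega>) \<partial>M) \<partial>lborel)"
      proof -
        have "(\<integral>\<^sup>+t. ennreal (exp (\<alpha> * t)) * (\<integral>\<^sup>+\<omega>. child_sum l t (\<psi>0 \<omega>) \<partial>M) \<partial>lborel)
          = (\<integral>\<^sup>+t. (\<integral>\<^sup>+y. (\<lambda>u. ennreal (exp (\<alpha> * u)) * l u) (t - y) \<partial>\<eta>) * 1 \<partial>lborel)"
          by (subst child_sum_eta[OF l]) simp
        also have "\<dots> = (\<integral>\<^sup>+t. ennreal (exp (\<alpha> * t)) * l t \<partial>lborel)"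
          using step.emeasure_space_1 by (subst nn_integral_convolution) auto
        finally show ?thesis by simp
      qed
      ultimately have "ennreal (p * c) + (\<integral>\<^sup>+t. ennreal (exp (\<alpha> * t)) * l t \<partial>lborel)
        = (\<integral>\<^sup>+t. ennreal (exp (\<alpha> * t)) * (\<integral>\<^sup>+\<omega>. s t \<omega> \<partial>M) \<partial>lborel)"
        unfolding s_def by (simp add: nn_integral_add[symmetric] distrib_left[symmetric])
      also have "\<dots> \<le> (\<integral>\<^sup>+t. ennreal (exp (\<alpha> * t)) * (l' t + (\<integral>\<^sup>+\<omega>. min (s t \<omega>) (s t \<omega> * s t \<omega>) \<partial>M)) \<partial>lborel)"
      proof (intro nn_integral_mono mult_left_mono)
        fix t
        have "(\<integral>\<^sup>+\<omega>. s t \<omega> \<partial>M) \<le> (\<integral>\<^sup>+\<omega>. (s t \<omega> - s t \<omega> * s t \<omega>) + min (s t \<omega>) (s t \<omega> * s t \<omega>) \<partial>M)"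
        proof (rule nn_integral_mono)
          fix \<omega>
          \<comment> \<open>If s is at most 1 the difference is genuine and the minimum is s * s. If
            s is larger, truncation makes the difference 0 and the minimum is s itself.\<close>
          show "s t \<omega> \<le> (s t \<omega> - s t \<omega> * s t \<omega>) + min (s t \<omega>) (s t \<omega> * s t \<omega>)"
            by (cases "s t \<omega> * s t \<omega> \<le> s t \<omega>") (auto simp: min_def diff_add_cancel_ennreal)
        qed
        also have "\<dots> = l' t + (\<integral>\<^sup>+\<omega>. min (s t \<omega>) (s t \<omega> * s t \<omega>) \<partial>M)"
          unfolding l'_def by (rule nn_integral_add) measurable
        finally show "(\<integral>\<^sup>+\<omega>. s t \<omega> \<partial>M) \<le> l' t + (\<integral>\<^sup>+\<omega>. min (s t \<omega>) (s t \<omega> * s t \<omega>) \<partial>M)" .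
      qed simp
      also have "\<dots> = (\<integral>\<^sup>+t. ennreal (exp (\<alpha> * t)) * l' t \<partial>lborel) +
          (\<integral>\<^sup>+t. ennreal (exp (\<alpha> * t)) * (\<integral>\<^sup>+\<omega>. min (s t \<omega>) (s t \<omega> * s t \<omega>) \<partial>M) \<partial>lborel)"
        by (subst nn_integral_add[symmetric]) (auto simp: distrib_left)
      also have "(\<integral>\<^sup>+t. ennreal (exp (\<alpha> * t)) * (\<integral>\<^sup>+\<omega>. min (s t \<omega>) (s t \<omega> * s t \<omega>) \<partial>M) \<partial>lborel) \<le> ennreal (p * c / 2)"
      proof -
        have "(\<integral>\<^sup>+t. ennreal (exp (\<alpha> * t)) * (\<integral>\<^sup>+\<omega>. min (s t \<omega>) (s t \<omega> * s t \<omega>) \<partial>M) \<partial>lborel)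
          = (\<integral>\<^sup>+t. (\<integral>\<^sup>+\<omega>. ennreal (exp (\<alpha> * t)) * min (s t \<omega>) (s t \<omega> * s t \<omega>) \<partial>M) \<partial>lborel)"
          by (simp add: nn_integral_cmult)
        also have "\<dots> = (\<integral>\<^sup>+\<omega>. (\<integral>\<^sup>+t. ennreal (exp (\<alpha> * t)) * min (s t \<omega>) (s t \<omega> * s t \<omega>) \<partial>lborel) \<partial>M)"
          by (rule P.Fubini'[symmetric]) (simp add: split_beta')
        also have "\<dots> \<le> (\<integral>\<^sup>+\<omega>. ennreal (K * p powr (\<alpha> / a)) * ennreal (Y \<omega> powr (\<alpha> / a)) \<partial>M)"
          using s_le
        proof (intro nn_integral_mono_AE, eventually_elim)
          case (elim \<omega>)
          have "(\<integral>\<^sup>+t. ennreal (exp (\<alpha> * t)) * min (s t \<omega>) (s t \<omega> * s t \<omega>) \<partial>lborel) \<le>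
            (\<integral>\<^sup>+t. ennreal (exp (\<alpha> * t) * min (p * Y \<omega> * exp (- a * t)) ((p * Y \<omega> * exp (- a * t))\<^sup>2)) \<partial>lborel)"
          proof (rule nn_integral_mono)
            fix t
            have le: "s t \<omega> \<le> ennreal (p * Y \<omega> * exp (- a * t))" using elim by auto
            have nn: "0 \<le> p * Y \<omega> * exp (- a * t)" using p Y0 by simp
            have "min (s t \<omega>) (s t \<omega> * s t \<omega>) \<le> min (ennreal (p * Y \<omega> * exp (- a * t)))
                (ennreal (p * Y \<omega> * exp (- a * t)) * ennreal (p * Y \<omega> * exp (- a * t)))"
              using le by (intro min.mono mult_mono) auto
            also have "\<dots> = ennreal (min (p * Y \<omega> * exp (- a * t)) ((p * Y \<omega> * exp (- a * t))\<^sup>2))"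
              using nn by (simp add: ennreal_mult'[symmetric] power2_eq_square min_def)
            finally show "ennreal (exp (\<alpha> * t)) * min (s t \<omega>) (s t \<omega> * s t \<omega>)
              \<le> ennreal (exp (\<alpha> * t) * min (p * Y \<omega> * exp (- a * t)) ((p * Y \<omega> * exp (- a * t))\<^sup>2))"
              by (simp add: ennreal_mult' mult_left_mono)
          qed
          also have "\<dots> \<le> ennreal (K * (p * Y \<omega>) powr (\<alpha> / a))"
            unfolding K_def using a p Y0 by (intro nn_integral_exp_min_le) auto
          also have "\<dots> = ennreal (K * p powr (\<alpha> / a)) * ennreal (Y \<omega> powr (\<alpha> / a))"
            using p Y0 K by (simp add: powr_mult ennreal_mult'[symmetric] mult.assoc)
          finally show ?case .
        qed
        also have "\<dots> = ennreal (K * p powr (\<alpha> / a)) * ennreal y"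
          unfolding y(1)[symmetric] by (rule nn_integral_cmult) measurable
        also have "\<dots> = ennreal (K * p powr (\<alpha> / a) * y)" using K by (simp add: ennreal_mult'[symmetric])
        also have "\<dots> \<le> ennreal (p * c / 2)" using p(3) by (rule ennreal_leI)
        finally show ?thesis .
      qed
      finally show ?thesis by (simp add: add_left_mono)
    qed
    have "ennreal (real (Suc n) * (p * c / 2)) \<le> (\<integral>\<^sup>+t. ennreal (exp (\<alpha> * t)) * l' t \<partial>lborel)"
    proof -
      have "ennreal (real (Suc n) * (p * c / 2)) + ennreal (p * c / 2) = ennreal (p * c) + ennreal (real n * (p * c / 2))"
        using p c by (simp add: ennreal_plus[symmetric] field_simps del: ennreal_plus)
      also have "\<dots> \<le> ennreal (p * c) + (\<integral>\<^sup>+t. ennreal (exp (\<alpha> * t)) * l t \<partial>lborel)"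
        using lint by (rule add_left_mono)
      also note main
      finally show ?thesis by (simp add: add.commute[of _ "ennreal (p * c / 2)"])
    qed
    then show ?case using l' l'_tail l'_C by blast
  qed
  define \<delta> where "\<delta> = p * c / 2"
  have \<delta>: "0 < \<delta>" using p cpos by (simp add: \<delta>_def)
  have mass_lower: "real n * \<delta> \<le> tail_mass n" for n
  proof -
    obtain l where lt: "\<And>t. l t \<le> tail n t"
      and lint: "ennreal (real n * \<delta>) \<le> (\<integral>\<^sup>+t. ennreal (exp (\<alpha> * t)) * l t \<partial>lborel)"
      using step[of n] by (auto simp: \<delta>_def)
    note lint
    also have "(\<integral>\<^sup>+t. ennreal (exp (\<alpha> * t)) * l t \<partial>lborel) \<le> tail_int n"
      unfolding tail_int_def gtail_def using lt by (intro nn_integral_mono mult_left_mono) auto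
    finally show ?thesis unfolding tail_int_eq_mass by (simp add: tail_mass_def)
  qed
  \<comment> \<open>A limiting increment below \<delta> / 2 would let the mass grow eventually at
    rate at most \<delta> / 2, against the lower bound n * \<delta>.\<close>
  show ?thesis
  proof (rule ccontr)
    assume "\<not> 0 < qW_int"
    then have "qW_int < \<delta> / 2" using \<delta> by simp
    then have "eventually (\<lambda>n. tail_mass (Suc n) - tail_mass n < \<delta> / 2) sequentially"
      using tail_mass_increment by (intro order_tendstoD)
    then obtain N where N: "\<And>n. n \<ge> N \<Longrightarrow> tail_mass (Suc n) - tail_mass n < \<delta> / 2"
      by (auto simp: eventually_sequentially)
    have up: "tail_mass (N + m) \<le> tail_mass N + real m * (\<delta> / 2)" for m
    proof (induction m)
      case (Suc m)
      have "real (Suc m) * (\<delta> / 2) = real m * (\<delta> / 2) + \<delta> / 2" by (simp add: field_simps)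
      then show ?case
        using Suc.IH N[OF le_add1, of m] unfolding add_Suc_right by linarith
    qed simp
    obtain m :: nat where m: "tail_mass N < real m * (\<delta> / 2)"
      using reals_Archimedean3[of "\<delta> / 2"] \<delta> by auto
    have "real (N + m) * \<delta> \<le> tail_mass N + real m * (\<delta> / 2)"
      using mass_lower[of "N + m"] up[of m] by linarith
    moreover have "real (N + m) * \<delta> = real N * \<delta> + real m * (\<delta> / 2) + real m * (\<delta> / 2)"
      by (simp add: algebra_simps)
    moreover have "0 \<le> real N * \<delta>" using \<delta> by simp
    ultimately show False using m by linarith
  qed
qed

end

section \<open>The first exceedance in length-lexicographic order\<close>

text \<open>A finite conjunction over the prefixes of a node, from which both prefix closure of the
  tree and measurability of membership can be read off.\<close>

lemma generation_iff:
  "i \<in> generation w n \<longleftrightarrow> length i = n \<and> (\<forall>r<n. i ! r \<in> children (w (take r i)))"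
proof (induction n arbitrary: i)
  case (Suc n)
  show ?case
  proof (cases i rule: rev_cases)
    case (snoc i' j)
    then show ?thesis
      by (auto simp: generation.simps(2) Suc.IH nth_append less_Suc_eq)
  qed (auto simp: generation.simps(2))
qed simp

declare generation.simps(2) [simp del]

lemma tree_iff: "i \<in> tree w \<longleftrightarrow> i \<in> generation w (length i)"
  by (auto simp: tree_def generation_iff)

lemma take_Ulam: "i \<in> Ulam \<Longrightarrow> take r i \<in> Ulam"
  by (auto simp: Ulam_def dest: in_set_takeD)

lemma nth_Ulam: "i \<in> Ulam \<Longrightarrow> r < length i \<Longrightarrow> 1 \<le> i ! r"
  unfolding Ulam_def by (metis (mono_tags) One_nat_def Suc_leI mem_Collect_eq neq0_conv nth_mem)

lemma wf_prec: "wf {(i, j). prec i j}"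
proof -
  have "{(i, j). prec i j} = lenlex less_than" by (auto simp: prec_def)
  then show ?thesis by (simp add: wf_lenlex)
qed

lemma prec_length: "prec i j \<Longrightarrow> length i \<le> length j"
  by (auto simp: prec_def lenlex_conv)

lemma prec_shorter: "length i < length j \<Longrightarrow> prec i j"
  by (auto simp: prec_def lenlex_conv)

lemma prec_total: "prec i j \<or> i = j \<or> prec j i"
proof -
  have "total (lenlex less_than)" by (intro total_lenlex) (auto simp: total_on_def)
  then show ?thesis unfolding prec_def total_on_def by blast
qed

definition node_val :: "(nat list \<Rightarrow> mark) \<Rightarrow> nat list \<Rightarrow> ennreal" where
  "node_val w i = ennreal (path_weight w i * mQ (w i))"

definition first_exceed :: "(nat list \<Rightarrow> mark) \<Rightarrow> real \<Rightarrow> nat list \<Rightarrow> bool" where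
  "first_exceed w t i \<longleftrightarrow> i \<in> tree w \<and> ennreal (exp t) < node_val w i \<and>
     (\<forall>j\<in>tree w. prec j i \<longrightarrow> node_val w j \<le> ennreal (exp t))"

text \<open>The maximum first exceeds the level in generation \<open>Suc n\<close> precisely when
  the first exceeding node has length \<open>Suc n\<close>, because shorter nodes precede longer
  ones. That node is unique by totality of the order, so the count is 0 or 1.\<close>

lemma first_exceed_count:
  assumes adm: "\<And>i. i \<in> Ulam \<Longrightarrow> admissible_mark (w i)"
  shows "(\<integral>\<^sup>+i. of_bool (i \<in> generation w (Suc n) \<and> first_exceed w t i) \<partial>count_space UNIV)
      + indicator {ennreal (exp t)<..} (max_upto n w) = (indicator {ennreal (exp t)<..} (max_upto (Suc n) w) :: ennreal)"
proof -
  have gt: "ennreal (exp t) < max_upto k w \<longleftrightarrow> (\<exists>i\<in>tree w. length i \<le> k \<and> ennreal (exp t) < node_val w i)" for k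
  proof -
    have "(\<Union>l\<le>k. generation w l) = {i \<in> tree w. length i \<le> k}" by (auto simp: tree_iff generation_iff)
    then show ?thesis using adm by (simp add: max_upto_eq_SUP less_SUP_iff node_val_def) blast
  qed
  consider "ennreal (exp t) < max_upto n w" |
    "\<not> ennreal (exp t) < max_upto n w" "ennreal (exp t) < max_upto (Suc n) w" |
    "\<not> ennreal (exp t) < max_upto (Suc n) w" by blast
  then show ?thesis
  proof cases
    case 1
    then obtain j where j: "j \<in> tree w" "length j \<le> n" "ennreal (exp t) < node_val w j" by (auto simp: gt)
    have F: "(i \<in> generation w (Suc n) \<and> first_exceed w t i) = False" for i
    proof (rule iffI)
      assume i: "i \<in> generation w (Suc n) \<and> first_exceed w t i"
      then have "prec j i" using j by (intro prec_shorter) (auto simp: generation_iff)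
      then show False using i j by (auto simp: first_exceed_def not_less[symmetric])
    qed simp
    have "ennreal (exp t) < max_upto (Suc n) w" using 1 max_upto_mono by (rule less_le_trans)
    then show ?thesis using 1 unfolding F by simp
  next
    case 2
    define E where "E = {i \<in> tree w. ennreal (exp t) < node_val w i}"
    obtain i1 where i1: "i1 \<in> E" "length i1 \<le> Suc n" using 2(2) by (auto simp: gt E_def)
    \<comment> \<open>Well-foundedness of the order provides a first exceeding node even when
      generations are infinite.\<close>
    obtain i0 where i0: "i0 \<in> E" "\<And>j. prec j i0 \<Longrightarrow> j \<notin> E"
      using wf_prec i1(1) by (rule wfE_min) auto
    have "\<not> prec i1 i0" using i0(2) i1(1) by auto
    then have "length i0 \<le> Suc n" using prec_shorter[of i1 i0] i1(2) by linarith
    moreover have "\<not> length i0 \<le> n" using 2(1) i0(1) by (auto simp: gt E_def)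
    ultimately have len: "length i0 = Suc n" by simp
    have first: "first_exceed w t i0"
      using i0 by (auto simp: first_exceed_def E_def not_less[symmetric])
    have uniq: "i \<in> generation w (Suc n) \<and> first_exceed w t i \<longleftrightarrow> i = i0" for i
    proof
      assume i: "i \<in> generation w (Suc n) \<and> first_exceed w t i"
      then have "i \<in> E" by (auto simp: first_exceed_def E_def)
      then have "\<not> prec i i0" using i0(2) by blast
      moreover have "\<not> prec i0 i" using i i0(1) by (auto simp: first_exceed_def E_def not_less[symmetric])
      ultimately show "i = i0" using prec_total by blast
    next
      assume "i = i0"
      then show "i \<in> generation w (Suc n) \<and> first_exceed w t i"
        using first len i0(1) by (auto simp: E_def tree_iff)
    qed
    have "(\<integral>\<^sup>+i. of_bool (i \<in> generation w (Suc n) \<and> first_exceed w t i) \<partial>count_space UNIV) =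
      (\<integral>\<^sup>+i. indicator {i0} i \<partial>count_space UNIV)"
      unfolding uniq by (intro nn_integral_cong) (auto simp: indicator_def)
    also have "\<dots> = 1" by (simp add: one_ennreal_def)
    finally show ?thesis using 2 by simp
  next
    case 3
    have F: "(i \<in> generation w (Suc n) \<and> first_exceed w t i) = False" for i
      using 3 by (auto simp: gt first_exceed_def generation_iff)
    have "\<not> ennreal (exp t) < max_upto n w"
      using 3 less_le_trans[OF _ max_upto_mono] by blast
    then show ?thesis using 3 unfolding F by simp
  qed
qed

text \<open>The positive part from \<open>H_integrand\<close> at a deterministic node, so that it
  can be summed over a generation instead of being evaluated along the spine.\<close>

definition H_body :: "real \<Rightarrow> (nat list \<Rightarrow> mark) \<Rightarrow> nat list \<Rightarrow> ennreal" where
  "H_body a w i = eexp (ereal a * node_Y w i)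
     - eexp (ereal a * ((SUP j\<in>{j \<in> tree w. prec j i}. node_S w j + node_Y w j) - node_S w i))"

lemma H_integrand_eq:
  "H_integrand a \<psi> J m \<omega> = H_body a (\<lambda>i. \<psi> i \<omega>) (J m \<omega>) * inverse (node_D a (\<lambda>i. \<psi> i \<omega>) (J m \<omega>))"
  by (simp add: H_integrand_def H_body_def Let_def)

text \<open>The derivative of exp (a * t), integrated over the levels from y up to ln q; the set of
  such levels is empty exactly when the truncated difference vanishes.\<close>

lemma truncated_diff_eq_nn_integral:
  assumes a: "0 < (a :: real)" and q: "0 \<le> q"
  shows "ennreal (q powr a) - eexp (ereal a * y) =
    (\<integral>\<^sup>+t. ennreal a * (ennreal (exp (a * t)) * of_bool (ennreal (exp t) < ennreal q \<and> y \<le> ereal t)) \<partial>lborel)"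
proof -
  have scale: "(\<integral>\<^sup>+t. ennreal a * f t \<partial>lborel) = ennreal a * (\<integral>\<^sup>+t. f t \<partial>lborel)"
    if "f \<in> borel_measurable borel" for f :: "real \<Rightarrow> ennreal"
    using that by (intro nn_integral_cmult) simp
  have less: "(\<integral>\<^sup>+t. ennreal a * (ennreal (exp (a * t)) * of_bool (ennreal (exp t) < ennreal q)) \<partial>lborel) = ennreal (q powr a)"
  proof -
    have "(\<integral>\<^sup>+t. ennreal a * (ennreal (exp (a * t)) * of_bool (ennreal (exp t) < ennreal q)) \<partial>lborel)
      = ennreal a * (\<integral>\<^sup>+t. ennreal (exp (a * t)) * of_bool (ennreal (exp t) < ennreal q) \<partial>lborel)"
      by (rule scale) (unfold of_bool_def, measurable)
    also have "\<dots> = ennreal a * ennreal (q powr a / a)"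
      unfolding nn_integral_exp_less[OF a q, symmetric] by (simp add: indicator_def)
    also have "\<dots> = ennreal (q powr a)" using a by (simp add: ennreal_mult'[symmetric])
    finally show ?thesis .
  qed
  show ?thesis
  proof (cases y)
    case MInf
    then show ?thesis using less a by (simp add: eexp_def)
  next
    case PInf
    then show ?thesis using a by (simp add: eexp_def)
  next
    case (real x)
    have below: "(\<integral>\<^sup>+t. ennreal a * (ennreal (exp (a * t)) * indicator {..<x} t) \<partial>lborel) = ennreal (exp (a * x))"
      using a nn_integral_exp_below[OF a, of x] by (subst scale) (auto simp: ennreal_mult'[symmetric])
    have E: "eexp (ereal a * y) = ennreal (exp (a * x))" using real by (simp add: eexp_def)
    show ?thesis
    proof (cases "exp x < q")
      case True
      have lt: "exp t < q" if "t < x" for t using that True by (meson exp_less_cancel_iff less_trans)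
      have "ennreal (q powr a) = (\<integral>\<^sup>+t. ennreal a * (ennreal (exp (a * t)) * indicator {..<x} t) +
          ennreal a * (ennreal (exp (a * t)) * of_bool (ennreal (exp t) < ennreal q \<and> y \<le> ereal t)) \<partial>lborel)"
        unfolding less[symmetric] using lt real
        by (intro nn_integral_cong) (auto simp: indicator_def ennreal_less_iff)
      also have "\<dots> = ennreal (exp (a * x)) +
        (\<integral>\<^sup>+t. ennreal a * (ennreal (exp (a * t)) * of_bool (ennreal (exp t) < ennreal q \<and> y \<le> ereal t)) \<partial>lborel)"
        unfolding below[symmetric] of_bool_def by (intro nn_integral_add) measurable
      finally show ?thesis unfolding E by simp
    next
      case False
      have F: "(ennreal (exp t) < ennreal q \<and> y \<le> ereal t) = False" for t
      proof (rule iffI)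
        assume A: "ennreal (exp t) < ennreal q \<and> y \<le> ereal t"
        then have "exp t < q" "exp x \<le> exp t" using real q by (auto simp: ennreal_less_iff)
        then show False using False by linarith
      qed simp
      have "q powr a \<le> exp (a * x)"
      proof -
        have "q powr a \<le> exp x powr a" using False q a by (intro powr_mono2) auto
        then show ?thesis by (simp add: powr_def mult.commute)
      qed
      then show ?thesis unfolding E F by (simp add: ennreal_minus ennreal_neg)
    qed
  qed
qed

text \<open>\<open>H_body\<close> measures levels relative to the position of node \<open>i\<close>.
  Shifting the level by the logarithm of the path weight makes the condition
  \<open>first_exceed\<close> at an absolute level, and the weight to the power \<open>a\<close> is
  the Jacobian-like factor exp (a * t) gains in this shift. If the weight is zero, both sides
  vanish.\<close>

lemma H_body_weight:
  assumes a: "0 < a" and adm: "\<And>i. i \<in> Ulam \<Longrightarrow> admissible_mark (w i)" and i: "i \<in> tree w"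
  shows "ennreal (path_weight w i powr a) * H_body a w i =
    (\<integral>\<^sup>+t. ennreal a * (ennreal (exp (a * t)) * of_bool (first_exceed w t i)) \<partial>lborel)"
proof -
  let ?p = "path_weight w i" and ?q = "mQ (w i)"
  have nn: "j \<in> Ulam" "0 \<le> path_weight w j" "0 \<le> mQ (w j)" if "j \<in> tree w" for j
    using that generation_weight_nonneg[OF adm] adm by (auto simp: tree_def admissible_mark_def)
  show ?thesis
  proof (cases "?p = 0")
    case True
    then show ?thesis by (simp add: first_exceed_def node_val_def)
  next
    case False
    then have p: "?p > 0" using nn(2)[OF i] by simp
    have q: "0 \<le> ?q" using nn(3)[OF i] .
    define y where "y = (SUP j\<in>{j \<in> tree w. prec j i}. node_S w j + node_Y w j) - node_S w i"
    have nS: "node_S w i = ereal (ln ?p)" using p by (simp add: node_S_def elog_def ennreal_eq_0_iff)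
    have Y: "eexp (ereal a * node_Y w i) = ennreal (?q powr a)"
      using q a by (cases "?q = 0") (auto simp: node_Y_def elog_def eexp_def ennreal_eq_0_iff powr_def)
    have node: "node_S w j + node_Y w j = elog (node_val w j)" if "j \<in> tree w" for j
      using nn[OF that] unfolding node_val_def
      by (cases "path_weight w j = 0"; cases "mQ (w j) = 0")
        (auto simp: node_S_def node_Y_def elog_def ennreal_eq_0_iff ln_mult mult_le_0_iff)
    have yle: "y \<le> ereal t \<longleftrightarrow> (\<forall>j\<in>tree w. prec j i \<longrightarrow> node_val w j \<le> ennreal (exp (t + ln ?p)))" for t
    proof -
      have "y \<le> ereal t \<longleftrightarrow> (SUP j\<in>{j \<in> tree w. prec j i}. node_S w j + node_Y w j) \<le> ereal (t + ln ?p)"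
        unfolding y_def nS by (subst ereal_minus_le_iff) (auto simp: add.commute)
      also have "\<dots> \<longleftrightarrow> (\<forall>j\<in>tree w. prec j i \<longrightarrow> elog (node_val w j) \<le> ereal (t + ln ?p))"
        using node by (auto simp: SUP_le_iff)
      finally show ?thesis by (simp add: elog_le_iff eexp_def)
    qed
    have first: "first_exceed w t i \<longleftrightarrow> ennreal (exp (t - ln ?p)) < ennreal ?q \<and> y \<le> ereal (t - ln ?p)" for t
      unfolding first_exceed_def yle using i p ennreal_less_mult_iff[OF p, of t "ennreal ?q"] q
      by (simp add: node_val_def ennreal_mult'[symmetric])
    have "H_body a w i = (\<integral>\<^sup>+t. ennreal a * (ennreal (exp (a * t)) * of_bool (ennreal (exp t) < ennreal ?q \<and> y \<le> ereal t)) \<partial>lborel)"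
      unfolding H_body_def y_def[symmetric] Y by (rule truncated_diff_eq_nn_integral[OF a q])
    also have "\<dots> = (\<integral>\<^sup>+t. ennreal a * (ennreal (exp (a * (t - ln ?p))) * of_bool (first_exceed w t i)) \<partial>lborel)"
      unfolding first
      by (subst nn_integral_real_affine[of _ 1 "- ln ?p"]) (simp_all add: of_bool_def add.commute)
    finally have "ennreal (?p powr a) * H_body a w i =
      (\<integral>\<^sup>+t. ennreal (?p powr a) * (ennreal a * (ennreal (exp (a * (t - ln ?p))) * of_bool (first_exceed w t i))) \<partial>lborel)"
      unfolding first of_bool_def by (simp add: nn_integral_cmult)
    also have "\<dots> = (\<integral>\<^sup>+t. ennreal a * (ennreal (exp (a * t)) * of_bool (first_exceed w t i)) \<partial>lborel)"
    proof (rule nn_integral_cong)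
      fix t
      have "?p powr a * exp (a * (t - ln ?p)) = exp (a * t)"
        using p by (simp add: powr_def exp_add[symmetric] algebra_simps)
      then have "ennreal (?p powr a) * ennreal (exp (a * (t - ln ?p))) = ennreal (exp (a * t))"
        by (simp add: ennreal_mult'[symmetric])
      then show "ennreal (?p powr a) * (ennreal a * (ennreal (exp (a * (t - ln ?p))) * of_bool (first_exceed w t i))) =
        ennreal a * (ennreal (exp (a * t)) * of_bool (first_exceed w t i))"
        by (metis mult.assoc mult.left_commute)
    qed
    finally show ?thesis .
  qed
qed

lemma measurable_generation:
  assumes X: "\<And>i. i \<in> Ulam \<Longrightarrow> (\<lambda>\<omega>. X \<omega> i) \<in> measurable N mark_space" and i: "i \<in> Ulam"
  shows "Measurable.pred N (\<lambda>\<omega>. i \<in> generation (X \<omega>) n)"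
proof -
  have [measurable]: "(\<lambda>\<omega>. X \<omega> (take r i)) \<in> measurable N mark_space" for r
    using X take_Ulam[OF i] by blast
  show ?thesis unfolding generation_iff by measurable
qed

lemma measurable_path_weight:
  assumes X: "\<And>i. i \<in> Ulam \<Longrightarrow> (\<lambda>\<omega>. X \<omega> i) \<in> measurable N mark_space" and i: "i \<in> Ulam"
  shows "(\<lambda>\<omega>. path_weight (X \<omega>) i) \<in> borel_measurable N"
  unfolding path_weight_def
  by (intro borel_measurable_prod measurable_compose[OF X[OF take_Ulam[OF i]] measurable_mC] nth_Ulam i) auto

lemma measurable_elog [measurable]: "elog \<in> borel_measurable borel"
  unfolding elog_def by measurable

lemma measurable_eexp [measurable]: "eexp \<in> borel_measurable borel"
  unfolding eexp_def by measurable

lemma measurable_power_sum_mark: "power_sum a \<in> borel_measurable mark_space"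
proof -
  have "(\<lambda>m. indicator (children m) j * ennreal (mC m j powr a)) \<in> borel_measurable mark_space" for j
  proof (cases "1 \<le> j")
    case True
    then have [measurable]: "(\<lambda>m. mC m j) \<in> borel_measurable mark_space" by (rule measurable_mC)
    show ?thesis unfolding indicator_def of_bool_def by measurable
  next
    case False
    then have "\<And>m. j \<notin> children m" by (auto simp: children_def)
    then show ?thesis by simp
  qed
  then show ?thesis unfolding power_sum_def[abs_def] by (intro borel_measurable_suminf_order)
qed

lemma measurable_node_D:
  assumes "\<And>i. i \<in> Ulam \<Longrightarrow> (\<lambda>\<omega>. X \<omega> i) \<in> measurable N mark_space" and "i \<in> Ulam"
  shows "(\<lambda>\<omega>. node_D a (X \<omega>) i) \<in> borel_measurable N"
  unfolding node_D_def using assms by (intro measurable_compose[OF _ measurable_power_sum_mark]) auto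

lemma tree_subset_Ulam: "i \<in> tree w \<Longrightarrow> i \<in> Ulam"
  using generation_subset_Ulam by (auto simp: tree_def)

lemma measurable_H_body:
  assumes X: "\<And>i. i \<in> Ulam \<Longrightarrow> (\<lambda>\<omega>. X \<omega> i) \<in> measurable N mark_space" and i: "i \<in> Ulam"
  shows "(\<lambda>\<omega>. H_body a (X \<omega>) i) \<in> borel_measurable N"
proof -
  have S [measurable]: "(\<lambda>\<omega>. node_S (X \<omega>) j) \<in> borel_measurable N" if "j \<in> Ulam" for j
    unfolding node_S_def using measurable_path_weight[OF X that] by measurable
  have Y [measurable]: "(\<lambda>\<omega>. node_Y (X \<omega>) j) \<in> borel_measurable N" if "j \<in> Ulam" for j
    unfolding node_Y_def using X[OF that] by measurable
  \<comment> \<open>The random index set becomes a fixed countable one, with the bottom value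
    -\<infinity> at nodes off the tree.\<close>
  have eq: "(SUP j\<in>{j \<in> tree (X \<omega>). prec j i}. node_S (X \<omega>) j + node_Y (X \<omega>) j) =
      (SUP j\<in>{j \<in> Ulam. prec j i}. if j \<in> generation (X \<omega>) (length j) then node_S (X \<omega>) j + node_Y (X \<omega>) j else -\<infinity>)" for \<omega>
  proof (rule antisym)
    show "(SUP j\<in>{j \<in> tree (X \<omega>). prec j i}. node_S (X \<omega>) j + node_Y (X \<omega>) j) \<le>
      (SUP j\<in>{j \<in> Ulam. prec j i}. if j \<in> generation (X \<omega>) (length j) then node_S (X \<omega>) j + node_Y (X \<omega>) j else -\<infinity>)"
    proof (rule SUP_least)
      fix j assume j: "j \<in> {j \<in> tree (X \<omega>). prec j i}"
      show "node_S (X \<omega>) j + node_Y (X \<omega>) j \<le> (SUP j\<in>{j \<in> Ulam. prec j i}.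
          if j \<in> generation (X \<omega>) (length j) then node_S (X \<omega>) j + node_Y (X \<omega>) j else -\<infinity>)"
        by (rule SUP_upper2[of j]) (use j tree_subset_Ulam in \<open>auto simp: tree_iff\<close>)
    qed
    show "(SUP j\<in>{j \<in> Ulam. prec j i}. if j \<in> generation (X \<omega>) (length j) then node_S (X \<omega>) j + node_Y (X \<omega>) j else -\<infinity>)
      \<le> (SUP j\<in>{j \<in> tree (X \<omega>). prec j i}. node_S (X \<omega>) j + node_Y (X \<omega>) j)"
      by (intro SUP_least) (auto simp: tree_iff intro: SUP_upper)
  qed
  have [measurable]: "(\<lambda>\<omega>. SUP j\<in>{j \<in> tree (X \<omega>). prec j i}. node_S (X \<omega>) j + node_Y (X \<omega>) j) \<in> borel_measurable N"
    unfolding eq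
  proof (rule borel_measurable_SUP)
    fix j assume "j \<in> {j \<in> Ulam. prec j i}"
    then have j: "j \<in> Ulam" by simp
    note [measurable] = measurable_generation[OF X j] S[OF j] Y[OF j]
    show "(\<lambda>\<omega>. if j \<in> generation (X \<omega>) (length j) then node_S (X \<omega>) j + node_Y (X \<omega>) j else -\<infinity>) \<in> borel_measurable N"
      by measurable
  qed simp
  note [measurable] = S[OF i] Y[OF i]
  show ?thesis unfolding H_body_def by measurable
qed

lemma measurable_first_exceed:
  assumes X: "\<And>i. i \<in> Ulam \<Longrightarrow> (\<lambda>\<omega>. X \<omega> i) \<in> measurable N mark_space" and i: "i \<in> Ulam"
    and [measurable]: "T \<in> borel_measurable N"
  shows "Measurable.pred N (\<lambda>\<omega>. first_exceed (X \<omega>) (T \<omega>) i)"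
proof -
  have V: "(\<lambda>\<omega>. node_val (X \<omega>) j) \<in> borel_measurable N" if "j \<in> Ulam" for j
    unfolding node_val_def using measurable_path_weight[OF X that] X[OF that] by measurable
  have eq: "first_exceed (X \<omega>) (T \<omega>) i \<longleftrightarrow> i \<in> generation (X \<omega>) (length i) \<and> ennreal (exp (T \<omega>)) < node_val (X \<omega>) i \<and>
     (\<forall>j\<in>Ulam. j \<in> generation (X \<omega>) (length j) \<longrightarrow> prec j i \<longrightarrow> node_val (X \<omega>) j \<le> ennreal (exp (T \<omega>)))" for \<omega>
    unfolding first_exceed_def using tree_subset_Ulam by (auto simp: tree_iff)
  have "Measurable.pred N (\<lambda>\<omega>. \<forall>j\<in>Ulam. j \<in> generation (X \<omega>) (length j) \<longrightarrow> prec j i \<longrightarrow> node_val (X \<omega>) j \<le> ennreal (exp (T \<omega>)))"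
  proof (rule pred_intros_countable_bounded)
    fix j assume j: "j \<in> Ulam"
    note [measurable] = measurable_generation[OF X j] V[OF j]
    show "Measurable.pred N (\<lambda>\<omega>. j \<in> generation (X \<omega>) (length j) \<longrightarrow> prec j i \<longrightarrow> node_val (X \<omega>) j \<le> ennreal (exp (T \<omega>)))"
      by measurable
  qed
  note [measurable] = this measurable_generation[OF X i] V[OF i]
  show ?thesis unfolding eq by measurable
qed

lemma nn_integral_count_swap:
  fixes f :: "'i :: countable \<Rightarrow> 'a \<Rightarrow> ennreal"
  assumes M: "sigma_finite_measure M" and f: "\<And>i. f i \<in> borel_measurable M"
  shows "(\<integral>\<^sup>+\<omega>. (\<integral>\<^sup>+i. f i \<omega> \<partial>count_space UNIV) \<partial>M) = (\<integral>\<^sup>+i. (\<integral>\<^sup>+\<omega>. f i \<omega> \<partial>M) \<partial>count_space UNIV)"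
proof -
  interpret P: pair_sigma_finite "count_space (UNIV :: 'i set)" M
    using M sigma_finite_measure_count_space_countable[of "UNIV :: 'i set"]
    by (simp add: pair_sigma_finite_def)
  show ?thesis
    by (rule P.Fubini') (auto intro!: measurable_pair_measure_countable1 f)
qed

context tilted_branching
begin

text \<open>By \<open>H_body_weight\<close> and Tonelli, the left side integrates \<alpha> * exp
  (\<alpha> * t) against the expected number of first exceedances in generation
  \<open>Suc n\<close>. By \<open>first_exceed_count\<close> that number adds up with
  \<open>tail n t\<close> to \<open>tail (Suc n) t\<close>.\<close>

lemma first_exceed_mass:
  "(\<integral>\<^sup>+i. (\<integral>\<^sup>+\<omega>. of_bool (i \<in> generation (\<lambda>i. \<psi> i \<omega>) (Suc n)) *
      (ennreal (path_weight (\<lambda>i. \<psi> i \<omega>) i powr \<alpha>) * H_body \<alpha> (\<lambda>i. \<psi> i \<omega>) i) \<partial>M) \<partial>count_space UNIV)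
    = ennreal (\<alpha> * (tail_mass (Suc n) - tail_mass n))"
proof -
  interpret P: pair_sigma_finite lborel M ..
  let ?w = "\<lambda>\<omega> i. \<psi> i \<omega>"
  let ?F = "\<lambda>i t \<omega>. of_bool (i \<in> generation (?w \<omega>) (Suc n) \<and> first_exceed (?w \<omega>) t i) :: ennreal"
  have psi: "\<And>i. i \<in> Ulam \<Longrightarrow> (\<lambda>\<omega>. ?w \<omega> i) \<in> measurable M mark_space" by (rule measurable_psi)
  have Fm: "(\<lambda>x. ?F i (fst x) (snd x)) \<in> borel_measurable (borel \<Otimes>\<^sub>M M)" for i
  proof (cases "i \<in> Ulam")
    case True
    have psi': "\<And>i. i \<in> Ulam \<Longrightarrow> (\<lambda>x. ?w (snd x) i) \<in> measurable (borel \<Otimes>\<^sub>M M) mark_space"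
      by (rule measurable_compose[OF measurable_snd measurable_psi])
    note [measurable] = measurable_generation[OF psi' True] measurable_first_exceed[OF psi' True measurable_fst]
    show ?thesis unfolding of_bool_def by measurable
  next
    case False
    then have "i \<notin> generation w k" for w k using generation_subset_Ulam by blast
    then show ?thesis by simp
  qed
  have Fm1: "(\<lambda>\<omega>. ?F i t \<omega>) \<in> borel_measurable M" for i t
    using measurable_compose[OF measurable_Pair1'[of t borel M] Fm[of i]] by simp
  have "(\<integral>\<^sup>+\<omega>. of_bool (i \<in> generation (?w \<omega>) (Suc n)) * (ennreal (path_weight (?w \<omega>) i powr \<alpha>) * H_body \<alpha> (?w \<omega>) i) \<partial>M)
    = (\<integral>\<^sup>+t. ennreal \<alpha> * (ennreal (exp (\<alpha> * t)) * (\<integral>\<^sup>+\<omega>. ?F i t \<omega> \<partial>M)) \<partial>lborel)" for i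
  proof -
    have "(\<integral>\<^sup>+\<omega>. of_bool (i \<in> generation (?w \<omega>) (Suc n)) * (ennreal (path_weight (?w \<omega>) i powr \<alpha>) * H_body \<alpha> (?w \<omega>) i) \<partial>M)
      = (\<integral>\<^sup>+\<omega>. (\<integral>\<^sup>+t. ennreal \<alpha> * (ennreal (exp (\<alpha> * t)) * ?F i t \<omega>) \<partial>lborel) \<partial>M)"
    proof (rule nn_integral_cong)
      fix \<omega> assume \<omega>: "\<omega> \<in> space M"
      show "of_bool (i \<in> generation (?w \<omega>) (Suc n)) * (ennreal (path_weight (?w \<omega>) i powr \<alpha>) * H_body \<alpha> (?w \<omega>) i)
        = (\<integral>\<^sup>+t. ennreal \<alpha> * (ennreal (exp (\<alpha> * t)) * ?F i t \<omega>) \<partial>lborel)"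
      proof (cases "i \<in> generation (?w \<omega>) (Suc n)")
        case True
        then have "i \<in> tree (?w \<omega>)" by (auto simp: tree_iff generation_iff)
        then show ?thesis
          using True H_body_weight[OF alpha_pos, of "?w \<omega>" i] admissible_psi[OF _ \<omega>] by simp
      qed simp
    qed
    also have "\<dots> = (\<integral>\<^sup>+t. (\<integral>\<^sup>+\<omega>. ennreal \<alpha> * (ennreal (exp (\<alpha> * t)) * ?F i t \<omega>) \<partial>M) \<partial>lborel)"
      using Fm[of i] by (intro P.Fubini') (simp add: split_beta')
    also have "\<dots> = (\<integral>\<^sup>+t. ennreal \<alpha> * (ennreal (exp (\<alpha> * t)) * (\<integral>\<^sup>+\<omega>. ?F i t \<omega> \<partial>M)) \<partial>lborel)"
      using Fm1 by (simp add: nn_integral_cmult)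
    finally show ?thesis .
  qed
  then have "(\<integral>\<^sup>+i. (\<integral>\<^sup>+\<omega>. of_bool (i \<in> generation (?w \<omega>) (Suc n)) *
      (ennreal (path_weight (?w \<omega>) i powr \<alpha>) * H_body \<alpha> (?w \<omega>) i) \<partial>M) \<partial>count_space UNIV)
    = (\<integral>\<^sup>+i. (\<integral>\<^sup>+t. ennreal \<alpha> * (ennreal (exp (\<alpha> * t)) * (\<integral>\<^sup>+\<omega>. ?F i t \<omega> \<partial>M)) \<partial>lborel) \<partial>count_space UNIV)"
    by simp
  also have "\<dots> = (\<integral>\<^sup>+t. (\<integral>\<^sup>+i. ennreal \<alpha> * (ennreal (exp (\<alpha> * t)) * (\<integral>\<^sup>+\<omega>. ?F i t \<omega> \<partial>M)) \<partial>count_space UNIV) \<partial>lborel)"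
    using Fm by (intro nn_integral_count_swap[symmetric] lborel.sigma_finite_measure_axioms) (simp, measurable)
  also have "\<dots> = (\<integral>\<^sup>+t. ennreal \<alpha> * (ennreal (exp (\<alpha> * t)) * (\<integral>\<^sup>+\<omega>. (\<integral>\<^sup>+i. ?F i t \<omega> \<partial>count_space UNIV) \<partial>M)) \<partial>lborel)"
    using Fm1 by (simp add: nn_integral_cmult nn_integral_count_swap[OF sigma_finite_measure_axioms])
  finally have eq: "(\<integral>\<^sup>+i. (\<integral>\<^sup>+\<omega>. of_bool (i \<in> generation (?w \<omega>) (Suc n)) *
      (ennreal (path_weight (?w \<omega>) i powr \<alpha>) * H_body \<alpha> (?w \<omega>) i) \<partial>M) \<partial>count_space UNIV)
    = (\<integral>\<^sup>+t. ennreal \<alpha> * (ennreal (exp (\<alpha> * t)) * (\<integral>\<^sup>+\<omega>. (\<integral>\<^sup>+i. ?F i t \<omega> \<partial>count_space UNIV) \<partial>M)) \<partial>lborel)"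
    (is "?L = ?R") .
  have Gm: "(\<lambda>x. \<integral>\<^sup>+i. ?F i (fst x) (snd x) \<partial>count_space UNIV) \<in> borel_measurable (borel \<Otimes>\<^sub>M M)"
  proof -
    interpret C: sigma_finite_measure "count_space (UNIV :: nat list set)"
      by (rule sigma_finite_measure_count_space_countable) simp
    have "(\<lambda>(i, x). ?F i (fst x) (snd x)) \<in> borel_measurable (count_space UNIV \<Otimes>\<^sub>M (borel \<Otimes>\<^sub>M M))"
      using Fm by (intro measurable_pair_measure_countable1) auto
    from measurable_compose[OF measurable_pair_swap' this]
    have "(\<lambda>(x, i). ?F i (fst x) (snd x)) \<in> borel_measurable ((borel \<Otimes>\<^sub>M M) \<Otimes>\<^sub>M count_space UNIV)"
      by (simp add: split_beta')
    then show ?thesis by (intro C.borel_measurable_nn_integral) (simp add: split_beta')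
  qed
  have Gm1: "(\<lambda>\<omega>. \<integral>\<^sup>+i. ?F i t \<omega> \<partial>count_space UNIV) \<in> borel_measurable M" for t
    using measurable_compose[OF measurable_Pair1'[of t borel M] Gm] by simp
  have tails: "(\<integral>\<^sup>+\<omega>. (\<integral>\<^sup>+i. ?F i t \<omega> \<partial>count_space UNIV) \<partial>M) + tail n t = tail (Suc n) t" for t
  proof -
    have [measurable]: "(\<lambda>\<omega>. indicator {ennreal (exp t)<..} (max_upto n (?w \<omega>)) :: ennreal) \<in> borel_measurable M"
      unfolding indicator_def of_bool_def greaterThan_iff by measurable
    show ?thesis
      unfolding tail_eq_nn_integral using Gm1[of t] first_exceed_count[OF admissible_psi]
      by (subst nn_integral_add[symmetric]) (auto intro!: nn_integral_cong)
  qed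
  have "?L + ennreal \<alpha> * tail_int n = ennreal \<alpha> * tail_int (Suc n)"
  proof -
    have [measurable]: "(\<lambda>t. \<integral>\<^sup>+\<omega>. (\<integral>\<^sup>+i. ?F i t \<omega> \<partial>count_space UNIV) \<partial>M) \<in> borel_measurable borel"
      using Gm by (intro borel_measurable_nn_integral) (simp add: split_beta')
    have "?L + ennreal \<alpha> * tail_int n = (\<integral>\<^sup>+t. ennreal \<alpha> * (ennreal (exp (\<alpha> * t)) * (\<integral>\<^sup>+\<omega>. (\<integral>\<^sup>+i. ?F i t \<omega> \<partial>count_space UNIV) \<partial>M))
        + ennreal \<alpha> * gtail n t \<partial>lborel)"
      unfolding eq tail_int_def by (subst nn_integral_add) (simp_all add: nn_integral_cmult)
    also have "\<dots> = (\<integral>\<^sup>+t. ennreal \<alpha> * gtail (Suc n) t \<partial>lborel)"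
      unfolding gtail_def tails[symmetric] by (simp add: distrib_left)
    finally show ?thesis by (simp add: tail_int_def nn_integral_cmult)
  qed
  then have "?L + ennreal (\<alpha> * tail_mass n) = ennreal (\<alpha> * tail_mass (Suc n))"
    using alpha_pos by (simp add: tail_int_eq_mass ennreal_mult'[symmetric])
  from arg_cong[OF this, of "\<lambda>x. x - ennreal (\<alpha> * tail_mass n)"]
  have "?L = ennreal (\<alpha> * tail_mass (Suc n)) - ennreal (\<alpha> * tail_mass n)"
    by (subst (asm) ennreal_add_diff_cancel_right) simp_all
  also have "\<dots> = ennreal (\<alpha> * (tail_mass (Suc n) - tail_mass n))"
    using alpha_pos by (simp add: ennreal_minus tail_mass_def right_diff_distrib)
  finally show ?thesis .
qed

end

section \<open>Spine and change of measure\<close>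

text \<open>Nodes that precede a node of generation m have length at most m, so only the tree up to
  that generation enters. This allows marks off the tree to be replaced when measurability is
  checked.\<close>

lemma H_body_cong:
  assumes gen: "\<And>s. s \<le> m \<Longrightarrow> generation w' s = generation w s"
    and eq: "\<And>i. i \<in> tree w \<Longrightarrow> length i \<le> m \<Longrightarrow> w' i = w i"
    and i: "i \<in> generation w m"
  shows "H_body a w' i = H_body a w i"
proof -
  have tr: "j \<in> tree w' \<longleftrightarrow> j \<in> tree w" if "length j \<le> m" for j
    using gen[OF that] by (simp add: tree_iff)
  have pw: "path_weight w' j = path_weight w j" if j: "j \<in> tree w" "length j \<le> m" for j
    unfolding path_weight_def
  proof (rule prod.cong)
    fix r assume r: "r \<in> {..<length j}"
    have "take r j \<in> tree w" using j r by (auto simp: tree_iff generation_iff)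
    then have "w' (take r j) = w (take r j)" using j r by (intro eq) auto
    then show "mC (w' (take r j)) (j ! r) = mC (w (take r j)) (j ! r)" by simp
  qed simp
  have S: "node_S w' j = node_S w j" "node_Y w' j = node_Y w j" if "j \<in> tree w" "length j \<le> m" for j
    using pw[OF that] eq[OF that] by (simp_all add: node_S_def node_Y_def)
  have len: "length i = m" "i \<in> tree w" using i by (auto simp: generation_iff tree_iff)
  have sets: "{j \<in> tree w'. prec j i} = {j \<in> tree w. prec j i}"
    using tr prec_length len by blast
  have "(SUP j\<in>{j \<in> tree w'. prec j i}. node_S w' j + node_Y w' j) = (SUP j\<in>{j \<in> tree w. prec j i}. node_S w j + node_Y w j)"
    unfolding sets using S prec_length len by (intro SUP_cong) auto
  then show ?thesis using S[OF len(2)] len(1) by (simp add: H_body_def)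
qed

locale spine_branching = tilted_branching M \<psi>0 \<psi> \<alpha> \<beta> \<mu>
  for M :: "'a measure" and \<psi>0 :: "'a \<Rightarrow> mark" and \<psi> :: "nat list \<Rightarrow> 'a \<Rightarrow> mark" and \<alpha> \<beta> \<mu> :: real +
  fixes J :: "nat \<Rightarrow> 'a \<Rightarrow> nat list" and Pt :: "'a measure"
  assumes spine: "spine M \<alpha> \<psi> J" and tilted: "tilted_measure M \<alpha> \<psi> J Pt"
    and D_pos: "measure M {\<omega> \<in> space M. power_sum \<alpha> (\<psi>0 \<omega>) = 0} = 0"
begin

abbreviation "tree_at \<omega> \<equiv> (\<lambda>i. \<psi> i \<omega>)"

lemma measurable_J [measurable]: "J k \<in> measurable M (count_space UNIV)"
  using spine by (simp add: spine_def)

lemma J_0: "\<omega> \<in> space M \<Longrightarrow> J 0 \<omega> = []"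
  using spine by (simp add: spine_def)

lemma J_Suc: "\<omega> \<in> space M \<Longrightarrow> \<exists>c\<in>children (\<psi> (J k \<omega>) \<omega>). J (Suc k) \<omega> = J k \<omega> @ [c]"
  using spine by (simp add: spine_def)

lemma J_generation: "\<omega> \<in> space M \<Longrightarrow> J k \<omega> \<in> generation (tree_at \<omega>) k"
proof (induction k)
  case (Suc k)
  then show ?case using J_Suc[of \<omega> k] by (auto simp: generation.simps(2))
qed (simp add: J_0)

lemma length_J: "\<omega> \<in> space M \<Longrightarrow> length (J k \<omega>) = k"
  using J_generation length_generation by blast

lemma J_Ulam: "\<omega> \<in> space M \<Longrightarrow> J k \<omega> \<in> Ulam"
  using J_generation generation_subset_Ulam by blast

lemma J_take: "\<omega> \<in> space M \<Longrightarrow> r \<le> k \<Longrightarrow> J r \<omega> = take r (J k \<omega>)"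
proof (induction k)
  case (Suc k)
  obtain c where c: "J (Suc k) \<omega> = J k \<omega> @ [c]" using J_Suc[OF Suc.prems(1)] by blast
  show ?case
  proof (cases "r = Suc k")
    case True
    then show ?thesis using length_J[OF Suc.prems(1)] by (metis order_refl take_all)
  next
    case False
    then have "r \<le> k" using Suc.prems by simp
    then show ?thesis using Suc length_J[OF Suc.prems(1), of k] by (simp add: c)
  qed
qed (simp add: J_0)

text \<open>Infinite values are excluded by the mean being 1 and zero values by hypothesis (c);
  there are only countably many nodes, so one null set suffices for all of them.\<close>

lemma node_D_regular: "AE \<omega> in M. \<forall>i\<in>Ulam. 0 < node_D \<alpha> (tree_at \<omega>) i \<and> node_D \<alpha> (tree_at \<omega>) i < \<infinity>"
proof (rule AE_ball_countable')
  fix i assume i: "i \<in> Ulam"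
  have [measurable]: "(\<lambda>\<omega>. power_sum \<alpha> (\<psi> i \<omega>)) \<in> borel_measurable M"
    by (rule measurable_compose[OF measurable_psi[OF i] measurable_power_sum_mark])
  have "AE \<omega> in M. power_sum \<alpha> (\<psi> i \<omega>) \<noteq> \<infinity>"
    using nn_integral_psi[OF measurable_power_sum_mark i] mean_one by (intro nn_integral_PInf_AE) auto
  moreover have "AE \<omega> in M. power_sum \<alpha> (\<psi> i \<omega>) \<noteq> 0"
  proof -
    have [measurable]: "(\<lambda>m. indicator {0} (power_sum \<alpha> m) :: ennreal) \<in> borel_measurable mark_space"
      using measurable_power_sum_mark by measurable
    have "(\<integral>\<^sup>+\<omega>. indicator {0} (power_sum \<alpha> (\<psi> i \<omega>)) \<partial>M) = (\<integral>\<^sup>+\<omega>. indicator {0} (power_sum \<alpha> (\<psi>0 \<omega>)) \<partial>M)"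
      by (rule nn_integral_psi[OF _ i]) measurable
    also have "\<dots> = (\<integral>\<^sup>+\<omega>. indicator {\<omega> \<in> space M. power_sum \<alpha> (\<psi>0 \<omega>) = 0} \<omega> \<partial>M)"
      by (intro nn_integral_cong) (auto simp: indicator_def)
    also have "\<dots> = 0" using D_pos by (simp add: emeasure_eq_measure)
    finally have "(\<integral>\<^sup>+\<omega>. indicator {0} (power_sum \<alpha> (\<psi> i \<omega>)) \<partial>M) = 0" .
    then have "AE \<omega> in M. indicator {0} (power_sum \<alpha> (\<psi> i \<omega>)) = (0 :: ennreal)"
      by (subst (asm) nn_integral_0_iff_AE) auto
    then show ?thesis by eventually_elim (auto simp: indicator_def split: if_splits)
  qed
  ultimately show "AE \<omega> in M. 0 < node_D \<alpha> (tree_at \<omega>) i \<and> node_D \<alpha> (tree_at \<omega>) i < \<infinity>"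
    by eventually_elim (auto simp: node_D_def zero_less_iff_neq_zero less_top)
qed simp

text \<open>All marks and no spine: test variables of this kind are measurable for every
  \<open>spine_past\<close>, so they can be carried through successive conditionings.\<close>

definition mark_alg :: "'a measure" where
  "mark_alg = sigma (space M) {\<psi> i -` B \<inter> space M | i B. i \<in> Ulam \<and> B \<in> sets mark_space}"

lemma space_mark_alg: "space mark_alg = space M"
  unfolding mark_alg_def by (intro space_measure_of) auto

lemma measurable_psi_mark_alg: "i \<in> Ulam \<Longrightarrow> \<psi> i \<in> measurable mark_alg mark_space"
proof (rule measurableI)
  assume i: "i \<in> Ulam"
  show "\<psi> i \<omega> \<in> space mark_space" if "\<omega> \<in> space mark_alg" for \<omega>
    using measurable_space[OF measurable_psi[OF i]] that by (simp add: space_mark_alg)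
  show "\<psi> i -` B \<inter> space mark_alg \<in> sets mark_alg" if "B \<in> sets mark_space" for B
    unfolding space_mark_alg unfolding mark_alg_def using i that by (subst sets_measure_of) auto
qed

lemma space_spine_past: "space (spine_past M \<psi> J k) = space M"
  unfolding spine_past_def by (intro space_measure_of) auto

lemma sets_spine_past: "sets (spine_past M \<psi> J k) = sigma_sets (space M)
     ({\<psi> i -` B \<inter> space M | i B. i \<in> Ulam \<and> B \<in> sets mark_space} \<union>
      {J s -` B \<inter> space M | s B. s \<le> k})"
  unfolding spine_past_def by (intro sets_measure_of) auto

lemma subalgebra_spine_past: "subalgebra M (spine_past M \<psi> J k)"
  unfolding subalgebra_def space_spine_past sets_spine_past
  by (auto intro!: sets.sigma_sets_subset measurable_sets[OF measurable_psi] measurable_sets[OF measurable_J])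

lemma subalgebra_mark_alg: "subalgebra (spine_past M \<psi> J k) mark_alg"
  unfolding subalgebra_def space_spine_past space_mark_alg sets_spine_past
  unfolding mark_alg_def by (subst sets_measure_of) (auto intro!: sigma_sets_mono')

lemma measurable_J_past: "J k \<in> measurable (spine_past M \<psi> J k) (count_space UNIV)"
proof (rule measurableI)
  show "J k -` B \<inter> space (spine_past M \<psi> J k) \<in> sets (spine_past M \<psi> J k)" for B
    unfolding space_spine_past sets_spine_past by (rule sigma_sets.Basic) blast
qed simp

text \<open>The last step of the spine is integrated out by conditioning on the marks and the spine
  so far. Its probability is a function of the marks and is absorbed into \<open>Z\<close>, which is
  why the induction runs over arbitrary \<open>Z\<close>.\<close>

lemma many_to_one:
  assumes "i \<in> Ulam" "Z \<in> borel_measurable mark_alg"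
  shows "(\<integral>\<^sup>+\<omega>. of_bool (J (length i) \<omega> = i) * Z \<omega> \<partial>M) =
    (\<integral>\<^sup>+\<omega>. of_bool (i \<in> generation (tree_at \<omega>) (length i)) *
      ((\<Prod>r<length i. ennreal (mC (\<psi> (take r i) \<omega>) (i ! r) powr \<alpha>) / node_D \<alpha> (tree_at \<omega>) (take r i)) * Z \<omega>) \<partial>M)"
  using assms
proof (induction i arbitrary: Z rule: rev_induct)
  case Nil
  show ?case by (intro nn_integral_cong) (simp add: J_0)
next
  case (snoc c i)
  let ?k = "length i"
  let ?past = "spine_past M \<psi> J ?k"
  have i: "i \<in> Ulam" "1 \<le> c" using snoc.prems by auto
  interpret finite_measure_subalgebra M ?past
    by standard (rule subalgebra_spine_past)
  \<comment> \<open>The indicator of \<open>c\<close> being a child is included because the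
    conditional probability is prescribed only for children; the spine always moves to a child, so
    nothing is lost.\<close>
  define f where "f \<omega> = of_bool (J ?k \<omega> = i) * (of_bool (c \<in> children (\<psi> i \<omega>)) * Z \<omega>)" for \<omega>
  define E where "E = {\<omega> \<in> space M. J (Suc ?k) \<omega> = J ?k \<omega> @ [c]}"
  define Z' where "Z' \<omega> = of_bool (c \<in> children (\<psi> i \<omega>)) *
    (ennreal (mC (\<psi> i \<omega>) c powr \<alpha>) / node_D \<alpha> (tree_at \<omega>) i * Z \<omega>)" for \<omega>
  note [measurable] = measurable_psi_mark_alg[OF i(1)]
  have [measurable]: "(\<lambda>m. mC m c) \<in> borel_measurable mark_space" using i(2) by (rule measurable_mC)
  have [measurable]: "(\<lambda>\<omega>. node_D \<alpha> (tree_at \<omega>) i) \<in> borel_measurable mark_alg"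
    using measurable_node_D[OF measurable_psi_mark_alg i(1)] .
  have Zm [measurable]: "Z \<in> borel_measurable mark_alg" by fact
  have Z'm: "Z' \<in> borel_measurable mark_alg" unfolding Z'_def of_bool_def by measurable
  have "(\<lambda>\<omega>. of_bool (c \<in> children (\<psi> i \<omega>)) * Z \<omega>) \<in> borel_measurable mark_alg"
    unfolding of_bool_def by measurable
  then have [measurable]: "(\<lambda>\<omega>. of_bool (c \<in> children (\<psi> i \<omega>)) * Z \<omega>) \<in> borel_measurable ?past"
    by (rule measurable_from_subalg[OF subalgebra_mark_alg])
  note [measurable] = measurable_J_past
  have fm: "f \<in> borel_measurable ?past" unfolding f_def of_bool_def[of "J _ _ = _"] by measurable
  have Em: "E \<in> sets M" unfolding E_def by measurable
  have "(\<integral>\<^sup>+\<omega>. of_bool (J (length (i @ [c])) \<omega> = i @ [c]) * Z \<omega> \<partial>M) = (\<integral>\<^sup>+\<omega>. f \<omega> * indicator E \<omega> \<partial>M)"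
  proof (rule nn_integral_cong)
    fix \<omega> assume \<omega>: "\<omega> \<in> space M"
    obtain d where d: "d \<in> children (\<psi> (J ?k \<omega>) \<omega>)" "J (Suc ?k) \<omega> = J ?k \<omega> @ [d]"
      using J_Suc[OF \<omega>] by blast
    show "of_bool (J (length (i @ [c])) \<omega> = i @ [c]) * Z \<omega> = f \<omega> * indicator E \<omega>"
      using d \<omega> by (auto simp: f_def E_def indicator_def)
  qed
  also have "\<dots> = (\<integral>\<^sup>+\<omega>. f \<omega> * nn_cond_exp M ?past (indicator E) \<omega> \<partial>M)"
    using fm Em by (intro nn_cond_exp_intg[symmetric]) auto
  also have "\<dots> = (\<integral>\<^sup>+\<omega>. of_bool (J ?k \<omega> = i) * Z' \<omega> \<partial>M)"
  proof (rule nn_integral_cong_AE)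
    have "AE \<omega> in M. c \<in> children (\<psi> (J ?k \<omega>) \<omega>) \<longrightarrow> nn_cond_exp M ?past (indicator E) \<omega>
        = ennreal (mC (\<psi> (J ?k \<omega>) \<omega>) c powr \<alpha>) / node_D \<alpha> (\<lambda>i. \<psi> i \<omega>) (J ?k \<omega>)"
      using spine i(2) unfolding spine_def E_def by blast
    then show "AE \<omega> in M. f \<omega> * nn_cond_exp M ?past (indicator E) \<omega> = of_bool (J ?k \<omega> = i) * Z' \<omega>"
      by eventually_elim (auto simp: f_def Z'_def mult_ac)
  qed
  also have "\<dots> = (\<integral>\<^sup>+\<omega>. of_bool (i \<in> generation (tree_at \<omega>) ?k) *
      ((\<Prod>r<?k. ennreal (mC (\<psi> (take r i) \<omega>) (i ! r) powr \<alpha>) / node_D \<alpha> (tree_at \<omega>) (take r i)) * Z' \<omega>) \<partial>M)"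
    by (rule snoc.IH[OF i(1) Z'm])
  also have "\<dots> = (\<integral>\<^sup>+\<omega>. of_bool (i @ [c] \<in> generation (tree_at \<omega>) (length (i @ [c]))) *
      ((\<Prod>r<length (i @ [c]). ennreal (mC (\<psi> (take r (i @ [c])) \<omega>) ((i @ [c]) ! r) powr \<alpha>) /
        node_D \<alpha> (tree_at \<omega>) (take r (i @ [c]))) * Z \<omega>) \<partial>M)"
  proof (rule nn_integral_cong)
    fix \<omega>
    have gen: "i @ [c] \<in> generation (tree_at \<omega>) (Suc ?k) \<longleftrightarrow> i \<in> generation (tree_at \<omega>) ?k \<and> c \<in> children (\<psi> i \<omega>)"
      by (auto simp: generation.simps(2))
    have pr: "(\<Prod>r<Suc ?k. ennreal (mC (\<psi> (take r (i @ [c])) \<omega>) ((i @ [c]) ! r) powr \<alpha>) /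
        node_D \<alpha> (tree_at \<omega>) (take r (i @ [c]))) =
      (\<Prod>r<?k. ennreal (mC (\<psi> (take r i) \<omega>) (i ! r) powr \<alpha>) / node_D \<alpha> (tree_at \<omega>) (take r i)) *
       (ennreal (mC (\<psi> i \<omega>) c powr \<alpha>) / node_D \<alpha> (tree_at \<omega>) i)"
      by (simp add: nth_append)
    show "of_bool (i \<in> generation (tree_at \<omega>) ?k) *
      ((\<Prod>r<?k. ennreal (mC (\<psi> (take r i) \<omega>) (i ! r) powr \<alpha>) / node_D \<alpha> (tree_at \<omega>) (take r i)) * Z' \<omega>)
      = of_bool (i @ [c] \<in> generation (tree_at \<omega>) (length (i @ [c]))) *
      ((\<Prod>r<length (i @ [c]). ennreal (mC (\<psi> (take r (i @ [c])) \<omega>) ((i @ [c]) ! r) powr \<alpha>) /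
        node_D \<alpha> (tree_at \<omega>) (take r (i @ [c]))) * Z \<omega>)"
      unfolding length_append_singleton pr gen Z'_def by (simp only: of_bool_conj mult_ac)
  qed
  finally show ?case .
qed

lemma space_G_alg: "space (G_alg M \<psi> J k) = space M"
  unfolding G_alg_def F_gen_def by (intro space_measure_of) auto

lemma sets_G_alg: "sets (G_alg M \<psi> J k) = sigma_sets (space M) (F_gen M \<psi> k \<union> {J s -` B \<inter> space M | s B. s \<le> k})"
  unfolding G_alg_def by (intro sets_measure_of) (auto simp: F_gen_def)

lemma subalgebra_G_alg: "subalgebra M (G_alg M \<psi> J k)"
proof -
  have "{\<omega> \<in> space M. i \<in> generation (tree_at \<omega>) s \<and> \<psi> i \<omega> \<in> B} \<in> sets M"
    if i: "i \<in> Ulam" and B: "B \<in> sets mark_space" for i s B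
  proof -
    note [measurable] = measurable_generation[OF measurable_psi i] measurable_psi[OF i] B
    show ?thesis by measurable
  qed
  then have "F_gen M \<psi> k \<union> {J s -` B \<inter> space M | s B. s \<le> k} \<subseteq> sets M"
    by (auto simp: F_gen_def intro!: measurable_sets[OF measurable_J])
  then show ?thesis
    unfolding subalgebra_def space_G_alg sets_G_alg by (simp add: sets.sigma_sets_subset)
qed

lemma subalgebra_Pt: "subalgebra Pt (G_alg M \<psi> J k)"
proof -
  let ?S = "sigma (space M) (\<Union>k. sets (G_alg M \<psi> J k))"
  have P: "(\<Union>k. sets (G_alg M \<psi> J k)) \<subseteq> Pow (space M)"
    using subalgebra_G_alg sets.sets_into_space by (fastforce simp: subalgebra_def)
  have s: "sets Pt = sets ?S" using tilted by (simp add: tilted_measure_def)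
  then have "space Pt = space M"
    using sets_eq_imp_space_eq[OF s] space_measure_of[OF P] by simp
  moreover have "sets (G_alg M \<psi> J k) \<subseteq> sets Pt"
    unfolding s sets_measure_of[OF P] by (auto intro: sigma_sets.Basic)
  ultimately show ?thesis by (simp add: subalgebra_def space_G_alg)
qed

lemma measurable_spine_L [measurable]: "spine_L \<alpha> \<psi> J k \<in> borel_measurable M"
proof -
  have "(\<lambda>\<omega>. node_D \<alpha> (tree_at \<omega>) (J r \<omega>)) \<in> borel_measurable M" for r
  proof -
    \<comment> \<open>Measurability of marks is available only for nodes in \<open>Ulam\<close>; the
      default 0 elsewhere is never reached by the spine.\<close>
    have "(\<lambda>\<omega>. if i \<in> Ulam then node_D \<alpha> (tree_at \<omega>) i else 0) \<in> borel_measurable M" for i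
      using measurable_node_D[OF measurable_psi, where i = i and a = \<alpha>] by (cases "i \<in> Ulam") auto
    from measurable_compose_countable[OF this measurable_J[of r]]
    have "(\<lambda>\<omega>. if J r \<omega> \<in> Ulam then node_D \<alpha> (tree_at \<omega>) (J r \<omega>) else 0) \<in> borel_measurable M" .
    then show ?thesis
      by (subst measurable_cong[where g = "\<lambda>\<omega>. if J r \<omega> \<in> Ulam then node_D \<alpha> (tree_at \<omega>) (J r \<omega>) else 0"])
        (auto simp: J_Ulam)
  qed
  then show ?thesis unfolding spine_L_def[abs_def] by (intro borel_measurable_prod_ennreal)
qed

text \<open>The tilt is prescribed on events. Equality of the restrictions of \<open>Pt\<close> and
  of the density measure to the sub-sigma-algebra carries it over to functions measurable
  there.\<close>

lemma nn_integral_Pt: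
  assumes g: "g \<in> borel_measurable (G_alg M \<psi> J k)"
  shows "(\<integral>\<^sup>+\<omega>. g \<omega> \<partial>Pt) = (\<integral>\<^sup>+\<omega>. g \<omega> * spine_L \<alpha> \<psi> J k \<omega> \<partial>M)"
proof -
  let ?G = "G_alg M \<psi> J k" and ?L = "spine_L \<alpha> \<psi> J k"
  have sub: "subalgebra (density M ?L) ?G"
    using subalgebra_G_alg by (simp add: subalgebra_def)
  have eq: "restr_to_subalg Pt ?G = restr_to_subalg (density M ?L) ?G"
  proof (rule measure_eqI)
    show "sets (restr_to_subalg Pt ?G) = sets (restr_to_subalg (density M ?L) ?G)"
      using sets_restr_to_subalg[OF sub] sets_restr_to_subalg[OF subalgebra_Pt] by simp
    fix A assume "A \<in> sets (restr_to_subalg Pt ?G)"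
    then have A: "A \<in> sets ?G" using sets_restr_to_subalg[OF subalgebra_Pt] by simp
    then have AM: "A \<in> sets M" using subalgebra_G_alg by (auto simp: subalgebra_def)
    have "emeasure (restr_to_subalg Pt ?G) A = (\<integral>\<^sup>+\<omega>. indicator A \<omega> * ?L \<omega> \<partial>M)"
      using emeasure_restr_to_subalg[OF subalgebra_Pt A] tilted A by (simp add: tilted_measure_def)
    also have "\<dots> = emeasure (restr_to_subalg (density M ?L) ?G) A"
      using emeasure_restr_to_subalg[OF sub A] AM by (simp add: emeasure_density mult.commute)
    finally show "emeasure (restr_to_subalg Pt ?G) A = emeasure (restr_to_subalg (density M ?L) ?G) A" .
  qed
  have "(\<integral>\<^sup>+\<omega>. g \<omega> \<partial>Pt) = (\<integral>\<^sup>+\<omega>. g \<omega> \<partial>density M ?L)"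
    using nn_integral_subalgebra2[OF subalgebra_Pt g] nn_integral_subalgebra2[OF sub g] eq by simp
  also have "\<dots> = (\<integral>\<^sup>+\<omega>. g \<omega> * ?L \<omega> \<partial>M)"
    using measurable_from_subalg[OF subalgebra_G_alg g]
    by (subst nn_integral_density) (auto simp: mult.commute)
  finally show ?thesis .
qed

text \<open>The mark of a node off the tree is not \<open>\<G>\<^sub>m\<^sub>+\<^sub>1\<close>-measurable; replacing it by a constant makes the
  whole family measurable and leaves the integrand unchanged.\<close>
lemma measurable_H_integrand: "H_integrand \<alpha> \<psi> J m \<in> borel_measurable (G_alg M \<psi> J (Suc m))"
proof -
  let ?G = "G_alg M \<psi> J (Suc m)"
  define m0 :: mark where "m0 = (0, 0, \<lambda>j\<in>{1..}. 0)"
  have m0: "m0 \<in> space mark_space"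
    by (auto simp: m0_def mark_space_def space_pair_measure space_PiM)
  define X where "X \<omega> i = (if i \<in> generation (tree_at \<omega>) (length i) \<and> length i \<le> m then \<psi> i \<omega> else m0)" for \<omega> i
  \<comment> \<open>Marks of generation m belong to the generators with s < Suc m; this is where the
    index \<open>Suc m\<close> is needed.\<close>
  have gset: "{\<omega> \<in> space M. i \<in> generation (tree_at \<omega>) (length i) \<and> \<psi> i \<omega> \<in> B} \<in> sets ?G"
    if "i \<in> Ulam" "length i \<le> m" "B \<in> sets mark_space" for i B
    unfolding sets_G_alg F_gen_def using that by (intro sigma_sets.Basic) (auto simp: less_Suc_eq_le)
  have Xm: "(\<lambda>\<omega>. X \<omega> i) \<in> measurable ?G mark_space" if i: "i \<in> Ulam" for i
  proof (cases "length i \<le> m")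
    case True
    show ?thesis
    proof (rule measurableI)
      show "X \<omega> i \<in> space mark_space" if "\<omega> \<in> space ?G" for \<omega>
        using measurable_space[OF measurable_psi[OF i]] that m0 by (auto simp: X_def space_G_alg)
      fix B assume B: "B \<in> sets mark_space"
      let ?A = "{\<omega> \<in> space M. i \<in> generation (tree_at \<omega>) (length i) \<and> \<psi> i \<omega> \<in> B}"
      let ?C = "{\<omega> \<in> space M. i \<in> generation (tree_at \<omega>) (length i) \<and> \<psi> i \<omega> \<in> space mark_space}"
      have "(\<lambda>\<omega>. X \<omega> i) -` B \<inter> space ?G = (if m0 \<in> B then ?A \<union> (space ?G - ?C) else ?A)"
        using measurable_space[OF measurable_psi[OF i]] True
        by (auto simp: X_def space_G_alg split: if_splits)
      moreover have "?A \<in> sets ?G" "?C \<in> sets ?G" using gset[OF i True] B by blast+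
      ultimately show "(\<lambda>\<omega>. X \<omega> i) -` B \<inter> space ?G \<in> sets ?G" by auto
    qed
  next
    case False
    then have "(\<lambda>\<omega>. X \<omega> i) = (\<lambda>_. m0)" by (auto simp: X_def)
    then show ?thesis using m0 by simp
  qed
  have Jm: "J m \<in> measurable ?G (count_space UNIV)"
  proof (rule measurableI)
    show "J m -` B \<inter> space ?G \<in> sets ?G" for B
      unfolding space_G_alg sets_G_alg by (rule sigma_sets.Basic) (auto intro: le_SucI)
  qed simp
  have gen: "generation (X \<omega>) s = generation (tree_at \<omega>) s" if "s \<le> Suc m" for s \<omega>
    using that
  proof (induction s)
    case (Suc s)
    have "children (X \<omega> i) = children (\<psi> i \<omega>)" if "i \<in> generation (tree_at \<omega>) s" for i
      using that Suc.prems length_generation[OF that] by (simp add: X_def)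
    then show ?case using Suc by (auto simp: generation.simps(2))
  qed simp
  have Xeq: "X \<omega> i = \<psi> i \<omega>" if "i \<in> tree (tree_at \<omega>)" "length i \<le> m" for i \<omega>
    using that by (simp add: X_def tree_iff)
  define f where "f i \<omega> = (if i \<in> Ulam then H_body \<alpha> (X \<omega>) i * inverse (node_D \<alpha> (X \<omega>) i) else 0)" for i \<omega>
  have "f i \<in> borel_measurable ?G" for i
  proof (cases "i \<in> Ulam")
    case True
    note [measurable] = measurable_H_body[OF Xm True] measurable_node_D[OF Xm True]
    show ?thesis using True unfolding f_def by simp
  qed (simp add: f_def[abs_def])
  then have fm: "(\<lambda>\<omega>. f (J m \<omega>) \<omega>) \<in> borel_measurable ?G"
    by (rule measurable_compose_countable[OF _ Jm])
  have "H_integrand \<alpha> \<psi> J m \<omega> = f (J m \<omega>) \<omega>" if "\<omega> \<in> space ?G" for \<omega>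
  proof -
    have \<omega>: "\<omega> \<in> space M" using that by (simp add: space_G_alg)
    have "H_body \<alpha> (X \<omega>) (J m \<omega>) = H_body \<alpha> (tree_at \<omega>) (J m \<omega>)"
      by (rule H_body_cong[OF gen Xeq J_generation[OF \<omega>]]) auto
    moreover have "X \<omega> (J m \<omega>) = \<psi> (J m \<omega>) \<omega>"
      using J_generation[OF \<omega>, of m] length_J[OF \<omega>, of m] by (simp add: X_def)
    ultimately show ?thesis
      using J_Ulam[OF \<omega>] by (simp add: f_def H_integrand_eq node_D_def)
  qed
  then show ?thesis using fm by (subst measurable_cong) auto
qed

lemma path_weight_powr:
  "ennreal (path_weight w i powr a) = (\<Prod>r<length i. ennreal (mC (w (take r i)) (i ! r) powr a))"
  unfolding path_weight_def prod_powr_distrib by (simp add: prod_ennreal)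

lemma ennreal_divide_cancel: "0 < d \<Longrightarrow> d < \<infinity> \<Longrightarrow> c / d * d = (c :: ennreal)"
  using ennreal_mult_divide_eq[of d c] ennreal_times_divide[of d c d] by (auto simp: mult.commute)

text \<open>The density with index m + 1 contributes one factor D for each node from the root to the
  spine node of generation m. The last cancels the inverse D of the integrand, and the others cancel
  the denominators of the spine probabilities, so that \<open>many_to_one\<close> leaves a sum over
  generation m weighted by the path weight to the power \<alpha>.\<close>

theorem H_integral:
  "(\<integral>\<^sup>+\<omega>. H_integrand \<alpha> \<psi> J (Suc n) \<omega> \<partial>Pt) = ennreal (\<alpha> * (tail_mass (Suc n) - tail_mass n))"
proof -
  let ?m = "Suc n"
  let ?D = "\<lambda>\<omega> i. node_D \<alpha> (tree_at \<omega>) i"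
  \<comment> \<open>The factor 0 off generation m and off \<open>Ulam\<close> makes every
    \<open>Z i\<close> measurable; the spine never visits those nodes at time m.\<close>
  define Z where "Z i \<omega> = (if i \<in> Ulam \<and> length i = ?m then
      H_body \<alpha> (tree_at \<omega>) i * inverse (?D \<omega> i) * (\<Prod>r<Suc ?m. ?D \<omega> (take r i)) else 0)" for i \<omega>
  have Zm: "Z i \<in> borel_measurable mark_alg" for i
  proof (cases "i \<in> Ulam \<and> length i = ?m")
    case True
    then have i: "i \<in> Ulam" by simp
    note [measurable] = measurable_H_body[OF measurable_psi_mark_alg i] measurable_node_D[OF measurable_psi_mark_alg i]
      measurable_node_D[OF measurable_psi_mark_alg take_Ulam[OF i]]
    show ?thesis using True unfolding Z_def by (simp del: prod.lessThan_Suc)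
  next
    case False
    then have "Z i = (\<lambda>_. 0)" by (auto simp: Z_def fun_eq_iff)
    then show ?thesis by simp
  qed
  have Zm': "(\<lambda>\<omega>. of_bool (J ?m \<omega> = i) * Z i \<omega>) \<in> borel_measurable M" for i
  proof -
    have [measurable]: "Z i \<in> borel_measurable M"
      by (rule measurable_from_subalg[OF subalgebra_spine_past[of 0] measurable_from_subalg[OF subalgebra_mark_alg Zm]])
    show ?thesis unfolding of_bool_def by measurable
  qed
  have "(\<integral>\<^sup>+\<omega>. H_integrand \<alpha> \<psi> J ?m \<omega> \<partial>Pt) = (\<integral>\<^sup>+\<omega>. H_integrand \<alpha> \<psi> J ?m \<omega> * spine_L \<alpha> \<psi> J (Suc ?m) \<omega> \<partial>M)"
    by (rule nn_integral_Pt[OF measurable_H_integrand])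
  also have "\<dots> = (\<integral>\<^sup>+\<omega>. (\<integral>\<^sup>+i. of_bool (J ?m \<omega> = i) * Z i \<omega> \<partial>count_space UNIV) \<partial>M)"
  proof (rule nn_integral_cong)
    fix \<omega> assume \<omega>: "\<omega> \<in> space M"
    have "(\<integral>\<^sup>+i. of_bool (J ?m \<omega> = i) * Z i \<omega> \<partial>count_space UNIV) =
        (\<integral>\<^sup>+i. Z (J ?m \<omega>) \<omega> * indicator {J ?m \<omega>} i \<partial>count_space UNIV)"
      by (intro nn_integral_cong) (auto simp: indicator_def)
    also have "\<dots> = Z (J ?m \<omega>) \<omega>" by (subst nn_integral_cmult_indicator) auto
    also have "\<dots> = H_integrand \<alpha> \<psi> J ?m \<omega> * (\<Prod>r<Suc ?m. ?D \<omega> (take r (J ?m \<omega>)))"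
      using J_Ulam[OF \<omega>] length_J[OF \<omega>] by (simp add: Z_def H_integrand_eq del: prod.lessThan_Suc)
    also have "(\<Prod>r<Suc ?m. ?D \<omega> (take r (J ?m \<omega>))) = spine_L \<alpha> \<psi> J (Suc ?m) \<omega>"
      unfolding spine_L_def by (intro prod.cong) (auto simp: J_take[OF \<omega>, symmetric])
    finally show "H_integrand \<alpha> \<psi> J ?m \<omega> * spine_L \<alpha> \<psi> J (Suc ?m) \<omega> =
        (\<integral>\<^sup>+i. of_bool (J ?m \<omega> = i) * Z i \<omega> \<partial>count_space UNIV)" by simp
  qed
  also have "\<dots> = (\<integral>\<^sup>+i. (\<integral>\<^sup>+\<omega>. of_bool (J ?m \<omega> = i) * Z i \<omega> \<partial>M) \<partial>count_space UNIV)"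
    by (rule nn_integral_count_swap[OF sigma_finite_measure_axioms Zm'])
  also have "\<dots> = (\<integral>\<^sup>+i. (\<integral>\<^sup>+\<omega>. of_bool (i \<in> generation (tree_at \<omega>) ?m) *
      (ennreal (path_weight (tree_at \<omega>) i powr \<alpha>) * H_body \<alpha> (tree_at \<omega>) i) \<partial>M) \<partial>count_space UNIV)"
  proof (rule nn_integral_cong)
    fix i :: "nat list"
    show "(\<integral>\<^sup>+\<omega>. of_bool (J ?m \<omega> = i) * Z i \<omega> \<partial>M) = (\<integral>\<^sup>+\<omega>. of_bool (i \<in> generation (tree_at \<omega>) ?m) *
      (ennreal (path_weight (tree_at \<omega>) i powr \<alpha>) * H_body \<alpha> (tree_at \<omega>) i) \<partial>M)"
    proof (cases "i \<in> Ulam \<and> length i = ?m")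
      case True
      then have i: "i \<in> Ulam" and len: "length i = ?m" by auto
      have "(\<integral>\<^sup>+\<omega>. of_bool (J ?m \<omega> = i) * Z i \<omega> \<partial>M) = (\<integral>\<^sup>+\<omega>. of_bool (i \<in> generation (tree_at \<omega>) ?m) *
        ((\<Prod>r<?m. ennreal (mC (\<psi> (take r i) \<omega>) (i ! r) powr \<alpha>) / ?D \<omega> (take r i)) * Z i \<omega>) \<partial>M)"
        using many_to_one[OF i Zm[of i]] unfolding len .
      also have "\<dots> = (\<integral>\<^sup>+\<omega>. of_bool (i \<in> generation (tree_at \<omega>) ?m) *
          (ennreal (path_weight (tree_at \<omega>) i powr \<alpha>) * H_body \<alpha> (tree_at \<omega>) i) \<partial>M)"
        using node_D_regular AE_space[of M]
      proof (intro nn_integral_cong_AE, eventually_elim)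
        case (elim \<omega>)
        let ?c = "\<lambda>r. ennreal (mC (\<psi> (take r i) \<omega>) (i ! r) powr \<alpha>)"
        have D: "0 < ?D \<omega> j" "?D \<omega> j < \<infinity>" if "j \<in> Ulam" for j using elim(3) that by auto
        have "(\<Prod>r<?m. ?c r / ?D \<omega> (take r i)) * Z i \<omega> =
          ((\<Prod>r<?m. ?c r / ?D \<omega> (take r i)) * (\<Prod>r<?m. ?D \<omega> (take r i))) *
          (H_body \<alpha> (tree_at \<omega>) i / ?D \<omega> i * ?D \<omega> i)"
          using i len by (simp add: Z_def prod.lessThan_Suc[of _ "Suc n"] divide_ennreal_def mult_ac del: prod.lessThan_Suc)
        also have "\<dots> = (\<Prod>r<?m. ?c r) * H_body \<alpha> (tree_at \<omega>) i"
          using D[OF take_Ulam[OF i]] D[OF i]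
          by (simp add: prod.distrib[symmetric] ennreal_divide_cancel del: prod.lessThan_Suc)
        also have "(\<Prod>r<?m. ?c r) = ennreal (path_weight (tree_at \<omega>) i powr \<alpha>)"
          using path_weight_powr[of "tree_at \<omega>" i \<alpha>] len by simp
        finally show ?case by simp
      qed
      finally show ?thesis .
    next
      case False
      then have "i \<notin> generation (tree_at \<omega>) ?m" for \<omega>
        using generation_subset_Ulam length_generation by blast
      moreover have "Z i \<omega> = 0" for \<omega> using False by (auto simp: Z_def)
      ultimately show ?thesis by simp
    qed
  qed
  also have "\<dots> = ennreal (\<alpha> * (tail_mass ?m - tail_mass n))" by (rule first_exceed_mass)
  finally show ?thesis .
qed

end

theorem theorem3p1:
  fixes M Pt :: "'a measure"
    and \<psi>0 :: "'a \<Rightarrow> mark"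
    and \<psi> :: "nat list \<Rightarrow> 'a \<Rightarrow> mark"
    and J :: "nat \<Rightarrow> 'a \<Rightarrow> nat list"
    and \<alpha> \<beta> \<mu> :: real
  assumes "prob_space M"
    and "random_mark M \<psi>0"
    and "measure M {\<omega> \<in> space M. 0 < mQ (\<psi>0 \<omega>)} > 0"
    and "iid_copies M \<psi>0 \<psi>"
    and "\<alpha> > 0"
    and "spine M \<alpha> \<psi> J"
    and "tilted_measure M \<alpha> \<psi> J Pt"
    and a1: "(\<integral>\<^sup>+\<omega>. power_sum \<alpha> (\<psi>0 \<omega>) \<partial>M) = 1"
    and a2: "AE \<omega> in M. summable (\<lambda>j. \<bar>log_term \<alpha> (\<psi>0 \<omega>) j\<bar>)"
            "integrable M (\<lambda>\<omega>. \<Sum>j. log_term \<alpha> (\<psi>0 \<omega>) j)"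
            "\<mu> = (\<integral>\<omega>. (\<Sum>j. log_term \<alpha> (\<psi>0 \<omega>) j) \<partial>M)"
            "\<mu> > 0"
    and b: "0 < \<beta>" "\<beta> < \<alpha>" "(\<integral>\<^sup>+\<omega>. power_sum \<beta> (\<psi>0 \<omega>) \<partial>M) < 1"
           "(\<integral>\<^sup>+\<omega>. ennreal (mQ (\<psi>0 \<omega>) powr \<alpha>) \<partial>M) < \<infinity>"
    and c: "measure M {\<omega> \<in> space M. power_sum \<alpha> (\<psi>0 \<omega>) = 0} = 0"
    and d: "\<not> arithmetic (eta M \<alpha> \<psi>0)"
    and e: "(\<integral>\<^sup>+\<omega>. power_sum \<alpha> (\<psi>0 \<omega>)
               * elog_pos (max (ennreal (mQ (\<psi>0 \<omega>) powr \<alpha>)) (power_sum \<alpha> (\<psi>0 \<omega>))) \<partial>M) < \<infinity>"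
  shows "\<exists>H::real. H \<ge> 0
    \<and> (\<lambda>m. (\<integral>\<^sup>+\<omega>. H_integrand \<alpha> \<psi> J m \<omega> \<partial>Pt) / ennreal (\<alpha> * \<mu>)) \<longlonglongrightarrow> ennreal H
    \<and> ((\<lambda>t::real. exp (\<alpha> * t) * measure M {\<omega> \<in> space M. max_W (\<lambda>i. \<psi> i \<omega>) > ereal t}) \<longlongrightarrow> H) at_top
    \<and> ((\<alpha> > 1 \<and> (\<integral>\<^sup>+\<omega>. epowr (power_sum 1 (\<psi>0 \<omega>)) \<alpha> \<partial>M) < \<infinity>
        \<or> \<alpha> \<le> 1 \<and> (\<exists>\<epsilon>>0. \<epsilon> < 1 \<and>
            (\<integral>\<^sup>+\<omega>. epowr (power_sum (\<alpha> / (1 + \<epsilon>)) (\<psi>0 \<omega>)) (1 + \<epsilon>) \<partial>M) < \<infinity>))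
       \<longrightarrow> H > 0)"
proof -
  interpret S: spine_branching M \<psi>0 \<psi> \<alpha> \<beta> \<mu> J Pt
    using assms
    by (simp add: spine_branching_def spine_branching_axioms_def tilted_branching_def
        tilted_branching_axioms_def branching_def branching_axioms_def)
  let ?H = "S.qW_int / \<mu>"
  have "?H \<ge> 0" using S.qW_int_nonneg a2(4) by simp
  moreover have "(\<lambda>m. (\<integral>\<^sup>+\<omega>. H_integrand \<alpha> \<psi> J m \<omega> \<partial>Pt) / ennreal (\<alpha> * \<mu>)) \<longlonglongrightarrow> ennreal ?H"
  \<comment> \<open>The telescoped formula compares a generation with its predecessor, so it starts
    at generation 1.\<close>
  proof (rule LIMSEQ_imp_Suc)
    have "(\<integral>\<^sup>+\<omega>. H_integrand \<alpha> \<psi> J (Suc n) \<omega> \<partial>Pt) / ennreal (\<alpha> * \<mu>) =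
        ennreal ((S.tail_mass (Suc n) - S.tail_mass n) / \<mu>)" for n
      unfolding S.H_integral using S.tail_mass_mono[of n] a2(4) \<open>\<alpha> > 0\<close> by (simp add: divide_ennreal)
    moreover have "(\<lambda>n. ennreal ((S.tail_mass (Suc n) - S.tail_mass n) / \<mu>)) \<longlonglongrightarrow> ennreal ?H"
      using a2(4) by (intro tendsto_ennrealI tendsto_divide S.tail_mass_increment tendsto_const) auto
    ultimately show "(\<lambda>n. (\<integral>\<^sup>+\<omega>. H_integrand \<alpha> \<psi> J (Suc n) \<omega> \<partial>Pt) / ennreal (\<alpha> * \<mu>)) \<longlonglongrightarrow> ennreal ?H"
      by simp
  qed
  moreover have "((\<lambda>t. exp (\<alpha> * t) * measure M {\<omega> \<in> space M. max_W (\<lambda>i. \<psi> i \<omega>) > ereal t}) \<longlongrightarrow> ?H) at_top"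
    using S.gW_tendsto unfolding S.gW_def[abs_def] S.W_tail_def .
  moreover have "?H > 0"
    if "\<alpha> > 1 \<and> (\<integral>\<^sup>+\<omega>. epowr (power_sum 1 (\<psi>0 \<omega>)) \<alpha> \<partial>M) < \<infinity>
        \<or> \<alpha> \<le> 1 \<and> (\<exists>\<epsilon>>0. \<epsilon> < 1 \<and> (\<integral>\<^sup>+\<omega>. epowr (power_sum (\<alpha> / (1 + \<epsilon>)) (\<psi>0 \<omega>)) (1 + \<epsilon>) \<partial>M) < \<infinity>)"
    using that
  \<comment> \<open>The two cases instantiate \<open>k\<close> in \<open>qW_int_pos\<close> by 1 and
    by \<alpha> / (1 + \<epsilon>); both lie below \<alpha>, and \<alpha> / k is the outer exponent
    of the respective moment condition.\<close>
  proof (elim disjE conjE exE)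
    assume "\<alpha> > 1" "(\<integral>\<^sup>+\<omega>. epowr (power_sum 1 (\<psi>0 \<omega>)) \<alpha> \<partial>M) < \<infinity>"
    then show ?thesis using S.qW_int_pos[of 1] assms(3) a2(4) by simp
  next
    fix \<epsilon> :: real
    assume "\<epsilon> > 0" "(\<integral>\<^sup>+\<omega>. epowr (power_sum (\<alpha> / (1 + \<epsilon>)) (\<psi>0 \<omega>)) (1 + \<epsilon>) \<partial>M) < \<infinity>"
    moreover from this \<open>\<alpha> > 0\<close> have "\<alpha> / (\<alpha> / (1 + \<epsilon>)) = 1 + \<epsilon>" "0 < \<alpha> / (1 + \<epsilon>)" "\<alpha> / (1 + \<epsilon>) < \<alpha>"
      by (simp_all add: field_simps)
    ultimately show ?thesis using S.qW_int_pos[of "\<alpha> / (1 + \<epsilon>)"] assms(3) a2(4) by simp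
  qed
  ultimately show ?thesis by blast
qed

end
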